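(* Let $n\ge2$, $K\in\mathcal K^2_+$ and $T\in GL_n$. For a measurable function $z$ on $S^{n-1}$ set $$(T^{(0)}_*z)(\theta):=z\Big(\frac{T^t\theta}{|T^t\theta|}\Big),\qquad\theta\in S^{n-1}.$$ Then $T^{(0)}_*$ maps $H^2(S^{n-1})$ to $H^2(S^{n-1})$ and $L^2(dV_K)$ to $L^2(dV_{T(K)})$, and $$L_{T(K)}\big(T^{(0)}_*z\big)=T^{(0)}_*\big(L_Kz\big)\qquad\forall z\in H^2(S^{n-1}).$$ In particular, $L_K$ and $L_{T(K)}$ are conjugate via the Hilbert space isometry $T^{(0)}_*:L^2(dV_K/V(K))\to L^2(dV_{T(K)}/V(T(K)))$, and therefore have the same spectrum: $\sigma(-L_K)=\sigma(-L_{T(K)})$.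
   Context: $T^t$ is the transpose of $T$, and $V$ is Lebesgue measure in $\mathbb R^n$. $\mathcal K^2_+$: convex bodies in $\mathbb R^n$ containing the origin in their interior, with $C^2$ boundary of strictly positive curvature; $h_K$: support function of $K$. Hilbert--Brunn--Minkowski operator: for $h\in C^2(S^{n-1})$, $D^2h:=\nabla^2_{S^{n-1}}h+h\,\delta$, with $\delta$ the standard metric on $S^{n-1}$ (equivalently the restriction to $TS^{n-1}$ of the Euclidean Hessian of the 1-homogeneous extension of $h$). For $h_1,\dots,h_{n-1}\in C^2(S^{n-1})$, $S(h_1,\dots,h_{n-1})(\theta):=D_{n-1}(D^2h_1(\theta),\dots,D^2h_{n-1}(\theta))$, computed in a local orthonormal frame, where $D_{n-1}$ is the mixed discriminant (the symmetric multilinear polarization of the determinant, $D_{n-1}(A,\dots,A)=\det A$). For $K\in\mathcal K^2_+$ and $z\in C^2(S^{n-1})$, $$L_Kz:=\frac{S(zh_K,h_K,\dots,h_K)}{S(h_K,\dots,h_K)}-z.$$ Let $dV_K:=\frac1nh_K\det(D^2h_K)\,d\theta$ be the cone measure of $K$ on $S^{n-1}$, which has total mass $V(K)$. $L_K$ is symmetric and elliptic on $L^2(dV_K)$ and has a unique self-adjoint extension with domain $H^2(S^{n-1})$, also denoted $L_K$. *)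

theory Defs
  imports "HOL-Analysis.Analysis" "HOL-Combinatorics.Permutations"
begin

text \<open>
  The ambient space is \<open>real ^ 'n\<close>, so that \<open>n = CARD('n)\<close>. A function on the sphere \<open>S\<close> is
  represented by a function \<open>real ^ 'n \<Rightarrow> real\<close> of which only the values on \<open>sphere 0 1\<close> matter.
\<close>

section \<open>Second derivatives in Euclidean space\<close>

definition hess :: "(real ^ 'n \<Rightarrow> real) \<Rightarrow> real ^ 'n \<Rightarrow> real ^ 'n \<Rightarrow> real ^ 'n \<Rightarrow> real" where
  "hess f x u v =
     frechet_derivative (\<lambda>y. frechet_derivative f (at y) u) (at x) v"

definition C2_on :: "(real ^ 'n) set \<Rightarrow> (real ^ 'n \<Rightarrow> real) \<Rightarrow> bool" where
  "C2_on U f \<longleftrightarrow>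
     (\<forall>x\<in>U. f differentiable (at x)) \<and>
     (\<forall>u. \<forall>x\<in>U. (\<lambda>y. frechet_derivative f (at y) u) differentiable (at x)) \<and>
     (\<forall>u v. continuous_on U (\<lambda>x. hess f x u v))"

section \<open>Convex bodies\<close>

definition support_fun :: "(real ^ 'n) set \<Rightarrow> real ^ 'n \<Rightarrow> real" where
  "support_fun K u = (SUP x\<in>K. x \<bullet> u)"

text \<open>
  Near each boundary point \<open>p\<close>, the body is the sublevel set \<open>f \<le> 0\<close> of a \<open>C\<^sup>2\<close> function with
  nonvanishing derivative at \<open>p\<close>. With respect to the outer normal, the second fundamental form at
  \<open>p\<close> is then \<open>hess f p / |\<nabla>f p|\<close> on the tangent space \<open>ker (f' p)\<close>, so that the last
  clause says that all principal curvatures are positive.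
\<close>

definition C2_positively_curved_boundary :: "(real ^ 'n) set \<Rightarrow> bool" where
  "C2_positively_curved_boundary K \<longleftrightarrow>
     (\<forall>p\<in>frontier K. \<exists>U f. open U \<and> p \<in> U \<and> C2_on U f \<and>
        K \<inter> U = {x \<in> U. f x \<le> 0} \<and>
        (\<exists>v. frechet_derivative f (at p) v \<noteq> 0) \<and>
        (\<forall>v. v \<noteq> 0 \<longrightarrow> frechet_derivative f (at p) v = 0 \<longrightarrow> hess f p v v > 0))"

definition K2_plus :: "(real ^ 'n) set set" where
  "K2_plus = {K. compact K \<and> convex K \<and> 0 \<in> interior K \<and> C2_positively_curved_boundary K}"

section \<open>Calculus on the sphere\<close>

definition hom_ext :: "(real ^ 'n \<Rightarrow> real) \<Rightarrow> real ^ 'n \<Rightarrow> real" where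
  "hom_ext h x = norm x * h (x /\<^sub>R norm x)"

definition C2_sphere :: "(real ^ 'n \<Rightarrow> real) \<Rightarrow> bool" where
  "C2_sphere h \<longleftrightarrow> C2_on (- {0}) (hom_ext h)"

text \<open>
  An orthonormal basis of the tangent space at \<open>\<theta>\<close>, indexed by \<open>{..<n-1}\<close>. Everything below is
  independent of the choice made here.
\<close>

definition tangent_frame :: "real ^ 'n \<Rightarrow> nat \<Rightarrow> real ^ 'n" where
  "tangent_frame \<theta> = (SOME e.
     (\<forall>i<CARD('n) - 1. e i \<bullet> \<theta> = 0) \<and>
     (\<forall>i<CARD('n) - 1. \<forall>j<CARD('n) - 1. e i \<bullet> e j = (if i = j then 1 else 0)))"

text \<open>The matrix, in this frame, of the restriction to the tangent space of the Euclidean Hessian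
  of the 1-homogeneous extension.\<close>

definition D2 :: "(real ^ 'n \<Rightarrow> real) \<Rightarrow> real ^ 'n \<Rightarrow> nat \<Rightarrow> nat \<Rightarrow> real" where
  "D2 h \<theta> i j = hess (hom_ext h) \<theta> (tangent_frame \<theta> i) (tangent_frame \<theta> j)"

text \<open>Since \<open>D\<^sup>2h = \<nabla>\<^sup>2h + h \<delta>\<close>, the covariant Hessian is recovered from \<open>D2\<close>; and along tangent
  vectors the 1-homogeneous extension has the same derivative as \<open>h\<close>.\<close>

definition sphere_grad :: "(real ^ 'n \<Rightarrow> real) \<Rightarrow> real ^ 'n \<Rightarrow> nat \<Rightarrow> real" where
  "sphere_grad h \<theta> i = frechet_derivative (hom_ext h) (at \<theta>) (tangent_frame \<theta> i)"

definition sphere_hess :: "(real ^ 'n \<Rightarrow> real) \<Rightarrow> real ^ 'n \<Rightarrow> nat \<Rightarrow> nat \<Rightarrow> real" where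
  "sphere_hess h \<theta> i j = D2 h \<theta> i j - (if i = j then h \<theta> else 0)"

section \<open>Mixed discriminants\<close>

text \<open>
  Determinants of \<open>m \<times> m\<close> matrices given as functions on \<open>{..<m} \<times> {..<m}\<close>; the size \<open>n - 1\<close> is
  not the cardinality of a type at hand.
\<close>

definition mat_det :: "nat \<Rightarrow> (nat \<Rightarrow> nat \<Rightarrow> real) \<Rightarrow> real" where
  "mat_det m A = (\<Sum>\<sigma> | \<sigma> permutes {..<m}. of_int (sign \<sigma>) * (\<Prod>i<m. A i (\<sigma> i)))"

text \<open>The polarization formula for the degree \<open>m\<close> form \<open>det\<close>, applied to \<open>A 0, \<dots>, A (m - 1)\<close>.\<close>

definition mixed_discriminant :: "nat \<Rightarrow> (nat \<Rightarrow> nat \<Rightarrow> nat \<Rightarrow> real) \<Rightarrow> real" where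
  "mixed_discriminant m A =
     (\<Sum>I\<in>Pow {..<m}. (- 1) ^ (m - card I) * mat_det m (\<lambda>i j. \<Sum>k\<in>I. A k i j)) / fact m"

definition mixed_S :: "(nat \<Rightarrow> real ^ 'n \<Rightarrow> real) \<Rightarrow> real ^ 'n \<Rightarrow> real" where
  "mixed_S h \<theta> = mixed_discriminant (CARD('n) - 1) (\<lambda>k. D2 (h k) \<theta>)"

text \<open>The operator \<open>L\<^sub>K\<close> on \<open>C\<^sup>2\<close> functions.\<close>

definition hbm_C2 :: "(real ^ 'n) set \<Rightarrow> (real ^ 'n \<Rightarrow> real) \<Rightarrow> real ^ 'n \<Rightarrow> real" where
  "hbm_C2 K z \<theta> =
     mixed_S (\<lambda>k. if k = 0 then (\<lambda>x. z x * support_fun K x) else support_fun K) \<theta>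
       / mixed_S (\<lambda>k. support_fun K) \<theta> - z \<theta>"

section \<open>Measures on the sphere\<close>

text \<open>Spherical Lebesgue measure: \<open>n\<close> times the volume of the cone over a set, inside the unit
  ball.\<close>

definition sphere_measure :: "(real ^ 'n) measure" where
  "sphere_measure = scale_measure (of_nat CARD('n))
     (distr (restrict_space lborel (ball 0 1 - {0})) (restrict_space borel (sphere 0 1))
        (\<lambda>x. x /\<^sub>R norm x))"

definition cone_measure :: "(real ^ 'n) set \<Rightarrow> (real ^ 'n) measure" where
  "cone_measure K = density sphere_measure
     (\<lambda>\<theta>. ennreal (support_fun K \<theta> * mat_det (CARD('n) - 1) (D2 (support_fun K) \<theta>) / CARD('n)))"

definition normalized_cone_measure :: "(real ^ 'n) set \<Rightarrow> (real ^ 'n) measure" where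
  "normalized_cone_measure K = scale_measure (ennreal (1 / measure lebesgue K)) (cone_measure K)"

section \<open>Real \<open>L\<^sup>2\<close> spaces and unbounded operators\<close>

text \<open>
  Elements of \<open>L\<^sup>2\<close> are represented by square integrable functions, and equality in \<open>L\<^sup>2\<close> is equality
  almost everywhere. An operator on \<open>L\<^sup>2\<close> is represented by its graph.
\<close>

definition L2 :: "'a measure \<Rightarrow> ('a \<Rightarrow> real) set" where
  "L2 M = {f \<in> borel_measurable M. integrable M (\<lambda>x. (f x)\<^sup>2)}"

definition L2_inner :: "'a measure \<Rightarrow> ('a \<Rightarrow> real) \<Rightarrow> ('a \<Rightarrow> real) \<Rightarrow> real" where
  "L2_inner M f g = (\<integral>x. f x * g x \<partial>M)"

definition L2_norm :: "'a measure \<Rightarrow> ('a \<Rightarrow> real) \<Rightarrow> real" where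
  "L2_norm M f = sqrt (L2_inner M f f)"

type_synonym 'a graph = "(('a \<Rightarrow> real) \<times> ('a \<Rightarrow> real)) set"

definition densely_defined :: "'a measure \<Rightarrow> 'a graph \<Rightarrow> bool" where
  "densely_defined M G \<longleftrightarrow>
     (\<forall>f\<in>L2 M. \<forall>\<epsilon>>0. \<exists>z\<in>Domain G. z \<in> L2 M \<and> L2_norm M (\<lambda>x. f x - z x) < \<epsilon>)"

definition adjoint_graph :: "'a measure \<Rightarrow> 'a graph \<Rightarrow> 'a graph" where
  "adjoint_graph M G = {(u, v). u \<in> L2 M \<and> v \<in> L2 M \<and>
     (\<forall>(z, w)\<in>G. L2_inner M w u = L2_inner M z v)}"

definition self_adjoint :: "'a measure \<Rightarrow> 'a graph \<Rightarrow> bool" where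
  "self_adjoint M G \<longleftrightarrow> densely_defined M G \<and> adjoint_graph M G = G"

definition neg_graph :: "'a graph \<Rightarrow> 'a graph" where
  "neg_graph G = {(z, \<lambda>x. - w x) | z w. (z, w) \<in> G}"

text \<open>
  \<open>\<mu>\<close> belongs to the resolvent set if \<open>G - \<mu>\<close> maps its domain onto \<open>L\<^sup>2\<close> and is bounded below
  (hence injective, with bounded inverse). Only real \<open>\<mu>\<close> are considered: \<open>L\<^sup>2\<close> is a real Hilbert
  space, and the operators of interest are self-adjoint.
\<close>

definition resolvent_set :: "'a measure \<Rightarrow> 'a graph \<Rightarrow> real set" where
  "resolvent_set M G = {\<mu>.
     (\<forall>v\<in>L2 M. \<exists>(z, w)\<in>G. AE x in M. w x - \<mu> * z x = v x) \<and>
     (\<exists>C. \<forall>(z, w)\<in>G. L2_norm M z \<le> C * L2_norm M (\<lambda>x. w x - \<mu> * z x))}"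

definition spectrum :: "'a measure \<Rightarrow> 'a graph \<Rightarrow> real set" where
  "spectrum M G = - resolvent_set M G"

text \<open>A linear isometry from \<open>L\<^sup>2(M)\<close> onto \<open>L\<^sup>2(N)\<close>.\<close>

definition hilbert_isometry ::
    "'a measure \<Rightarrow> 'a measure \<Rightarrow> (('a \<Rightarrow> real) \<Rightarrow> 'a \<Rightarrow> real) \<Rightarrow> bool" where
  "hilbert_isometry M N U \<longleftrightarrow>
     (\<forall>f\<in>L2 M. U f \<in> L2 N) \<and>
     (\<forall>f\<in>L2 M. \<forall>g\<in>L2 M. \<forall>a b.
        AE x in N. U (\<lambda>y. a * f y + b * g y) x = a * U f x + b * U g x) \<and>
     (\<forall>f\<in>L2 M. \<forall>g\<in>L2 M. L2_inner N (U f) (U g) = L2_inner M f g) \<and>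
     (\<forall>g\<in>L2 N. \<exists>f\<in>L2 M. AE x in N. U f x = g x)"

text \<open>\<open>B = U A U\<^sup>-\<^sup>1\<close>, for a map \<open>U\<close> from \<open>L\<^sup>2(M)\<close> onto \<open>L\<^sup>2(N)\<close>, equality of domains included.\<close>

definition conjugate_via ::
    "'a measure \<Rightarrow> (('a \<Rightarrow> real) \<Rightarrow> 'a \<Rightarrow> real) \<Rightarrow> 'a graph \<Rightarrow> 'a graph \<Rightarrow> bool" where
  "conjugate_via M U A B \<longleftrightarrow> (\<forall>z\<in>L2 M. \<forall>w\<in>L2 M. (z, w) \<in> A \<longleftrightarrow> (U z, U w) \<in> B)"

section \<open>The Sobolev space \<open>H\<^sup>2\<close> and the self-adjoint operator\<close>

definition H2_norm :: "(real ^ 'n \<Rightarrow> real) \<Rightarrow> real" where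
  "H2_norm z = sqrt (\<integral>\<theta>. (z \<theta>)\<^sup>2
     + (\<Sum>i<CARD('n) - 1. (sphere_grad z \<theta> i)\<^sup>2)
     + (\<Sum>i<CARD('n) - 1. \<Sum>j<CARD('n) - 1. (sphere_hess z \<theta> i j)\<^sup>2) \<partial>sphere_measure)"

text \<open>The completion of \<open>C\<^sup>2\<close> in the \<open>H\<^sup>2\<close> norm, realized inside \<open>L\<^sup>2\<close>.\<close>

definition H2_sphere :: "(real ^ 'n \<Rightarrow> real) set" where
  "H2_sphere = {z \<in> L2 sphere_measure. \<exists>s. (\<forall>k. C2_sphere (s k)) \<and>
     (\<forall>\<epsilon>>0. \<exists>N::nat. \<forall>k\<ge>N. \<forall>l\<ge>N. H2_norm (\<lambda>\<theta>. s k \<theta> - s l \<theta>) < \<epsilon>) \<and>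
     (\<lambda>k. L2_norm sphere_measure (\<lambda>\<theta>. s k \<theta> - z \<theta>)) \<longlonglongrightarrow> 0}"

definition hbm_extension :: "(real ^ 'n) set \<Rightarrow> (real ^ 'n) graph \<Rightarrow> bool" where
  "hbm_extension K G \<longleftrightarrow>
     self_adjoint (cone_measure K) G \<and> Domain G = H2_sphere \<and>
     (\<forall>z. C2_sphere z \<longrightarrow> (z, hbm_C2 K z) \<in> G)"

text \<open>
  The unique self-adjoint extension. For \<open>K \<in> K2_plus\<close> (and \<open>n \<ge> 2\<close>) existence and uniqueness are a
  theorem of elliptic regularity, so the second branch, which only makes the definition total, is
  irrelevant.
\<close>

definition hbm_graph :: "(real ^ 'n) set \<Rightarrow> (real ^ 'n) graph" where
  "hbm_graph K = (if \<exists>!G. hbm_extension K G then THE G. hbm_extension K G else {})"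

text \<open>The value \<open>L\<^sub>K z\<close>, for \<open>z\<close> in the domain; determined up to equality almost everywhere.\<close>

definition hbm :: "(real ^ 'n) set \<Rightarrow> (real ^ 'n \<Rightarrow> real) \<Rightarrow> real ^ 'n \<Rightarrow> real" where
  "hbm K z = (if z \<in> Domain (hbm_graph K) then SOME w. (z, w) \<in> hbm_graph K else (\<lambda>_. 0))"

section \<open>The action of linear maps\<close>

definition push0 :: "real ^ 'n ^ 'n \<Rightarrow> (real ^ 'n \<Rightarrow> real) \<Rightarrow> real ^ 'n \<Rightarrow> real" where
  "push0 T z \<theta> = z ((transpose T *v \<theta>) /\<^sub>R norm (transpose T *v \<theta>))"

end

theory Submission
  imports Defs
begin

text \<open>
  Let \<open>A\<close> be the transpose of \<open>T\<close> and \<open>\<phi> \<theta> = A \<theta> / |A \<theta>|\<close>, so that \<open>push0 T z = z \<circ> \<phi>\<close>. The support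
  function of \<open>T K\<close> is \<open>h\<^sub>K \<circ> A\<close>, and the 1-homogeneous extension of \<open>(z \<circ> \<phi>) h\<^bsub>T K\<^esub>\<close> is that of \<open>z h\<^sub>K\<close>
  composed with \<open>A\<close>. Therefore all the forms \<open>D\<^sup>2\<close> which enter into \<open>L\<^bsub>T K\<^esub> (z \<circ> \<phi>)\<close> at \<open>\<theta>\<close> are the forms
  for \<open>K\<close> at \<open>\<phi> \<theta>\<close>, pulled back by one and the same linear map. All mixed discriminants are then multiplied by
  the factor \<open>(det T)\<^sup>2 / |A \<theta>| ^ (n + 1)\<close>, which cancels in the quotient (\<open>mixed_S_linear\<close>, \<open>hbm_C2_push0\<close>).

  The Jacobian of \<open>\<phi>\<close> on the sphere is \<open>|det T| / |A \<theta>| ^ n\<close> (\<open>nn_integral_sphere_map\<close>). Combined with the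
  factor above, it shows that \<open>\<phi>\<close> maps the cone measure of \<open>T K\<close> to \<open>|det T|\<close> times that of \<open>K\<close>
  (\<open>scaled_measure_iso_cone_measure\<close>); after division by the volumes, composition with \<open>\<phi>\<close> is an isometry.

  These computations differentiate \<open>h\<^sub>K\<close> twice. Its gradient is the point of \<open>K\<close> with a given outer normal,
  which depends continuously on the normal by strict convexity, and solves a Lagrange system with invertible
  derivative by the positive curvature; hence it is \<open>C\<^sup>1\<close> (\<open>C2_sphere_support_fun\<close>).

  Composition with \<open>\<phi>\<close> is bounded on \<open>H\<^sup>2\<close>, as is its inverse, the composition with the map for \<open>T\<^sup>-\<^sup>1\<close>
  (\<open>push0_H2_sphere\<close>). It therefore maps the self-adjoint extensions of \<open>L\<^sub>K\<close> with domain \<open>H\<^sup>2\<close> bijectively to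
  those of \<open>L\<^bsub>T K\<^esub>\<close>, and the unique extension for \<open>K\<close> to the one for \<open>T K\<close> (\<open>hbm_graph_linear_image\<close>). The
  conjugacy of the operators and the equality of the spectra are formal consequences, which hold for every
  isomorphism of measure spaces up to a constant (\<open>pull_graph_comp_iff\<close>, \<open>spectrum_pull_graph\<close>).
\<close>

section \<open>Calculus of twice continuously differentiable functions\<close>

lemma frechet_derivative_eqI: "(f has_derivative f') (at x) \<Longrightarrow> frechet_derivative f (at x) = f'"
  using frechet_derivative_at by metis

lemma C2_onI:
  fixes f :: "real ^ 'n \<Rightarrow> real"
  assumes U: "open U"
    and f': "\<And>x. x \<in> U \<Longrightarrow> (f has_derivative f' x) (at x)"
    and f'': "\<And>x u. x \<in> U \<Longrightarrow> ((\<lambda>y. f' y u) has_derivative f'' x u) (at x)"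
    and cont: "\<And>u v. continuous_on U (\<lambda>x. f'' x u v)"
  shows C2_onI_C2: "C2_on U f"
    and C2_onI_frechet: "x \<in> U \<Longrightarrow> frechet_derivative f (at x) = f' x"
    and C2_onI_hess: "x \<in> U \<Longrightarrow> hess f x u v = f'' x u v"
proof -
  have fr: "frechet_derivative f (at x) = f' x" if "x \<in> U" for x
    by (rule frechet_derivative_eqI[OF f'[OF that]])
  have fr2: "((\<lambda>y. frechet_derivative f (at y) u) has_derivative f'' x u) (at x)" if "x \<in> U" for x u
    by (rule has_derivative_transform_within_open[OF f''[OF that] U that]) (simp add: fr)
  have he: "hess f x u v = f'' x u v" if "x \<in> U" for x u v
    unfolding hess_def using frechet_derivative_eqI[OF fr2[OF that]] by simp
  show "x \<in> U \<Longrightarrow> frechet_derivative f (at x) = f' x" by (rule fr)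
  show "x \<in> U \<Longrightarrow> hess f x u v = f'' x u v" by (rule he)
  have "continuous_on U (\<lambda>x. hess f x u v)" for u v
    using cont[of u v] continuous_on_cong[OF refl, of U "\<lambda>x. hess f x u v" "\<lambda>x. f'' x u v"] he by simp
  then show "C2_on U f"
    unfolding C2_on_def using f' fr2 by (blast intro: differentiableI)
qed

lemma C2_onD:
  assumes "C2_on U f" "x \<in> U"
  shows C2_onD1: "(f has_derivative frechet_derivative f (at x)) (at x)"
    and C2_onD2: "((\<lambda>y. frechet_derivative f (at y) u) has_derivative hess f x u) (at x)"
proof -
  show "(f has_derivative frechet_derivative f (at x)) (at x)"
    using assms unfolding C2_on_def by (meson frechet_derivative_works)
  have "hess f x u = frechet_derivative (\<lambda>y. frechet_derivative f (at y) u) (at x)"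
    by (simp add: hess_def fun_eq_iff)
  then show "((\<lambda>y. frechet_derivative f (at y) u) has_derivative hess f x u) (at x)"
    using assms unfolding C2_on_def by (metis frechet_derivative_works)
qed

lemma C2_on_hess_continuous: "C2_on U f \<Longrightarrow> continuous_on U (\<lambda>x. hess f x u v)"
  by (simp add: C2_on_def)

lemma C2_on_continuous: "C2_on U f \<Longrightarrow> continuous_on U f"
  using C2_onD1 has_derivative_continuous by (fast intro: continuous_at_imp_continuous_on)

lemma C2_on_frechet_continuous: "C2_on U f \<Longrightarrow> continuous_on U (\<lambda>x. frechet_derivative f (at x) u)"
  using C2_onD2 has_derivative_continuous by (fast intro: continuous_at_imp_continuous_on)

lemma C2_on_linear_frechet: "C2_on U f \<Longrightarrow> x \<in> U \<Longrightarrow> linear (frechet_derivative f (at x))"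
  using C2_onD1 has_derivative_linear by blast

lemma C2_on_linear_hess: "C2_on U f \<Longrightarrow> x \<in> U \<Longrightarrow> linear (hess f x u)"
  using C2_onD2 has_derivative_linear by blast

text \<open>Near \<open>x\<close> the derivative is linear in the direction, so the identities of linearity can themselves be
  differentiated; this is where openness of \<open>U\<close> enters.\<close>

lemma C2_on_linear_hess_left:
  assumes U: "open U" and f: "C2_on U f" and x: "x \<in> U"
  shows "linear (\<lambda>u. hess f x u v)"
proof (rule linearI)
  note D = C2_onD2[OF f x]
  note lin = C2_on_linear_frechet[OF f]
  fix u w :: "real ^ 'a" and c :: real
  have "((\<lambda>y. frechet_derivative f (at y) (u + w)) has_derivative (\<lambda>v. hess f x u v + hess f x w v)) (at x)"
    by (rule has_derivative_transform_within_open[OF has_derivative_add[OF D D] U x])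
      (simp add: linear_add[OF lin])
  from frechet_derivative_eqI[OF this] show "hess f x (u + w) v = hess f x u v + hess f x w v"
    by (simp add: hess_def)
  have "((\<lambda>y. frechet_derivative f (at y) (c *\<^sub>R u)) has_derivative (\<lambda>v. c * hess f x u v)) (at x)"
    by (rule has_derivative_transform_within_open[OF has_derivative_mult_right[OF D] U x])
      (simp add: linear_scale[OF lin])
  from frechet_derivative_eqI[OF this] show "hess f x (c *\<^sub>R u) v = c *\<^sub>R hess f x u v"
    by (simp add: hess_def)
qed

lemma C2_on_cong:
  assumes U: "open U" and f: "C2_on U f" and eq: "\<And>x. x \<in> U \<Longrightarrow> g x = f x"
  shows C2_on_cong_C2: "C2_on U g"
    and C2_on_cong_frechet: "x \<in> U \<Longrightarrow> frechet_derivative g (at x) = frechet_derivative f (at x)"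
    and C2_on_cong_hess: "x \<in> U \<Longrightarrow> hess g x u v = hess f x u v"
proof -
  have g: "(g has_derivative frechet_derivative f (at x)) (at x)" if "x \<in> U" for x
    by (rule has_derivative_transform_within_open[OF C2_onD1[OF f that] U that]) (simp add: eq)
  note C = C2_onI[where f'="\<lambda>x. frechet_derivative f (at x)" and f''="hess f", OF U g C2_onD2[OF f] C2_on_hess_continuous[OF f]]
  show "C2_on U g" by (rule C(1))
  show "x \<in> U \<Longrightarrow> frechet_derivative g (at x) = frechet_derivative f (at x)" by (rule C(2))
  show "x \<in> U \<Longrightarrow> hess g x u v = hess f x u v" by (rule C(3))
qed

lemma C2_on_linear_comp:
  fixes A :: "real ^ 'n \<Rightarrow> real ^ 'n"
  assumes U: "open U" and A: "linear A" and f: "C2_on V f" and AU: "\<And>x. x \<in> U \<Longrightarrow> A x \<in> V"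
  shows C2_on_linear_comp_C2: "C2_on U (\<lambda>x. f (A x))"
    and C2_on_linear_comp_frechet:
      "x \<in> U \<Longrightarrow> frechet_derivative (\<lambda>x. f (A x)) (at x) = (\<lambda>u. frechet_derivative f (at (A x)) (A u))"
    and C2_on_linear_comp_hess: "x \<in> U \<Longrightarrow> hess (\<lambda>x. f (A x)) x u v = hess f (A x) (A u) (A v)"
proof -
  have A': "(A has_derivative A) (at x)" for x
    by (rule linear_imp_has_derivative[OF A])
  have 1: "((\<lambda>x. f (A x)) has_derivative (\<lambda>u. frechet_derivative f (at (A x)) (A u))) (at x)"
    if "x \<in> U" for x
    by (rule has_derivative_compose[OF A' C2_onD1[OF f AU[OF that]]])
  have 2: "((\<lambda>y. frechet_derivative f (at (A y)) (A u)) has_derivative (\<lambda>v. hess f (A x) (A u) (A v))) (at x)"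
    if "x \<in> U" for x u
    by (rule has_derivative_compose[OF A' C2_onD2[OF f AU[OF that]]])
  have 3: "continuous_on U (\<lambda>x. hess f (A x) (A u) (A v))" for u v
    by (rule continuous_on_compose2[OF C2_on_hess_continuous[OF f] linear_continuous_on])
      (use A AU in \<open>auto simp: linear_linear\<close>)
  note C = C2_onI[where f'="\<lambda>x u. frechet_derivative f (at (A x)) (A u)"
      and f''="\<lambda>x u v. hess f (A x) (A u) (A v)", OF U 1 2 3]
  show "C2_on U (\<lambda>x. f (A x))" by (rule C(1))
  show "x \<in> U \<Longrightarrow> frechet_derivative (\<lambda>x. f (A x)) (at x) = (\<lambda>u. frechet_derivative f (at (A x)) (A u))"
    by (rule C(2))
  show "x \<in> U \<Longrightarrow> hess (\<lambda>x. f (A x)) x u v = hess f (A x) (A u) (A v)"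
    by (rule C(3))
qed

lemma C2_on_mult:
  assumes U: "open U" and f: "C2_on U f" and g: "C2_on U g"
  shows C2_on_mult_C2: "C2_on U (\<lambda>x. f x * g x)"
    and C2_on_mult_frechet: "x \<in> U \<Longrightarrow> frechet_derivative (\<lambda>x. f x * g x) (at x) =
      (\<lambda>u. f x * frechet_derivative g (at x) u + frechet_derivative f (at x) u * g x)"
    and C2_on_mult_hess: "x \<in> U \<Longrightarrow> hess (\<lambda>x. f x * g x) x u v =
      f x * hess g x u v + frechet_derivative f (at x) v * frechet_derivative g (at x) u +
      (frechet_derivative f (at x) u * frechet_derivative g (at x) v + hess f x u v * g x)"
proof -
  note C = C2_onI[where f="\<lambda>x. f x * g x" and f'="\<lambda>x u. f x * frechet_derivative g (at x) u + frechet_derivative f (at x) u * g x"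
      and f''="\<lambda>x u v. f x * hess g x u v + frechet_derivative f (at x) v * frechet_derivative g (at x) u +
      (frechet_derivative f (at x) u * frechet_derivative g (at x) v + hess f x u v * g x)",
      OF U has_derivative_mult[OF C2_onD1[OF f] C2_onD1[OF g]]
        has_derivative_add[OF has_derivative_mult[OF C2_onD1[OF f] C2_onD2[OF g]]
            has_derivative_mult[OF C2_onD2[OF f] C2_onD1[OF g]]]]
  have *: "continuous_on U (\<lambda>x. f x * hess g x u v + frechet_derivative f (at x) v * frechet_derivative g (at x) u +
      (frechet_derivative f (at x) u * frechet_derivative g (at x) v + hess f x u v * g x))" for u v
    by (intro continuous_intros C2_on_continuous C2_on_frechet_continuous C2_on_hess_continuous f g)
  show "C2_on U (\<lambda>x. f x * g x)" by (rule C(1)) (auto intro: *)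
  show "x \<in> U \<Longrightarrow> frechet_derivative (\<lambda>x. f x * g x) (at x) =
      (\<lambda>u. f x * frechet_derivative g (at x) u + frechet_derivative f (at x) u * g x)"
    by (rule C(2)) (auto intro: *)
  show "x \<in> U \<Longrightarrow> hess (\<lambda>x. f x * g x) x u v =
      f x * hess g x u v + frechet_derivative f (at x) v * frechet_derivative g (at x) u +
      (frechet_derivative f (at x) u * frechet_derivative g (at x) v + hess f x u v * g x)"
    by (rule C(3)) (auto intro: *)
qed

lemma C2_on_diff:
  assumes U: "open U" and f: "C2_on U f" and g: "C2_on U g"
  shows "C2_on U (\<lambda>x. f x - g x)"
  by (rule C2_onI(1)[where f'="\<lambda>x u. frechet_derivative f (at x) u - frechet_derivative g (at x) u"
      and f''="\<lambda>x u v. hess f x u v - hess g x u v"])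
    (intro U has_derivative_diff C2_onD1[OF f] C2_onD1[OF g] C2_onD2[OF f] C2_onD2[OF g]
        continuous_intros C2_on_hess_continuous f g; assumption)+

lemma C2_on_inverse:
  assumes U: "open U" and f: "C2_on U f" and nz: "\<And>x. x \<in> U \<Longrightarrow> f x \<noteq> 0"
  shows "C2_on U (\<lambda>x. inverse (f x))"
proof (rule C2_onI(1)[where f'="\<lambda>x u. - frechet_derivative f (at x) u * (inverse (f x) * inverse (f x))"
      and f''="\<lambda>x u v. 2 * frechet_derivative f (at x) u * frechet_derivative f (at x) v * inverse (f x) ^ 3
        - hess f x u v * inverse (f x) ^ 2"])
  note inv = Deriv.has_derivative_inverse[OF nz C2_onD1[OF f]]
  fix x u assume x: "x \<in> U"
  show "((\<lambda>x. inverse (f x)) has_derivative (\<lambda>u. - frechet_derivative f (at x) u * (inverse (f x) * inverse (f x)))) (at x)"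
    by (rule has_derivative_eq_rhs[OF inv[OF x x]]) (simp add: fun_eq_iff)
  show "((\<lambda>y. - frechet_derivative f (at y) u * (inverse (f y) * inverse (f y))) has_derivative
     (\<lambda>v. 2 * frechet_derivative f (at x) u * frechet_derivative f (at x) v * inverse (f x) ^ 3
        - hess f x u v * inverse (f x) ^ 2)) (at x)"
    by (rule has_derivative_eq_rhs[OF has_derivative_mult[OF has_derivative_minus[OF C2_onD2[OF f x]]
          has_derivative_mult[OF inv[OF x x] inv[OF x x]]]])
      (auto simp: fun_eq_iff field_simps power2_eq_square power3_eq_cube)
next
  show "continuous_on U (\<lambda>x. 2 * frechet_derivative f (at x) u * frechet_derivative f (at x) v * inverse (f x) ^ 3
        - hess f x u v * inverse (f x) ^ 2)" for u v
    by (intro continuous_intros C2_on_continuous C2_on_frechet_continuous C2_on_hess_continuous f) (use nz in auto)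
qed (rule U)

lemma C2_on_norm: "C2_on (- {0}) (norm :: real ^ 'n \<Rightarrow> real)"
proof (rule C2_onI(1)[where f'="\<lambda>x u. (x \<bullet> u) * inverse (norm x)"
      and f''="\<lambda>x u v. (u \<bullet> v) * inverse (norm x) - (x \<bullet> u) * (x \<bullet> v) * inverse (norm x) ^ 3"])
  fix x u :: "real ^ 'n" assume "x \<in> - {0}"
  then have x: "x \<noteq> 0" by simp
  have nd: "(norm has_derivative (\<lambda>u. (x \<bullet> u) * inverse (norm x))) (at x)"
    by (rule has_derivative_eq_rhs[OF has_derivative_norm[OF x]])
      (simp add: fun_eq_iff sgn_div_norm inner_commute)
  then show "(norm has_derivative (\<lambda>u. (x \<bullet> u) * inverse (norm x))) (at x)" .
  have i: "((\<lambda>x. inverse (norm x)) has_derivative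
      (\<lambda>u. - (inverse (norm x) * ((x \<bullet> u) * inverse (norm x)) * inverse (norm x)))) (at x)"
    by (rule Deriv.has_derivative_inverse[OF _ nd]) (use x in simp)
  have "((\<lambda>y. y \<bullet> u) has_derivative (\<lambda>v. v \<bullet> u)) (at x)"
    by (auto intro!: derivative_eq_intros)
  from has_derivative_mult[OF this i]
  show "((\<lambda>y. (y \<bullet> u) * inverse (norm y)) has_derivative
     (\<lambda>v. (u \<bullet> v) * inverse (norm x) - (x \<bullet> u) * (x \<bullet> v) * inverse (norm x) ^ 3)) (at x)"
    by (rule has_derivative_eq_rhs) (auto simp: fun_eq_iff inner_commute power3_eq_cube algebra_simps)
next
  show "continuous_on (- {0}) (\<lambda>x::real^'n. (u \<bullet> v) * inverse (norm x) - (x \<bullet> u) * (x \<bullet> v) * inverse (norm x) ^ 3)" for u v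
    by (intro continuous_intros) auto
qed auto

section \<open>Positively homogeneous functions\<close>

definition pos_homogeneous :: "(real ^ 'n \<Rightarrow> real) \<Rightarrow> bool" where
  "pos_homogeneous f \<longleftrightarrow> (\<forall>t>0. \<forall>x. f (t *\<^sub>R x) = t * f x)"

lemma pos_homogeneous_hom_ext: "pos_homogeneous (hom_ext h)" for h :: "real ^ 'n \<Rightarrow> real"
unfolding pos_homogeneous_def
proof (intro allI impI)
  fix t :: real and x :: "real ^ 'n" assume "t > 0"
  then have "(t *\<^sub>R x) /\<^sub>R norm (t *\<^sub>R x) = x /\<^sub>R norm x" by simp
  then show "hom_ext h (t *\<^sub>R x) = t * hom_ext h x"
    unfolding hom_ext_def using \<open>t > 0\<close> by (simp only: norm_scaleR)
qed

context
  fixes f :: "real ^ 'n \<Rightarrow> real"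
  assumes f: "C2_on (- {0}) f" and hom: "pos_homogeneous f"
begin

text \<open>Differentiate \<open>f (t x) = t f x\<close> in \<open>x\<close>, once and twice.\<close>

lemma pos_homogeneous_derivs_scale:
  assumes t: "t > 0" and x: "x \<noteq> 0"
  shows frechet_pos_homogeneous_scale:
      "frechet_derivative f (at (t *\<^sub>R x)) u = frechet_derivative f (at x) u"
    and hess_pos_homogeneous_scale: "hess f (t *\<^sub>R x) u v = hess f x u v / t"
proof -
  have S: "open (- {0 :: real ^ 'n})" by auto
  have A: "linear (\<lambda>x :: real ^ 'n. t *\<^sub>R x)" by (simp add: linear_iff algebra_simps)
  have lin1: "linear (frechet_derivative f (at (t *\<^sub>R x)))"
    by (rule C2_on_linear_frechet[OF f]) (use t x in auto)
  have lin2: "linear (hess f (t *\<^sub>R x) w)" "linear (\<lambda>u. hess f (t *\<^sub>R x) u w)" for w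
    by (rule C2_on_linear_hess[OF f] C2_on_linear_hess_left[OF S f], use t x in simp)+
  have c: "C2_on (- {0}) (\<lambda>_ :: real ^ 'n. t)"
    by (rule C2_onI(1)[where f'="\<lambda>_ _. 0" and f''="\<lambda>_ _ _. 0"]) auto
  have c': "frechet_derivative (\<lambda>_ :: real ^ 'n. t) (at x) u = 0" for u
    by (simp add: frechet_derivative_eqI[OF has_derivative_const])
  have c'': "hess (\<lambda>_ :: real ^ 'n. t) x u v = 0" for u v
    by (simp add: hess_def frechet_derivative_eqI[OF has_derivative_const])
  have At: "t *\<^sub>R y \<in> - {0}" if "y \<in> - {0}" for y :: "real ^ 'n"
    using that t by simp
  have x': "x \<in> - {0}" using x by simp
  note L = C2_on_linear_comp(2,3)[OF S A f At x']
  note M = C2_on_mult(2,3)[OF S c f x']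
  have eq: "(\<lambda>x. f (t *\<^sub>R x)) = (\<lambda>x. t * f x)"
    using hom t by (simp add: pos_homogeneous_def fun_eq_iff)
  have "frechet_derivative f (at (t *\<^sub>R x)) (t *\<^sub>R u) = t * frechet_derivative f (at x) u"
    using fun_cong[OF L(1), of u] fun_cong[OF M(1), of u] unfolding eq by (simp add: c')
  then show "frechet_derivative f (at (t *\<^sub>R x)) u = frechet_derivative f (at x) u"
    using t by (simp add: linear_scale[OF lin1])
  have "hess f (t *\<^sub>R x) (t *\<^sub>R u) (t *\<^sub>R v) = t * hess f x u v"
    using L(2)[of u v] M(2)[of u v] t unfolding eq by (simp add: c' c'')
  then show "hess f (t *\<^sub>R x) u v = hess f x u v / t"
    using t by (simp add: linear_scale[OF lin2(1)] linear_scale[OF lin2(2)] field_simps)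
qed

text \<open>Differentiate \<open>f (t x) = t f x\<close> in \<open>t\<close>, at \<open>t = 1\<close>.\<close>

lemma euler_identity:
  assumes x: "x \<noteq> 0"
  shows "frechet_derivative f (at x) x = f x"
proof -
  have "((\<lambda>s. f (s *\<^sub>R x)) has_derivative (\<lambda>s. frechet_derivative f (at (1 *\<^sub>R x)) (s *\<^sub>R x))) (at 1)"
    by (rule has_derivative_compose[OF _ C2_onD1[OF f]]) (use x in \<open>auto intro!: derivative_eq_intros\<close>)
  moreover have "((\<lambda>s. f (s *\<^sub>R x)) has_derivative (\<lambda>s. s * f x)) (at 1)"
    by (rule has_derivative_transform_within_open[where f="\<lambda>s. s * f x" and s="{0<..}"])
      (use hom in \<open>auto simp: pos_homogeneous_def intro!: derivative_eq_intros\<close>)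
  ultimately have "(\<lambda>s. frechet_derivative f (at (1 *\<^sub>R x)) (s *\<^sub>R x)) = (\<lambda>s. s * f x)"
    by (rule has_derivative_unique)
  from fun_cong[OF this, of 1] show ?thesis by simp
qed

text \<open>The derivative of \<open>f\<close> is constant along rays.\<close>

lemma hess_radial_right:
  assumes x: "x \<noteq> 0"
  shows "hess f x u x = 0"
proof -
  have "((\<lambda>s. frechet_derivative f (at (s *\<^sub>R x)) u) has_derivative (\<lambda>s. hess f (1 *\<^sub>R x) u (s *\<^sub>R x))) (at 1)"
    by (rule has_derivative_compose[OF _ C2_onD2[OF f]]) (use x in \<open>auto intro!: derivative_eq_intros\<close>)
  moreover have "((\<lambda>s. frechet_derivative f (at (s *\<^sub>R x)) u) has_derivative (\<lambda>s. 0)) (at 1)"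
    by (rule has_derivative_transform_within_open[where f="\<lambda>s. frechet_derivative f (at x) u" and s="{0<..}"])
      (use x in \<open>auto simp: frechet_pos_homogeneous_scale\<close>)
  ultimately have "(\<lambda>s. hess f (1 *\<^sub>R x) u (s *\<^sub>R x)) = (\<lambda>s. 0)"
    by (rule has_derivative_unique)
  from fun_cong[OF this, of 1] show ?thesis by simp
qed

text \<open>Differentiate the Euler identity \<open>\<Sum>\<^sub>b y\<^sub>b \<partial>\<^sub>b f y = f y\<close> in the direction \<open>v\<close>: the derivative of the
  factors \<open>y\<^sub>b\<close> cancels the right-hand side. Together with the preceding lemma this gives the Hessian radial
  kernel in both arguments.\<close>

lemma hess_radial_left:
  assumes x: "x \<noteq> 0"
  shows "hess f x x v = 0"
proof -
  have S: "open (- {0 :: real ^ 'n})" by auto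
  have lin: "linear (frechet_derivative f (at y))" if "y \<noteq> 0" for y
    using C2_on_linear_frechet[OF f] that by simp
  have eul: "(\<Sum>b\<in>Basis. (y \<bullet> b) * frechet_derivative f (at y) b) = f y" if "y \<noteq> 0" for y
  proof -
    have "frechet_derivative f (at y) y = frechet_derivative f (at y) (\<Sum>b\<in>Basis. (y \<bullet> b) *\<^sub>R b)"
      by (simp add: euclidean_representation)
    also have "\<dots> = (\<Sum>b\<in>Basis. (y \<bullet> b) * frechet_derivative f (at y) b)"
      by (simp add: linear_sum[OF lin[OF that]] linear_scale[OF lin[OF that]])
    finally show ?thesis using euler_identity[OF that] by simp
  qed
  have "((\<lambda>y. \<Sum>b\<in>Basis. (y \<bullet> b) * frechet_derivative f (at y) b) has_derivative
      (\<lambda>v. \<Sum>b\<in>Basis. (x \<bullet> b) * hess f x b v + (v \<bullet> b) * frechet_derivative f (at x) b)) (at x)"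
    by (intro has_derivative_sum has_derivative_mult C2_onD2[OF f] has_derivative_inner_left has_derivative_ident)
      (use x in auto)
  moreover have "((\<lambda>y. \<Sum>b\<in>Basis. (y \<bullet> b) * frechet_derivative f (at y) b) has_derivative
      frechet_derivative f (at x)) (at x)"
    by (rule has_derivative_transform_within_open[OF C2_onD1[OF f] S]) (use x eul in auto)
  ultimately have "(\<lambda>v. \<Sum>b\<in>Basis. (x \<bullet> b) * hess f x b v + (v \<bullet> b) * frechet_derivative f (at x) b)
      = frechet_derivative f (at x)"
    by (rule has_derivative_unique)
  from fun_cong[OF this, of v]
  have "(\<Sum>b\<in>Basis. (x \<bullet> b) * hess f x b v) + (\<Sum>b\<in>Basis. (v \<bullet> b) * frechet_derivative f (at x) b)
      = frechet_derivative f (at x) v"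
    by (simp add: sum.distrib)
  also have "frechet_derivative f (at x) v = frechet_derivative f (at x) (\<Sum>b\<in>Basis. (v \<bullet> b) *\<^sub>R b)"
    by (simp add: euclidean_representation)
  also have "\<dots> = (\<Sum>b\<in>Basis. (v \<bullet> b) * frechet_derivative f (at x) b)"
    by (simp add: linear_sum[OF lin[OF x]] linear_scale[OF lin[OF x]])
  finally have 0: "(\<Sum>b\<in>Basis. (x \<bullet> b) * hess f x b v) = 0" by simp
  have hl: "linear (\<lambda>u. hess f x u v)"
    by (rule C2_on_linear_hess_left[OF S f]) (use x in simp)
  have "hess f x x v = hess f x (\<Sum>b\<in>Basis. (x \<bullet> b) *\<^sub>R b) v"
    by (simp add: euclidean_representation)
  also have "\<dots> = (\<Sum>b\<in>Basis. (x \<bullet> b) * hess f x b v)"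
    by (simp add: linear_sum[OF hl] linear_scale[OF hl])
  finally show ?thesis using 0 by simp
qed

end

section \<open>Determinants in orthonormal frames\<close>

text \<open>A permutation contributes to the determinant only if it fixes \<open>l\<close>, because some row other than \<open>l\<close>
  would otherwise be sent to column \<open>l\<close>. The map \<open>b\<close> numbers the remaining indices.\<close>

lemma det_eq_mat_det_of_column:
  fixes M :: "real ^ 'n ^ 'n"
  assumes b: "bij_betw b {..<m} (UNIV - {l})" and col: "\<And>i. i \<noteq> l \<Longrightarrow> M $ i $ l = 0"
  shows "det M = M $ l $ l * mat_det m (\<lambda>i j. M $ b i $ b j)"
proof -
  let ?P = "{p. p permutes (UNIV :: 'n set)}" and ?Q = "{p. p permutes (UNIV - {l})}"
  let ?t = "\<lambda>p. of_int (sign p) * (\<Prod>i\<in>UNIV. M $ i $ p i)"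
  have inj: "inj_on b {..<m}" and im: "b ` {..<m} = UNIV - {l}"
    using b by (auto simp: bij_betw_def)
  have "det M = sum ?t ?P" by (simp add: det_def)
  also have "\<dots> = sum ?t ?Q"
  proof (rule sum.mono_neutral_right)
    show "finite ?P" by (simp add: finite_permutations)
    show "?Q \<subseteq> ?P" using permutes_subset[of _ "UNIV - {l}" UNIV] by blast
    show "\<forall>p\<in>?P - ?Q. ?t p = 0"
    proof
      fix p assume p: "p \<in> ?P - ?Q"
      then have "p l \<noteq> l"
        using permutes_superset[of p UNIV "UNIV - {l}"] by auto
      moreover obtain i where i: "p i = l"
        using p permutes_surj[of p UNIV] surjD[of p l] by force
      ultimately have "i \<noteq> l" by auto
      then have "M $ i $ p i = 0" using col[of i] i by simp
      then have "(\<Prod>i\<in>UNIV. M $ i $ p i) = 0" by (meson UNIV_I finite prod_zero)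
      then show "?t p = 0" by simp
    qed
  qed
  also have "\<dots> = (\<Sum>\<sigma> | \<sigma> permutes {..<m}. M $ l $ l * (of_int (sign \<sigma>) * (\<Prod>i<m. M $ b i $ b (\<sigma> i))))"
  proof (rule sum.reindex_bij_witness[where j="map_permutation (UNIV - {l}) (inv_into {..<m} b)"
        and i="map_permutation {..<m} b"])
    have b': "bij_betw (inv_into {..<m} b) (UNIV - {l}) {..<m}"
      by (rule bij_betw_inv_into[OF b])
    fix p assume p: "p \<in> ?Q"
    then have p': "p permutes (UNIV - {l})" by simp
    let ?\<sigma> = "map_permutation (UNIV - {l}) (inv_into {..<m} b) p"
    show "map_permutation {..<m} b ?\<sigma> = p"
      by (rule map_permutation_compose_inv[OF b' p']) (use im in \<open>simp add: f_inv_into_f\<close>)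
    show \<sigma>: "?\<sigma> \<in> {\<sigma>. \<sigma> permutes {..<m}}"
      using map_permutation_permutes[OF b' p'] by simp
    have sgn: "sign ?\<sigma> = sign p"
      by (rule sign_map_permutation[OF bij_betw_imp_inj_on[OF b'] p']) simp
    have bs: "b (?\<sigma> i) = p (b i)" if "i < m" for i
    proof -
      have bi: "b i \<in> UNIV - {l}" using im that by auto
      have "?\<sigma> i = ?\<sigma> (inv_into {..<m} b (b i))" using inj that by simp
      also have "\<dots> = inv_into {..<m} b (p (b i))"
        by (rule map_permutation_apply[OF bij_betw_imp_inj_on[OF b'] bi])
      finally show ?thesis
        using permutes_in_image[OF p', of "b i"] bi im by (simp add: f_inv_into_f)
    qed
    have "(\<Prod>i\<in>UNIV. M $ i $ p i) = M $ l $ p l * (\<Prod>i\<in>UNIV - {l}. M $ i $ p i)"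
      by (simp add: prod.remove)
    also have "p l = l" using p' by (simp add: permutes_not_in)
    also have "(\<Prod>i\<in>UNIV - {l}. M $ i $ p i) = (\<Prod>i<m. M $ b i $ b (?\<sigma> i))"
      by (subst prod.reindex_bij_betw[OF b, symmetric]) (simp add: bs)
    finally show "M $ l $ l * (of_int (sign ?\<sigma>) * (\<Prod>i<m. M $ b i $ b (?\<sigma> i))) = ?t p"
      by (simp add: sgn)
  next
    fix \<sigma> assume "\<sigma> \<in> {\<sigma>. \<sigma> permutes {..<m}}"
    then have \<sigma>: "\<sigma> permutes {..<m}" by simp
    show "map_permutation (UNIV - {l}) (inv_into {..<m} b) (map_permutation {..<m} b \<sigma>) = \<sigma>"
      by (rule map_permutation_compose_inv[OF b \<sigma>]) (use inj in simp)
    show "map_permutation {..<m} b \<sigma> \<in> ?Q"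
      using map_permutation_permutes[OF b \<sigma>] by simp
  qed
  finally show ?thesis unfolding mat_det_def sum_distrib_left .
qed

lemma mat_det_cong:
  assumes eq: "\<And>i j. i < m \<Longrightarrow> j < m \<Longrightarrow> A i j = B i j"
  shows "mat_det m A = mat_det m B"
  unfolding mat_det_def
proof (intro sum.cong refl arg_cong2[where f="(*)"] prod.cong)
  fix \<sigma> i assume "\<sigma> \<in> {\<sigma>. \<sigma> permutes {..<m}}" "i \<in> {..<m}"
  then have "i < m" "\<sigma> i < m" using permutes_in_image[of \<sigma> "{..<m}" i] by auto
  then show "A i (\<sigma> i) = B i (\<sigma> i)" by (rule eq)
qed

text \<open>Passing from \<open>A\<close> to the block-diagonal matrix \<open>diag(A, 1)\<close> is multiplicative, and takes \<open>mat_det\<close>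
  to the determinant on \<open>real ^ 'n ^ 'n\<close>, for which the claims are known.\<close>

lemma
  fixes l :: "'n::finite"
  assumes b: "bij_betw b {..<m} (UNIV - {l})"
  shows mat_det_mult: "mat_det m (\<lambda>i j. \<Sum>k<m. A i k * B k j) = mat_det m A * mat_det m B"
    and mat_det_transpose: "mat_det m (\<lambda>i j. A j i) = mat_det m A"
proof -
  define c where "c = inv_into {..<m} b"
  define E :: "(nat \<Rightarrow> nat \<Rightarrow> real) \<Rightarrow> real ^ 'n ^ 'n" where
    "E A = (\<chi> i j. if i = l \<or> j = l then if i = j then 1 else 0 else A (c i) (c j))" for A
  have cb: "c (b i) = i" and bl: "b i \<noteq> l" if "i < m" for i
    using b that by (auto simp: c_def bij_betw_def)
  have detE: "det (E A) = mat_det m A" for A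
  proof -
    have "det (E A) = E A $ l $ l * mat_det m (\<lambda>i j. E A $ b i $ b j)"
      by (rule det_eq_mat_det_of_column[OF b]) (simp add: E_def)
    also have "mat_det m (\<lambda>i j. E A $ b i $ b j) = mat_det m A"
      by (rule mat_det_cong) (auto simp: E_def cb bl)
    finally show ?thesis by (simp add: E_def)
  qed
  have sum_split: "(\<Sum>k\<in>UNIV. g k) = g l + (\<Sum>k<m. g (b k))" for g :: "'n \<Rightarrow> real"
    by (subst sum.reindex_bij_betw[OF b]) (simp add: sum.remove)
  have mul: "E A ** E B = E (\<lambda>i j. \<Sum>k<m. A i k * B k j)"
    unfolding vec_eq_iff matrix_matrix_mult_def vec_lambda_beta sum_split
    by (auto simp: E_def cb bl bl[THEN not_sym])
  show "mat_det m (\<lambda>i j. \<Sum>k<m. A i k * B k j) = mat_det m A * mat_det m B"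
    unfolding detE[symmetric] mul[symmetric] by (rule det_mul)
  have tr: "transpose (E A) = E (\<lambda>i j. A j i)"
    by (auto simp: vec_eq_iff transpose_def E_def)
  show "mat_det m (\<lambda>i j. A j i) = mat_det m A"
    unfolding detE[symmetric] tr[symmetric] by (rule det_transpose)
qed

lemma mat_det_scale: "mat_det m (\<lambda>i j. c * A i j) = c ^ m * mat_det m A"
  unfolding mat_det_def by (simp add: prod.distrib sum_distrib_left mult.left_commute)

lemma tangent_frame:
  fixes \<theta> :: "real ^ 'n"
  assumes "norm \<theta> = 1"
  shows tangent_frame_orthogonal: "i < CARD('n) - 1 \<Longrightarrow> tangent_frame \<theta> i \<bullet> \<theta> = 0"
    and tangent_frame_orthonormal: "i < CARD('n) - 1 \<Longrightarrow> j < CARD('n) - 1 \<Longrightarrow>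
      tangent_frame \<theta> i \<bullet> tangent_frame \<theta> j = (if i = j then 1 else 0)"
proof -
  obtain S where S: "\<theta> \<in> S" "pairwise orthogonal S" "\<And>x. x \<in> S \<Longrightarrow> norm x = 1"
    "independent S" "card S = DIM(real ^ 'n)"
    using vector_in_orthonormal_basis[OF assms] by metis
  then have fin: "finite S" by (simp add: finiteI_independent)
  have "card (S - {\<theta>}) = CARD('n) - 1" using S fin by simp
  then obtain e where e: "bij_betw e {..<CARD('n) - 1} (S - {\<theta>})"
    using fin by (metis bij_betw_iff_card card_lessThan finite_Diff finite_lessThan)
  let ?P = "\<lambda>e :: nat \<Rightarrow> real ^ 'n. (\<forall>i<CARD('n) - 1. e i \<bullet> \<theta> = 0) \<and>
     (\<forall>i<CARD('n) - 1. \<forall>j<CARD('n) - 1. e i \<bullet> e j = (if i = j then 1 else 0))"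
  have eS: "e i \<in> S - {\<theta>}" if "i < CARD('n) - 1" for i
    using e that by (auto simp: bij_betw_def)
  have einj: "e i \<noteq> e j" if "i < CARD('n) - 1" "j < CARD('n) - 1" "i \<noteq> j" for i j
    using e that by (auto simp: bij_betw_def inj_on_def)
  have "?P e"
  proof (intro conjI allI impI)
    fix i assume i: "i < CARD('n) - 1"
    then show "e i \<bullet> \<theta> = 0"
      using pairwiseD[OF S(2), of "e i" \<theta>] eS[OF i] S(1) by (auto simp: orthogonal_def)
    fix j assume j: "j < CARD('n) - 1"
    show "e i \<bullet> e j = (if i = j then 1 else 0)"
      using pairwiseD[OF S(2), of "e i" "e j"] eS[OF i] eS[OF j] einj[OF i j] S(3)[of "e i"]
      by (auto simp: orthogonal_def norm_eq_1)
  qed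
  then have "?P (SOME e. ?P e)" by (rule someI[where P="?P"])
  moreover have "tangent_frame \<theta> = (SOME e. ?P e)" by (simp only: tangent_frame_def)
  ultimately have "?P (tangent_frame \<theta>)" by (simp only:)
  then show "i < CARD('n) - 1 \<Longrightarrow> tangent_frame \<theta> i \<bullet> \<theta> = 0"
    "i < CARD('n) - 1 \<Longrightarrow> j < CARD('n) - 1 \<Longrightarrow>
      tangent_frame \<theta> i \<bullet> tangent_frame \<theta> j = (if i = j then 1 else 0)"
    by auto
qed

text \<open>The tangent frame completed by \<open>\<theta>\<close> in row \<open>l\<close>: the change from standard to adapted coordinates.\<close>

lemma adapted_frame_matrix:
  fixes \<theta> :: "real ^ 'n" and l :: 'n
  assumes b: "bij_betw b {..<CARD('n) - 1} (UNIV - {l})" and \<theta>: "norm \<theta> = 1"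
  obtains R :: "real ^ 'n ^ 'n"
  where "orthogonal_matrix R" "R $ l = \<theta>" "\<And>i. i < CARD('n) - 1 \<Longrightarrow> R $ b i = tangent_frame \<theta> i"
proof
  let ?c = "inv_into {..<CARD('n) - 1} b"
  define R :: "real ^ 'n ^ 'n" where "R = (\<chi> k. if k = l then \<theta> else tangent_frame \<theta> (?c k))"
  have c: "?c k < CARD('n) - 1" "b (?c k) = k" if "k \<noteq> l" for k
  proof -
    have "k \<in> b ` {..<CARD('n) - 1}" using b that by (simp add: bij_betw_def)
    then show "?c k < CARD('n) - 1" "b (?c k) = k"
      using inv_into_into[of k b "{..<CARD('n) - 1}"] by (simp_all add: f_inv_into_f)
  qed
  have R: "R $ k = tangent_frame \<theta> (?c k)" if "k \<noteq> l" for k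
    using that by (auto simp: R_def)
  show "R $ l = \<theta>" by (simp add: R_def)
  have "R $ k \<bullet> R $ k' = (if k = k' then 1 else 0)" for k k'
  proof (cases "k = l \<or> k' = l")
    case True
    then show ?thesis
      using \<theta> tangent_frame_orthogonal[OF \<theta> c(1)] by (auto simp: R_def inner_commute norm_eq_1)
  next
    case False
    then have "?c k = ?c k' \<longleftrightarrow> k = k'" using c(2) by metis
    then show ?thesis
      using tangent_frame_orthonormal[OF \<theta> c(1) c(1), of k k'] False by (simp add: R)
  qed
  then show "orthogonal_matrix R"
    by (simp add: orthogonal_matrix_orthonormal_rows row_def norm_eq_1 orthogonal_def)
  show "R $ b i = tangent_frame \<theta> i" if "i < CARD('n) - 1" for i
    using b that by (auto simp: R_def bij_betw_def)
qed

lemma exists_bij_lessThan_except: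
  fixes l :: "'n::finite"
  obtains b where "bij_betw b {..<CARD('n) - 1} (UNIV - {l})"
  by (metis bij_betw_iff_card card_Diff_singleton card_lessThan finite finite_lessThan UNIV_I)

lemma sum_bij_lessThan_except:
  fixes l :: "'n::finite"
  assumes "bij_betw b {..<CARD('n) - 1} (UNIV - {l})"
  shows "(\<Sum>k\<in>UNIV. g k) = (g l :: 'b :: comm_monoid_add) + (\<Sum>i<CARD('n) - 1. g (b i))"
  by (subst sum.reindex_bij_betw[OF assms]) (simp add: sum.remove)

lemma tangent_frame_expansion:
  fixes \<theta> :: "real ^ 'n"
  assumes \<theta>: "norm \<theta> = 1"
  shows "w = (\<theta> \<bullet> w) *\<^sub>R \<theta> + (\<Sum>i<CARD('n) - 1. (tangent_frame \<theta> i \<bullet> w) *\<^sub>R tangent_frame \<theta> i)"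
proof -
  obtain l :: 'n where True by simp
  obtain b where b: "bij_betw b {..<CARD('n) - 1} (UNIV - {l})"
    by (rule exists_bij_lessThan_except)
  obtain R where R: "orthogonal_matrix R" "R $ l = \<theta>" "\<And>i. i < CARD('n) - 1 \<Longrightarrow> R $ b i = tangent_frame \<theta> i"
    by (rule adapted_frame_matrix[OF b \<theta>]) blast
  have "w = transpose R *v (R *v w)"
    using R(1) by (simp add: matrix_vector_mul_assoc orthogonal_matrix_def)
  also have "\<dots> = (\<Sum>k\<in>UNIV. (R $ k \<bullet> w) *\<^sub>R R $ k)"
    by (simp add: vec_eq_iff matrix_vector_mult_def transpose_def inner_vec_def mult.commute)
  finally show ?thesis
    by (simp add: sum_bij_lessThan_except[OF b] R)
qed

text \<open>Both sides are the squared norm of the vector that represents \<open>\<phi>\<close>.\<close>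

lemma tangent_frame_sum_squares:
  fixes \<theta> :: "real ^ 'n" and \<phi> :: "real ^ 'n \<Rightarrow> real"
  assumes \<theta>: "norm \<theta> = 1" and \<phi>: "linear \<phi>"
  shows "(\<Sum>b\<in>Basis. (\<phi> b)\<^sup>2) = (\<phi> \<theta>)\<^sup>2 + (\<Sum>i<CARD('n) - 1. (\<phi> (tangent_frame \<theta> i))\<^sup>2)"
proof -
  let ?e = "tangent_frame \<theta>"
  define a where "a = adjoint \<phi> 1"
  have a: "\<phi> x = a \<bullet> x" for x
    using adjoint_works[OF \<phi>, of x 1] by (simp add: a_def inner_commute)
  have "(\<Sum>b\<in>Basis. (\<phi> b)\<^sup>2) = a \<bullet> a"
    by (subst euclidean_inner) (simp add: a power2_eq_square)
  also have "\<dots> = a \<bullet> ((\<theta> \<bullet> a) *\<^sub>R \<theta> + (\<Sum>i<CARD('n) - 1. (?e i \<bullet> a) *\<^sub>R ?e i))"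
    by (rule arg_cong[OF tangent_frame_expansion[OF \<theta>]])
  also have "\<dots> = (\<phi> \<theta>)\<^sup>2 + (\<Sum>i<CARD('n) - 1. (\<phi> (?e i))\<^sup>2)"
    by (simp add: a inner_add_right inner_sum_right power2_eq_square inner_commute)
  finally show ?thesis .
qed

lemma bilinear_frame_sum_squares: 
  fixes \<theta> :: "real ^ 'n" and H :: "real ^ 'n \<Rightarrow> real ^ 'n \<Rightarrow> real"
  assumes \<theta>: "norm \<theta> = 1" and H: "bilinear H" "\<And>v. H \<theta> v = 0" "\<And>u. H u \<theta> = 0"
  shows "(\<Sum>b\<in>Basis. \<Sum>c\<in>Basis. (H b c)\<^sup>2) =
    (\<Sum>i<CARD('n) - 1. \<Sum>j<CARD('n) - 1. (H (tangent_frame \<theta> i) (tangent_frame \<theta> j))\<^sup>2)"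
proof -
  let ?e = "tangent_frame \<theta>"
  have l1: "linear (H u)" and l2: "linear (\<lambda>u. H u v)" for u v
    using H(1) by (auto simp: bilinear_def)
  have "(\<Sum>b\<in>Basis. \<Sum>c\<in>Basis. (H b c)\<^sup>2) = (\<Sum>b\<in>Basis. \<Sum>j<CARD('n) - 1. (H b (?e j))\<^sup>2)"
    by (simp add: tangent_frame_sum_squares[OF \<theta> l1] H(3))
  also have "\<dots> = (\<Sum>j<CARD('n) - 1. \<Sum>b\<in>Basis. (H b (?e j))\<^sup>2)"
    by (rule sum.swap)
  also have "\<dots> = (\<Sum>j<CARD('n) - 1. \<Sum>i<CARD('n) - 1. (H (?e i) (?e j))\<^sup>2)"
    by (simp add: tangent_frame_sum_squares[OF \<theta> l2] H(2))
  also have "\<dots> = (\<Sum>i<CARD('n) - 1. \<Sum>j<CARD('n) - 1. (H (?e i) (?e j))\<^sup>2)"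
    by (rule sum.swap)
  finally show ?thesis .
qed

text \<open>Adding \<open>\<theta> \<theta>\<^sup>t\<close> fills the kernel of the form, so that its determinant on the tangent space
  becomes an expression in which no frame is chosen; this makes it continuous in \<open>\<theta>\<close>.\<close>

lemma mat_det_tangent_frame_eq_det:
  fixes \<theta> :: "real ^ 'n" and H :: "real ^ 'n \<Rightarrow> real ^ 'n \<Rightarrow> real"
  assumes \<theta>: "norm \<theta> = 1" and H: "bilinear H" "\<And>v. H \<theta> v = 0" "\<And>u. H u \<theta> = 0"
  shows "mat_det (CARD('n) - 1) (\<lambda>i j. H (tangent_frame \<theta> i) (tangent_frame \<theta> j)) =
    det ((\<chi> i j. H (axis i 1) (axis j 1) + \<theta> $ i * \<theta> $ j) :: real ^ 'n ^ 'n)" (is "_ = det ?N")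
proof -
  obtain l :: 'n where True by simp
  obtain b where b: "bij_betw b {..<CARD('n) - 1} (UNIV - {l})"
    by (rule exists_bij_lessThan_except)
  obtain R where R: "orthogonal_matrix R" "R $ l = \<theta>" "\<And>i. i < CARD('n) - 1 \<Longrightarrow> R $ b i = tangent_frame \<theta> i"
    by (rule adapted_frame_matrix[OF b \<theta>]) blast
  define G where "G u v = H u v + (u \<bullet> \<theta>) * (v \<bullet> \<theta>)" for u v
  have l1: "linear (H u)" and l2: "linear (\<lambda>u. H u v)" for u v
    using H(1) by (auto simp: bilinear_def)
  have G1: "linear (G u)" and G2: "linear (\<lambda>u. G u v)" for u v
    unfolding G_def by (auto simp: linear_iff linear_add[OF l1] linear_scale[OF l1] linear_add[OF l2]
        linear_scale[OF l2] inner_add_left algebra_simps)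
  have exp: "G u v = (\<Sum>j\<in>UNIV. \<Sum>i\<in>UNIV. u $ i * v $ j * G (axis i 1) (axis j 1))" for u v
  proof -
    have "G u v = G u (\<Sum>j\<in>UNIV. v $ j *s axis j 1)" by (simp add: basis_expansion)
    also have "\<dots> = (\<Sum>j\<in>UNIV. v $ j * G u (axis j 1))"
      by (simp add: linear_sum[OF G1] scalar_mult_eq_scaleR linear_scale[OF G1])
    also have "\<dots> = (\<Sum>j\<in>UNIV. v $ j * G (\<Sum>i\<in>UNIV. u $ i *s axis i 1) (axis j 1))"
      by (simp add: basis_expansion)
    also have "\<dots> = (\<Sum>j\<in>UNIV. \<Sum>i\<in>UNIV. u $ i * v $ j * G (axis i 1) (axis j 1))"
      by (simp add: linear_sum[OF G2] scalar_mult_eq_scaleR linear_scale[OF G2] sum_distrib_left algebra_simps)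
    finally show ?thesis .
  qed
  have N: "?N $ i $ j = G (axis i 1) (axis j 1)" for i j
    by (simp add: G_def inner_axis' )
  have ent: "(R ** ?N ** transpose R) $ i $ j = G (R $ i) (R $ j)" for i j
  proof -
    have "(R ** ?N ** transpose R) $ i $ j =
        (\<Sum>k\<in>UNIV. (\<Sum>p\<in>UNIV. R $ i $ p * ?N $ p $ k) * R $ j $ k)"
      by (simp only: matrix_matrix_mult_def transpose_def vec_lambda_beta)
    also have "\<dots> = (\<Sum>k\<in>UNIV. \<Sum>p\<in>UNIV. R $ i $ p * R $ j $ k * G (axis p 1) (axis k 1))"
      unfolding N sum_distrib_right by (simp only: mult_ac)
    finally show ?thesis by (simp only: exp[of "R $ i" "R $ j"])
  qed
  have "(det R)\<^sup>2 = 1" using det_orthogonal_matrix[OF R(1)] by auto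
  then have "det ?N = det (R ** ?N ** transpose R)"
    by (simp add: det_mul power2_eq_square)
  also have "\<dots> = (R ** ?N ** transpose R) $ l $ l * mat_det (CARD('n) - 1) (\<lambda>i j. (R ** ?N ** transpose R) $ b i $ b j)"
  proof (rule det_eq_mat_det_of_column[OF b])
    fix i assume "i \<noteq> l"
    then have "R $ i \<bullet> R $ l = 0"
      using R(1) by (simp add: orthogonal_matrix_orthonormal_rows row_def orthogonal_def)
    then show "(R ** ?N ** transpose R) $ i $ l = 0"
      unfolding ent by (simp add: G_def R H)
  qed
  also have "\<dots> = mat_det (CARD('n) - 1) (\<lambda>i j. H (tangent_frame \<theta> i) (tangent_frame \<theta> j))"
    unfolding ent using \<theta>
    by (auto simp: G_def R H norm_eq_1 tangent_frame_orthogonal[OF \<theta>] intro!: mat_det_cong)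
  finally show ?thesis by simp
qed

text \<open>A linear map induces a map from the tangent space at \<open>\<theta>\<close> to the tangent space at
  \<open>A \<theta> / |A \<theta>|\<close>, by projecting off the radial direction. In adapted frames \<open>A\<close> is block triangular
  with radial entry \<open>|A \<theta>|\<close>, so this induced map has determinant \<open>\<plusminus> det A / |A \<theta>|\<close>; a form
  with radial kernel does not see the projection.\<close>

lemma mat_det_tangent_frame_linear:
  fixes \<theta> :: "real ^ 'n" and A :: "real ^ 'n ^ 'n" and H :: "real ^ 'n \<Rightarrow> real ^ 'n \<Rightarrow> real"
  assumes \<theta>: "norm \<theta> = 1" and nz: "A *v \<theta> \<noteq> 0"
    and y: "y = (A *v \<theta>) /\<^sub>R norm (A *v \<theta>)"
    and H: "bilinear H" "\<And>v. H y v = 0" "\<And>u. H u y = 0"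
  shows "mat_det (CARD('n) - 1) (\<lambda>i j. H (A *v tangent_frame \<theta> i) (A *v tangent_frame \<theta> j)) =
    (det A / norm (A *v \<theta>))\<^sup>2 * mat_det (CARD('n) - 1) (\<lambda>i j. H (tangent_frame y i) (tangent_frame y j))"
proof -
  let ?m = "CARD('n) - 1"
  define C where "C k i = tangent_frame y k \<bullet> (A *v tangent_frame \<theta> i)" for k i
  define D where "D i j = H (tangent_frame y i) (tangent_frame y j)" for i j
  have ny: "norm y = 1" using nz by (simp add: y)
  have Ay: "A *v \<theta> = norm (A *v \<theta>) *\<^sub>R y" using nz by (simp add: y)
  obtain l :: 'n where True by simp
  obtain b where b: "bij_betw b {..<?m} (UNIV - {l})"
    by (rule exists_bij_lessThan_except)
  obtain R where R: "orthogonal_matrix R" "R $ l = \<theta>" "\<And>i. i < ?m \<Longrightarrow> R $ b i = tangent_frame \<theta> i"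
    by (rule adapted_frame_matrix[OF b \<theta>]) blast
  obtain Q where Q: "orthogonal_matrix Q" "Q $ l = y" "\<And>i. i < ?m \<Longrightarrow> Q $ b i = tangent_frame y i"
    by (rule adapted_frame_matrix[OF b ny]) blast
  let ?B = "Q ** A ** transpose R"
  have B: "?B $ k $ i = Q $ k \<bullet> (A *v R $ i)" for k i
    by (simp add: matrix_mul_assoc[symmetric])
      (simp add: matrix_matrix_mult_def transpose_def inner_vec_def matrix_vector_mult_def)
  have "(det R)\<^sup>2 = 1" "(det Q)\<^sup>2 = 1" using det_orthogonal_matrix R(1) Q(1) by fastforce+
  then have "(det A)\<^sup>2 = (det ?B)\<^sup>2"
    by (simp add: det_mul power_mult_distrib)
  also have "det ?B = ?B $ l $ l * mat_det ?m (\<lambda>i j. ?B $ b i $ b j)"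
  proof (rule det_eq_mat_det_of_column[OF b])
    fix i assume "i \<noteq> l"
    then have "Q $ i \<bullet> Q $ l = 0"
      using Q(1) by (simp add: orthogonal_matrix_orthonormal_rows row_def orthogonal_def)
    then show "?B $ i $ l = 0" unfolding B R(2) by (subst Ay) (simp add: Q)
  qed
  also have "?B $ l $ l = norm (A *v \<theta>)"
    unfolding B R(2) Q(2) by (subst Ay) (use ny in \<open>simp add: norm_eq_1\<close>)
  also have "mat_det ?m (\<lambda>i j. ?B $ b i $ b j) = mat_det ?m C"
    unfolding B by (rule mat_det_cong) (simp add: C_def R Q)
  finally have det: "(mat_det ?m C)\<^sup>2 = (det A / norm (A *v \<theta>))\<^sup>2"
    using nz by (simp add: field_simps power_mult_distrib)
  have l1: "linear (H u)" and l2: "linear (\<lambda>u. H u v)" for u v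
    using H(1) by (auto simp: bilinear_def)
  have exp: "H u v = (\<Sum>p<?m. (\<Sum>k<?m. (tangent_frame y k \<bullet> u) * D k p) * (tangent_frame y p \<bullet> v))" for u v
  proof -
    have "H u v = H u ((y \<bullet> v) *\<^sub>R y + (\<Sum>p<?m. (tangent_frame y p \<bullet> v) *\<^sub>R tangent_frame y p))"
      by (rule arg_cong[OF tangent_frame_expansion[OF ny]])
    also have "\<dots> = (\<Sum>p<?m. (tangent_frame y p \<bullet> v) * H u (tangent_frame y p))"
      by (simp add: linear_add[OF l1] linear_scale[OF l1] linear_sum[OF l1] H)
    also have "\<dots> = (\<Sum>p<?m. (tangent_frame y p \<bullet> v) *
        H ((y \<bullet> u) *\<^sub>R y + (\<Sum>k<?m. (tangent_frame y k \<bullet> u) *\<^sub>R tangent_frame y k)) (tangent_frame y p))"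
      by (intro sum.cong refl arg_cong[where f="\<lambda>x. _ * H x _"] tangent_frame_expansion[OF ny])
    also have "\<dots> = (\<Sum>p<?m. (\<Sum>k<?m. (tangent_frame y k \<bullet> u) * D k p) * (tangent_frame y p \<bullet> v))"
      by (simp add: linear_add[OF l2] linear_scale[OF l2] linear_sum[OF l2] H D_def mult.commute)
    finally show ?thesis .
  qed
  have "mat_det ?m (\<lambda>i j. H (A *v tangent_frame \<theta> i) (A *v tangent_frame \<theta> j)) =
      mat_det ?m (\<lambda>i j. \<Sum>p<?m. (\<Sum>k<?m. C k i * D k p) * C p j)"
    unfolding C_def by (rule mat_det_cong) (rule exp)
  also have "\<dots> = mat_det ?m C * mat_det ?m D * mat_det ?m C"
    using mat_det_mult[OF b, of "\<lambda>i p. \<Sum>k<?m. C k i * D k p" C] mat_det_mult[OF b, of "\<lambda>i k. C k i" D]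
      mat_det_transpose[OF b, of C] by simp
  also have "\<dots> = (det A / norm (A *v \<theta>))\<^sup>2 * mat_det ?m D"
    unfolding det[symmetric] by (simp add: power2_eq_square)
  finally show ?thesis by (simp add: D_def[abs_def])
qed

section \<open>The action of linear maps on functions on the sphere\<close>

lemma invertible_mult_eq_0: "invertible A \<Longrightarrow> A *v x = 0 \<longleftrightarrow> x = 0" for A :: "real ^ 'n ^ 'n"
  by (metis invertible_def matrix_vector_mul_assoc matrix_vector_mul_lid matrix_vector_mult_0_right)

lemma invertible_transpose: "invertible A \<Longrightarrow> invertible (transpose A)" for A :: "real ^ 'n ^ 'n"
  by (simp add: invertible_det_nz det_transpose)

lemma open_minus_zero: "open (- {0 :: real ^ 'n})"
  by auto

lemma hom_ext_sphere: "norm x = 1 \<Longrightarrow> hom_ext h x = h x"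
  by (simp add: hom_ext_def)

lemma hom_ext_eq_self: "pos_homogeneous f \<Longrightarrow> x \<noteq> 0 \<Longrightarrow> hom_ext f x = f x"
  unfolding hom_ext_def pos_homogeneous_def by (metis mult.left_neutral mult.left_commute
    norm_eq_zero positive_imp_inverse_positive right_inverse scaleR_left_imp_eq zero_less_norm_iff mult.commute)

lemma hom_ext_mult:
  "x \<noteq> 0 \<Longrightarrow> hom_ext (\<lambda>x. g x * h x) x = hom_ext g x * hom_ext h x * inverse (norm x)"
  by (simp add: hom_ext_def)

lemma push0_scaleR:
  fixes T :: "real ^ 'n ^ 'n"
  assumes t: "t > 0"
  shows "push0 T z (t *\<^sub>R x) = push0 T z x"
proof -
  have "(t *\<^sub>R w) /\<^sub>R norm (t *\<^sub>R w) = w /\<^sub>R norm w" for w :: "real ^ 'n"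
    using t by simp
  then show ?thesis unfolding push0_def matrix_vector_mult_scaleR by (rule arg_cong)
qed

lemma hom_ext_push0:
  fixes T :: "real ^ 'n ^ 'n"
  assumes T: "invertible T" and x: "x \<noteq> 0"
  shows "hom_ext (push0 T z) x =
    norm x * inverse (norm (transpose T *v x)) * hom_ext z (transpose T *v x)"
proof -
  let ?w = "transpose T *v x"
  have w: "?w \<noteq> 0"
    using x invertible_mult_eq_0[OF invertible_transpose[OF T]] by simp
  have "hom_ext (push0 T z) x = norm x * push0 T z x"
    unfolding hom_ext_def using x push0_scaleR[of "inverse (norm x)" T z x] by simp
  then show ?thesis using w x by (simp add: push0_def hom_ext_def mult.assoc[symmetric] del: transpose_matrix_vector)
qed

lemma C2_sphere_mult: "C2_sphere g \<Longrightarrow> C2_sphere h \<Longrightarrow> C2_sphere (\<lambda>x. g x * h x)"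
  unfolding C2_sphere_def
  by (rule C2_on_cong_C2[OF open_minus_zero C2_on_mult_C2[OF open_minus_zero
        C2_on_mult_C2[OF open_minus_zero] C2_on_inverse[OF open_minus_zero C2_on_norm]]])
    (auto simp: hom_ext_mult)

lemma C2_sphere_diff: "C2_sphere g \<Longrightarrow> C2_sphere h \<Longrightarrow> C2_sphere (\<lambda>x. g x - h x)"
  unfolding C2_sphere_def
  by (rule C2_on_cong_C2[OF open_minus_zero C2_on_diff[OF open_minus_zero, of "hom_ext g" "hom_ext h"]])
    (auto simp: hom_ext_def algebra_simps)

text \<open>The factor by which \<open>hom_ext (push0 T z)\<close> differs from \<open>hom_ext z \<circ> transpose T\<close>.\<close>

lemma C2_on_norm_ratio:
  fixes A :: "real ^ 'n ^ 'n"
  assumes A: "invertible A"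
  shows "C2_on (- {0}) (\<lambda>x. norm x * inverse (norm (A *v x)))"
proof -
  have nA: "C2_on (- {0}) (\<lambda>x. norm (A *v x))"
    by (rule C2_on_linear_comp_C2[OF open_minus_zero _ C2_on_norm])
      (auto simp: invertible_mult_eq_0[OF A])
  show ?thesis
    by (rule C2_on_mult_C2[OF open_minus_zero C2_on_norm C2_on_inverse[OF open_minus_zero nA]])
      (auto simp: invertible_mult_eq_0[OF A])
qed

lemma C2_on_comp_matrix:
  fixes A :: "real ^ 'n ^ 'n"
  assumes A: "invertible A" and f: "C2_on (- {0}) f"
  shows "C2_on (- {0}) (\<lambda>x. f (A *v x))"
  by (rule C2_on_linear_comp_C2[OF open_minus_zero _ f]) (auto simp: invertible_mult_eq_0[OF A])

lemma C2_sphere_push0: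
  fixes T :: "real ^ 'n ^ 'n"
  assumes T: "invertible T" and z: "C2_sphere z"
  shows "C2_sphere (push0 T z)"
  unfolding C2_sphere_def
  by (rule C2_on_cong_C2[OF open_minus_zero C2_on_mult_C2[OF open_minus_zero
        C2_on_norm_ratio[OF invertible_transpose[OF T]]
        C2_on_comp_matrix[OF invertible_transpose[OF T] z[unfolded C2_sphere_def]]]])
    (auto simp: hom_ext_push0[OF T])

text \<open>Forms with radial kernel are determined by their restriction to the tangent space, and can be compared
  at different points of the sphere.\<close>

lemma hess_hom_ext:
  fixes h :: "real ^ 'n \<Rightarrow> real"
  assumes h: "C2_sphere h" and x: "x \<noteq> 0"
  shows bilinear_hess_hom_ext: "bilinear (hess (hom_ext h) x)"
    and hess_hom_ext_radial_left: "hess (hom_ext h) x x v = 0"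
    and hess_hom_ext_radial_right: "hess (hom_ext h) x u x = 0"
proof -
  note h' = h[unfolded C2_sphere_def]
  have "x \<in> - {0}" using x by simp
  then show "bilinear (hess (hom_ext h) x)"
    unfolding bilinear_def
    using C2_on_linear_hess[OF h'] C2_on_linear_hess_left[OF open_minus_zero h'] by auto
  show "hess (hom_ext h) x x v = 0" "hess (hom_ext h) x u x = 0"
    using hess_radial_left[OF h' pos_homogeneous_hom_ext x]
      hess_radial_right[OF h' pos_homogeneous_hom_ext x] by auto
qed

lemma bilinear_sum_fun:
  assumes "\<And>k. k \<in> I \<Longrightarrow> bilinear (H k)"
  shows "bilinear (\<lambda>u v. \<Sum>k\<in>I. H k u v)"
  using assms unfolding bilinear_def by (auto intro: linear_compose_sum)

text \<open>When the 1-homogeneous extensions are related by \<open>F k = f k \<circ> A\<close>, all the forms \<open>D\<^sup>2\<close>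
  change by the same linear map and the same homogeneity factor, so that mixed discriminants
  change by a factor which does not depend on the functions.\<close>

lemma mat_det_sum_D2_linear:
  fixes A :: "real ^ 'n ^ 'n" and h h' :: "nat \<Rightarrow> real ^ 'n \<Rightarrow> real"
  assumes A: "invertible A" and \<theta>: "norm \<theta> = 1"
    and h: "\<And>k. C2_sphere (h k)"
    and h': "\<And>k x. x \<noteq> 0 \<Longrightarrow> hom_ext (h' k) x = hom_ext (h k) (A *v x)"
    and y: "y = (A *v \<theta>) /\<^sub>R norm (A *v \<theta>)"
  shows "mat_det (CARD('n) - 1) (\<lambda>i j. \<Sum>k\<in>I. D2 (h' k) \<theta> i j) =
    (det A)\<^sup>2 / norm (A *v \<theta>) ^ (CARD('n) + 1) *
    mat_det (CARD('n) - 1) (\<lambda>i j. \<Sum>k\<in>I. D2 (h k) y i j)"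
proof -
  let ?m = "CARD('n) - 1" and ?r = "norm (A *v \<theta>)"
  let ?H = "\<lambda>u v. \<Sum>k\<in>I. hess (hom_ext (h k)) y u v"
  have \<theta>0: "\<theta> \<noteq> 0" using \<theta> by auto
  have nz: "A *v \<theta> \<noteq> 0" using \<theta>0 A by (simp add: invertible_mult_eq_0)
  have r: "?r > 0" using nz by simp
  have y0: "y \<noteq> 0" and Ay: "A *v \<theta> = ?r *\<^sub>R y" using nz by (auto simp: y)
  have D: "D2 (h' k) \<theta> i j = inverse ?r * hess (hom_ext (h k)) y (A *v tangent_frame \<theta> i) (A *v tangent_frame \<theta> j)" for k i j
  proof -
    have C: "C2_on (- {0}) (\<lambda>x. hom_ext (h k) (A *v x))"
      by (rule C2_on_comp_matrix[OF A h[unfolded C2_sphere_def]])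
    have "D2 (h' k) \<theta> i j = hess (\<lambda>x. hom_ext (h k) (A *v x)) \<theta> (tangent_frame \<theta> i) (tangent_frame \<theta> j)"
      unfolding D2_def by (rule C2_on_cong_hess[OF open_minus_zero C]) (use h' \<theta>0 in auto)
    also have "\<dots> = hess (hom_ext (h k)) (A *v \<theta>) (A *v tangent_frame \<theta> i) (A *v tangent_frame \<theta> j)"
      by (rule C2_on_linear_comp_hess[OF open_minus_zero _ h[unfolded C2_sphere_def]])
        (use \<theta>0 in \<open>auto simp: invertible_mult_eq_0[OF A]\<close>)
    also have "\<dots> = hess (hom_ext (h k)) y (A *v tangent_frame \<theta> i) (A *v tangent_frame \<theta> j) / ?r"
      by (subst Ay) (rule hess_pos_homogeneous_scale[OF h[unfolded C2_sphere_def] pos_homogeneous_hom_ext r y0])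
    finally show ?thesis by (simp add: divide_inverse mult.commute)
  qed
  have bil: "bilinear ?H" by (intro bilinear_sum_fun bilinear_hess_hom_ext h y0)
  have "mat_det ?m (\<lambda>i j. \<Sum>k\<in>I. D2 (h' k) \<theta> i j) =
      mat_det ?m (\<lambda>i j. inverse ?r * ?H (A *v tangent_frame \<theta> i) (A *v tangent_frame \<theta> j))"
    by (simp add: D sum_distrib_left)
  also have "\<dots> = inverse ?r ^ ?m * ((det A / ?r)\<^sup>2 * mat_det ?m (\<lambda>i j. ?H (tangent_frame y i) (tangent_frame y j)))"
    unfolding mat_det_scale
    by (subst mat_det_tangent_frame_linear[OF \<theta> nz y bil])
      (simp_all add: hess_hom_ext_radial_left[OF h y0] hess_hom_ext_radial_right[OF h y0])
  also have "inverse ?r ^ ?m * ((det A / ?r)\<^sup>2 * a) = (det A)\<^sup>2 / ?r ^ (CARD('n) + 1) * a" for a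
  proof -
    have "CARD('n) + 1 = ?m + 2" by simp
    then have "?r ^ (CARD('n) + 1) = ?r ^ ?m * ?r\<^sup>2" by (simp only: power_add)
    then show ?thesis by (simp add: power_inverse divide_inverse power_mult_distrib)
  qed
  finally show ?thesis by (simp add: D2_def)
qed

lemma mixed_S_linear:
  fixes A :: "real ^ 'n ^ 'n" and h h' :: "nat \<Rightarrow> real ^ 'n \<Rightarrow> real"
  assumes A: "invertible A" and \<theta>: "norm \<theta> = 1"
    and h: "\<And>k. C2_sphere (h k)"
    and h': "\<And>k x. x \<noteq> 0 \<Longrightarrow> hom_ext (h' k) x = hom_ext (h k) (A *v x)"
    and y: "y = (A *v \<theta>) /\<^sub>R norm (A *v \<theta>)"
  shows "mixed_S h' \<theta> = (det A)\<^sup>2 / norm (A *v \<theta>) ^ (CARD('n) + 1) * mixed_S h y"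
proof -
  let ?c = "(det A)\<^sup>2 / norm (A *v \<theta>) ^ (CARD('n) + 1)"
  have "mat_det (CARD('n) - 1) (\<lambda>i j. \<Sum>k\<in>I. D2 (h' k) \<theta> i j) =
      ?c * mat_det (CARD('n) - 1) (\<lambda>i j. \<Sum>k\<in>I. D2 (h k) y i j)" for I
    by (rule mat_det_sum_D2_linear[OF A \<theta> h h' y])
  then show ?thesis
    unfolding mixed_S_def mixed_discriminant_def
    by (simp only: sum_distrib_left times_divide_eq_right mult.left_commute[of _ ?c])
qed

lemma mat_det_D2_linear:
  fixes A :: "real ^ 'n ^ 'n" and h h' :: "real ^ 'n \<Rightarrow> real"
  assumes A: "invertible A" and \<theta>: "norm \<theta> = 1" and h: "C2_sphere h"
    and h': "\<And>x. x \<noteq> 0 \<Longrightarrow> hom_ext h' x = hom_ext h (A *v x)"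
    and y: "y = (A *v \<theta>) /\<^sub>R norm (A *v \<theta>)"
  shows "mat_det (CARD('n) - 1) (D2 h' \<theta>) =
    (det A)\<^sup>2 / norm (A *v \<theta>) ^ (CARD('n) + 1) * mat_det (CARD('n) - 1) (D2 h y)"
  using mat_det_sum_D2_linear[where h="\<lambda>_. h" and h'="\<lambda>_. h'" and I="{0}", OF A \<theta> h h' y] by simp

text \<open>The frames are chosen without any continuity, so a frame-free expression for the determinant is
  needed.\<close>

lemma continuous_on_mat_det_D2:
  fixes h :: "real ^ 'n \<Rightarrow> real"
  assumes h: "C2_sphere h"
  shows "continuous_on (sphere 0 1) (\<lambda>\<theta>. mat_det (CARD('n) - 1) (D2 h \<theta>))"
proof -
  have "continuous_on (sphere 0 1) (\<lambda>\<theta>. det ((\<chi> i j. hess (hom_ext h) \<theta> (axis i 1) (axis j 1) + \<theta> $ i * \<theta> $ j) :: real ^ 'n ^ 'n))"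
    unfolding det_def vec_lambda_beta
    by (intro continuous_intros continuous_on_subset[OF C2_on_hess_continuous[OF h[unfolded C2_sphere_def]]]) auto
  then show ?thesis
  proof (rule continuous_on_eq)
    fix \<theta> :: "real ^ 'n" assume "\<theta> \<in> sphere 0 1"
    then have \<theta>: "norm \<theta> = 1" and nz: "\<theta> \<noteq> 0" by auto
    show "det ((\<chi> i j. hess (hom_ext h) \<theta> (axis i 1) (axis j 1) + \<theta> $ i * \<theta> $ j) :: real ^ 'n ^ 'n) =
        mat_det (CARD('n) - 1) (D2 h \<theta>)"
      using mat_det_tangent_frame_eq_det[OF \<theta> hess_hom_ext[OF h nz]] by (simp add: D2_def[abs_def])
  qed
qed

lemma support_fun_linear_image:
  fixes T :: "real ^ 'n ^ 'n"
  shows "support_fun ((\<lambda>x. T *v x) ` K) u = support_fun K (transpose T *v u)"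
  by (simp add: support_fun_def image_comp dot_lmul_matrix[symmetric] inner_commute)

lemma pos_homogeneous_support_fun:
  fixes K :: "(real ^ 'n) set"
  assumes "bounded K" "K \<noteq> {}"
  shows "pos_homogeneous (support_fun K)"
  unfolding pos_homogeneous_def
proof (intro allI impI)
  fix t :: real and u :: "real ^ 'n" assume t: "t > 0"
  obtain B where "norm x \<le> B" if "x \<in> K" for x using assms(1) by (auto simp: bounded_iff)
  then have "x \<bullet> u \<le> B * norm u" if "x \<in> K" for x
    using norm_cauchy_schwarz[of x u] mult_right_mono[of "norm x" B "norm u"] that by force
  then have bdd: "bdd_above ((\<lambda>x. x \<bullet> u) ` K)" by (rule bdd_aboveI2)
  have "t * Sup ((\<lambda>x. x \<bullet> u) ` K) = Sup ((*) t ` (\<lambda>x. x \<bullet> u) ` K)"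
    by (rule continuous_at_Sup_mono)
      (use t bdd assms in \<open>auto intro!: monoI mult_left_mono continuous_intros\<close>)
  then show "support_fun K (t *\<^sub>R u) = t * support_fun K u"
    by (simp add: support_fun_def image_comp comp_def)
qed

lemma hom_ext_support_fun_linear:
  fixes T :: "real ^ 'n ^ 'n"
  assumes T: "invertible T" and K: "bounded K" "K \<noteq> {}" and x: "x \<noteq> 0"
  shows "hom_ext (support_fun ((\<lambda>x. T *v x) ` K)) x = hom_ext (support_fun K) (transpose T *v x)"
proof -
  have "bounded ((\<lambda>x. T *v x) ` K)"
    using bounded_linear_image[OF K(1) matrix_vector_mul_bounded_linear[of T]] .
  then have "pos_homogeneous (support_fun ((\<lambda>x. T *v x) ` K))"
    using K by (intro pos_homogeneous_support_fun) auto
  then have "hom_ext (support_fun ((\<lambda>x. T *v x) ` K)) x = support_fun ((\<lambda>x. T *v x) ` K) x"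
    by (rule hom_ext_eq_self[OF _ x])
  also have "\<dots> = hom_ext (support_fun K) (transpose T *v x)"
    unfolding support_fun_linear_image
    using hom_ext_eq_self[OF pos_homogeneous_support_fun[OF K]] x invertible_mult_eq_0[OF invertible_transpose[OF T]]
    by simp
  finally show ?thesis .
qed

lemma C2_sphere_support_fun_linear_image:
  fixes T :: "real ^ 'n ^ 'n"
  assumes T: "invertible T" and K: "bounded K" "K \<noteq> {}" and C: "C2_sphere (support_fun K)"
  shows "C2_sphere (support_fun ((\<lambda>x. T *v x) ` K))"
  unfolding C2_sphere_def
  by (rule C2_on_cong_C2[OF open_minus_zero
      C2_on_comp_matrix[OF invertible_transpose[OF T] C[unfolded C2_sphere_def]]])
    (use hom_ext_support_fun_linear[OF T K] in auto)

text \<open>The support functions satisfy \<open>h\<^bsub>T K\<^esub> = h\<^sub>K \<circ> A\<close> with \<open>A = transpose T\<close>. The product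
  \<open>(push0 T z) h\<^bsub>T K\<^esub>\<close> has the 1-homogeneous extension \<open>(hom_ext (z h\<^sub>K)) \<circ> A\<close> without any further
  factor, since the factor \<open>|x| / |A x|\<close> from \<open>push0\<close> is absorbed by the degree of \<open>h\<^sub>K\<close>.\<close>

theorem hbm_C2_push0:
  fixes T :: "real ^ 'n ^ 'n"
  assumes T: "invertible T" and K: "bounded K" "K \<noteq> {}" and C: "C2_sphere (support_fun K)"
    and z: "C2_sphere z" and \<theta>: "norm \<theta> = 1"
  shows "hbm_C2 ((\<lambda>x. T *v x) ` K) (push0 T z) \<theta> = push0 T (hbm_C2 K z) \<theta>"
proof -
  let ?A = "transpose T" and ?TK = "(\<lambda>x. T *v x) ` K"
  define y where "y = (?A *v \<theta>) /\<^sub>R norm (?A *v \<theta>)"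
  let ?c = "(det ?A)\<^sup>2 / norm (?A *v \<theta>) ^ (CARD('n) + 1)"
  note A = invertible_transpose[OF T]
  have ext: "hom_ext (\<lambda>x. push0 T z x * support_fun ?TK x) x = hom_ext (\<lambda>x. z x * support_fun K x) (?A *v x)"
    if x: "x \<noteq> 0" for x
    using x invertible_mult_eq_0[OF A, of x]
    by (simp add: hom_ext_mult hom_ext_push0[OF T] hom_ext_support_fun_linear[OF T K])
  have 1: "mixed_S (\<lambda>k. if k = 0 then (\<lambda>x. push0 T z x * support_fun ?TK x) else support_fun ?TK) \<theta> =
      ?c * mixed_S (\<lambda>k. if k = 0 then (\<lambda>x. z x * support_fun K x) else support_fun K) y"
    by (rule mixed_S_linear[OF A \<theta> _ _ y_def])
      (use ext in \<open>auto simp: C2_sphere_mult z C hom_ext_support_fun_linear[OF T K]\<close>)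
  have 2: "mixed_S (\<lambda>k. support_fun ?TK) \<theta> = ?c * mixed_S (\<lambda>k. support_fun K) y"
    by (rule mixed_S_linear[OF A \<theta> _ _ y_def]) (auto simp: C hom_ext_support_fun_linear[OF T K])
  have "?A *v \<theta> \<noteq> 0" using \<theta> invertible_mult_eq_0[OF A, of \<theta>] by auto
  moreover have "det ?A \<noteq> 0" using A by (simp add: invertible_det_nz)
  \<comment> \<open>A nonzero common factor cancels in the quotient, also if the denominator vanishes.\<close>
  ultimately have "?c \<noteq> 0" by simp
  then show ?thesis
    unfolding hbm_C2_def[of ?TK] 1 2 by (simp add: push0_def y_def[symmetric] hbm_C2_def del: transpose_matrix_vector)
qed

section \<open>Lebesgue measure under linear maps\<close>

lemma measurable_matrix_vector_mult [measurable]: "(\<lambda>x. (A :: real ^ 'n ^ 'm) *v x) \<in> borel_measurable borel"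
  by (intro borel_measurable_continuous_onI matrix_vector_mult_linear_continuous_on)

lemma measurable_vec_nth [measurable]: "(\<lambda>x :: real ^ 'n. x $ i) \<in> borel_measurable borel"
  by (intro borel_measurable_continuous_onI continuous_intros)

text \<open>Integration along the lines parallel to the axis \<open>m\<close>: weighting \<open>F x\<close> by the mass 1 of
  the interval of all \<open>t\<close> with \<open>0 \<le> x\<^sub>m - t \<le> 1\<close>, and translating by \<open>t\<close>, gives the right-hand
  side. The inner integral is unchanged when \<open>F\<close> is translated along the line, by an amount
  that may depend on the line; hence shears preserve Lebesgue measure.\<close>

lemma nn_integral_lines:
  fixes F :: "real ^ 'n \<Rightarrow> ennreal"
  assumes [measurable]: "F \<in> borel_measurable borel"
  shows "(\<integral>\<^sup>+x. F x \<partial>lborel) =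
    (\<integral>\<^sup>+x. indicator {0..1} (x $ m) * (\<integral>\<^sup>+t. F (x + t *\<^sub>R axis m 1) \<partial>lborel) \<partial>lborel)"
proof -
  have "(\<integral>\<^sup>+x. F x \<partial>lborel) = (\<integral>\<^sup>+x. (\<integral>\<^sup>+t. F x * indicator {0..1} (x $ m - t) \<partial>lborel) \<partial>lborel)"
  proof (rule nn_integral_cong)
    fix x :: "real ^ 'n"
    have "(\<integral>\<^sup>+t. F x * indicator {0..1} (x $ m - t) \<partial>lborel) =
        (\<integral>\<^sup>+t. F x * indicator {x $ m - 1..x $ m} t \<partial>lborel)"
      by (intro nn_integral_cong) (auto split: split_indicator)
    also have "\<dots> = F x" by (simp add: nn_integral_cmult_indicator)
    finally show "F x = (\<integral>\<^sup>+t. F x * indicator {0..1} (x $ m - t) \<partial>lborel)" by simp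
  qed
  also have "\<dots> = (\<integral>\<^sup>+t. (\<integral>\<^sup>+x. F x * indicator {0..1} (x $ m - t) \<partial>lborel) \<partial>lborel)"
    by (rule lborel_pair.Fubini'[symmetric]) measurable
  also have "\<dots> = (\<integral>\<^sup>+t. (\<integral>\<^sup>+x. indicator {0..1} (x $ m) * F (x + t *\<^sub>R axis m 1) \<partial>lborel) \<partial>lborel)"
  proof (rule nn_integral_cong)
    fix t :: real
    have "(\<integral>\<^sup>+x. F x * indicator {0..1} (x $ m - t) \<partial>lborel) =
        (\<integral>\<^sup>+x. F x * indicator {0..1} (x $ m - t) \<partial>distr lborel borel ((+) (t *\<^sub>R axis m 1)))"
      by (simp add: lborel_distr_plus)
    also have "\<dots> = (\<integral>\<^sup>+x. indicator {0..1} (x $ m) * F (x + t *\<^sub>R axis m 1) \<partial>lborel)"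
      by (subst nn_integral_distr) (auto simp: axis_def add.commute mult.commute)
    finally show "(\<integral>\<^sup>+x. F x * indicator {0..1} (x $ m - t) \<partial>lborel) =
        (\<integral>\<^sup>+x. indicator {0..1} (x $ m) * F (x + t *\<^sub>R axis m 1) \<partial>lborel)" .
  qed
  also have "\<dots> = (\<integral>\<^sup>+x. (\<integral>\<^sup>+t. indicator {0..1} (x $ m) * F (x + t *\<^sub>R axis m 1) \<partial>lborel) \<partial>lborel)"
    by (rule lborel_pair.Fubini') measurable
  finally show ?thesis by (simp add: nn_integral_cmult)
qed

lemma nn_integral_shear:
  fixes F :: "real ^ 'n \<Rightarrow> ennreal"
  assumes [measurable]: "F \<in> borel_measurable borel" and mn: "m \<noteq> n"
  shows "(\<integral>\<^sup>+x. F (\<chi> i. if i = m then x $ m + x $ n else x $ i) \<partial>lborel) = (\<integral>\<^sup>+x. F x \<partial>lborel)"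
proof -
  have shear: "(\<chi> i. if i = m then x $ m + x $ n else x $ i) = x + x $ n *\<^sub>R axis m 1" for x :: "real ^ 'n"
    by (auto simp: vec_eq_iff axis_def)
  have [measurable]: "(\<lambda>x. F (x + x $ n *\<^sub>R axis m 1)) \<in> borel_measurable borel"
    by measurable
  have line: "(\<integral>\<^sup>+t. F (x + t *\<^sub>R axis m 1 + (x + t *\<^sub>R axis m 1) $ n *\<^sub>R axis m 1) \<partial>lborel) =
      (\<integral>\<^sup>+t. F (x + t *\<^sub>R axis m 1) \<partial>lborel)" for x
  proof -
    have "(\<integral>\<^sup>+t. F (x + t *\<^sub>R axis m 1) \<partial>lborel) =
        (\<integral>\<^sup>+t. F (x + t *\<^sub>R axis m 1) \<partial>distr lborel borel ((+) (x $ n)))"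
      by (simp add: lborel_distr_plus)
    also have "\<dots> = (\<integral>\<^sup>+t. F (x + (x $ n + t) *\<^sub>R axis m 1) \<partial>lborel)"
      by (subst nn_integral_distr) auto
    also have "\<dots> = (\<integral>\<^sup>+t. F (x + t *\<^sub>R axis m 1 + (x + t *\<^sub>R axis m 1) $ n *\<^sub>R axis m 1) \<partial>lborel)"
      using mn by (simp add: axis_def algebra_simps)
    finally show ?thesis by simp
  qed
  have "(\<integral>\<^sup>+x. F (x + x $ n *\<^sub>R axis m 1) \<partial>lborel) = (\<integral>\<^sup>+x. indicator {0..1} (x $ m) *
      (\<integral>\<^sup>+t. F (x + t *\<^sub>R axis m 1 + (x + t *\<^sub>R axis m 1) $ n *\<^sub>R axis m 1) \<partial>lborel) \<partial>lborel)"
    by (rule nn_integral_lines) measurable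
  also have "\<dots> = (\<integral>\<^sup>+x. F x \<partial>lborel)"
    unfolding line by (rule nn_integral_lines[symmetric]) measurable
  finally show ?thesis unfolding shear .
qed

lemma nn_integral_stretch:
  fixes F :: "real ^ 'n \<Rightarrow> ennreal"
  assumes [measurable]: "F \<in> borel_measurable borel" and c: "\<And>i. c i \<noteq> 0"
  shows "(\<integral>\<^sup>+x. F x \<partial>lborel) = ennreal (\<Prod>i\<in>UNIV. \<bar>c i\<bar>) * (\<integral>\<^sup>+x. F (\<chi> i. c i * x $ i) \<partial>lborel)"
proof -
  define C where "C j = c (axis_index j)" for j :: "real ^ 'n"
  have ax: "C (axis i 1) = c i" for i by (simp add: C_def axis_index_axis)
  have inj: "inj (\<lambda>i :: 'n. axis i (1 :: real))" by (auto simp: inj_def axis_eq_axis)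
  have B: "(Basis :: (real ^ 'n) set) = range (\<lambda>i. axis i 1)" by (auto simp: Basis_vec_def)
  have T: "0 + (\<Sum>j\<in>Basis. (C j * (x \<bullet> j)) *\<^sub>R j) = (\<chi> i. c i * x $ i)" for x :: "real ^ 'n"
    unfolding B sum.reindex[OF inj] comp_def ax inner_axis
    by (simp add: vec_eq_iff axis_def if_distrib cong: if_cong)
  have p: "(\<Prod>j\<in>Basis. \<bar>C j\<bar>) = (\<Prod>i\<in>UNIV. \<bar>c i\<bar>)"
    unfolding B by (simp add: prod.reindex[OF inj] ax)
  have [measurable]: "(\<lambda>x :: real ^ 'n. \<chi> i. c i * x $ i) \<in> borel_measurable borel"
    by (intro borel_measurable_continuous_onI continuous_on_vec_lambda continuous_intros)
  have "lborel = density (distr lborel borel (\<lambda>x :: real ^ 'n. \<chi> i. c i * x $ i)) (\<lambda>_. \<Prod>j\<in>Basis. \<bar>C j\<bar>)"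
    unfolding T[symmetric] by (rule lborel_affine_euclidean) (auto simp: C_def c)
  then have "(\<integral>\<^sup>+x. F x \<partial>lborel) = (\<integral>\<^sup>+x. F x \<partial>density (distr lborel borel (\<lambda>x :: real ^ 'n. \<chi> i. c i * x $ i)) (\<lambda>_. \<Prod>j\<in>Basis. \<bar>C j\<bar>))"
    by (rule arg_cong)
  then show ?thesis
    by (simp add: nn_integral_density nn_integral_distr nn_integral_cmult p)
qed

lemma det_matrix_shear:
  assumes "m \<noteq> n"
  shows "det (matrix (\<lambda>x :: real ^ 'n. \<chi> i. if i = m then x $ m + x $ n else x $ i)) = 1"
proof -
  have "matrix (\<lambda>x :: real ^ 'n. \<chi> i. if i = m then x $ m + x $ n else x $ i) =
      (\<chi> k. if k = m then row m (mat 1) + 1 *s row n (mat 1) else row k (mat 1))"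
    (is "?L = ?R")
  proof -
    have "?L $ i $ j = ?R $ i $ j" for i j
      using assms by (cases "i = m") (simp_all add: matrix_def row_def mat_def axis_def)
    then show ?thesis by (simp add: vec_eq_iff)
  qed
  then show ?thesis by (simp add: det_row_operation[OF assms])
qed

lemma det_matrix_stretch: "det (matrix (\<lambda>x :: real ^ 'n. \<chi> i. c i * x $ i)) = prod c UNIV"
proof -
  have "det (matrix (\<lambda>x :: real ^ 'n. \<chi> i. c i * x $ i)) =
      (\<Prod>i\<in>UNIV. matrix (\<lambda>x :: real ^ 'n. \<chi> i. c i * x $ i) $ i $ i)"
    by (rule det_diagonal) (simp add: matrix_def axis_def)
  then show ?thesis by (simp add: matrix_def)
qed

text \<open>Every linear map is a product of shears, stretches, transpositions of coordinates and maps with a vanishing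
  coordinate. The property \<open>P\<close> is vacuous for singular maps; a product is invertible only if its factors
  are, so that \<open>P\<close> is inherited by products.\<close>

lemma nn_integral_lborel_linear:
  fixes A :: "real ^ 'n ^ 'n" and F :: "real ^ 'n \<Rightarrow> ennreal"
  assumes A: "invertible A" and F: "F \<in> borel_measurable borel"
  shows "(\<integral>\<^sup>+x. F x \<partial>lborel) = ennreal \<bar>det A\<bar> * (\<integral>\<^sup>+x. F (A *v x) \<partial>lborel)"
proof -
  define P :: "(real ^ 'n \<Rightarrow> real ^ 'n) \<Rightarrow> bool" where
    "P f \<longleftrightarrow> (det (matrix f) \<noteq> 0 \<longrightarrow> (\<forall>F :: real ^ 'n \<Rightarrow> ennreal. F \<in> borel_measurable borel \<longrightarrow>
      (\<integral>\<^sup>+x. F x \<partial>lborel) = ennreal \<bar>det (matrix f)\<bar> * (\<integral>\<^sup>+x. F (f x) \<partial>lborel)))" for f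
  have comp: "P (f \<circ> g)" if f: "linear f" "P f" and g: "linear g" "P g" for f g
    unfolding P_def
  proof (intro impI allI)
    fix F :: "real ^ 'n \<Rightarrow> ennreal"
    assume nz: "det (matrix (f \<circ> g)) \<noteq> 0" and [measurable]: "F \<in> borel_measurable borel"
    have [measurable]: "f \<in> borel_measurable borel"
      using f(1) by (intro borel_measurable_continuous_onI linear_continuous_on) (simp add: linear_linear)
    have d: "det (matrix (f \<circ> g)) = det (matrix f) * det (matrix g)"
      by (simp add: matrix_compose[OF g(1) f(1)] det_mul)
    have "(\<integral>\<^sup>+x. F x \<partial>lborel) = ennreal \<bar>det (matrix f)\<bar> * (\<integral>\<^sup>+x. F (f x) \<partial>lborel)"
      by (rule f(2)[unfolded P_def, rule_format]) (use nz d in auto)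
    also have "(\<integral>\<^sup>+x. F (f x) \<partial>lborel) = ennreal \<bar>det (matrix g)\<bar> * (\<integral>\<^sup>+x. F (f (g x)) \<partial>lborel)"
      by (rule g(2)[unfolded P_def, rule_format]) (use nz d in auto)
    finally show "(\<integral>\<^sup>+x. F x \<partial>lborel) = ennreal \<bar>det (matrix (f \<circ> g))\<bar> * (\<integral>\<^sup>+x. F ((f \<circ> g) x) \<partial>lborel)"
      by (simp add: d abs_mult ennreal_mult mult.assoc)
  qed
  have stretch: "P (\<lambda>x. \<chi> i. c i * x $ i)" for c :: "'n \<Rightarrow> real"
    unfolding P_def det_matrix_stretch abs_prod
  proof (intro impI allI)
    fix F :: "real ^ 'n \<Rightarrow> ennreal"
    assume "prod c UNIV \<noteq> 0" and F: "F \<in> borel_measurable borel"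
    then have "c i \<noteq> 0" for i by (simp add: prod_zero_iff)
    then show "(\<integral>\<^sup>+x. F x \<partial>lborel) = ennreal (\<Prod>i\<in>UNIV. \<bar>c i\<bar>) * (\<integral>\<^sup>+x. F (\<chi> i. c i * x $ i) \<partial>lborel)"
      by (rule nn_integral_stretch[OF F])
  qed
  have shear: "P (\<lambda>x. \<chi> i. if i = m then x $ m + x $ n else x $ i)" if "m \<noteq> n" for m n
    unfolding P_def det_matrix_shear[OF that] 
  proof (intro impI allI)
    fix F :: "real ^ 'n \<Rightarrow> ennreal" assume "F \<in> borel_measurable borel"
    from nn_integral_shear[OF this that]
    show "(\<integral>\<^sup>+x. F x \<partial>lborel) = ennreal \<bar>1\<bar> * (\<integral>\<^sup>+x. F (\<chi> i. if i = m then x $ m + x $ n else x $ i) \<partial>lborel)"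
      by simp
  qed
  have PA: "P ((*v) A)"
  proof (rule induct_linear_elementary[where P = P and f = "(*v) A"])
    fix f :: "real ^ 'n \<Rightarrow> real ^ 'n" and i assume "linear f" "\<And>x. f x $ i = 0"
    then have "row i (matrix f) = 0" by (simp add: row_def matrix_def vec_eq_iff)
    then show "P f" by (simp add: P_def det_zero_row)
  next
    fix m n :: 'n assume mn: "m \<noteq> n"
    let ?E = "\<lambda>m n (x :: real ^ 'n). \<chi> i. if i = m then x $ m + x $ n else x $ i"
    let ?D = "\<lambda>m (x :: real ^ 'n). \<chi> i. (if i = m then - 1 else 1) * x $ i"
    have lin: "linear (?E m n)" "linear (?D m)" for m n
      by (auto simp: linear_iff vec_eq_iff algebra_simps)
    \<comment> \<open>On the coordinates \<open>(m, n)\<close>, from right to left: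
      \<open>(a, b) \<mapsto> (a + b, b) \<mapsto> (- a - b, b) \<mapsto> (- a - b, - a) \<mapsto> (a + b, - a) \<mapsto> (b, - a) \<mapsto> (b, a)\<close>.\<close>
    have swap: "(\<lambda>x :: real ^ 'n. \<chi> i. x $ Transposition.transpose m n i) =
        ?D n \<circ> (?E m n \<circ> (?D m \<circ> (?E n m \<circ> (?D m \<circ> ?E m n))))"
    proof (intro ext, unfold vec_eq_iff, rule allI)
      fix x :: "real ^ 'n" and i
      show "(\<chi> i. x $ Transposition.transpose m n i) $ i =
          (?D n \<circ> (?E m n \<circ> (?D m \<circ> (?E n m \<circ> (?D m \<circ> ?E m n))))) x $ i"
        using mn by (cases "i = m"; cases "i = n") simp_all
    qed
    show "P (\<lambda>x. \<chi> i. x $ Transposition.transpose m n i)"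
      unfolding swap by (rule comp, (rule lin linear_compose stretch shear mn mn[symmetric] | rule comp)+)
  next
    show "linear ((*v) A)" by simp
  next
    fix f g :: "real ^ 'n \<Rightarrow> real ^ 'n" assume "linear f" "linear g" "P f" "P g"
    then show "P (f \<circ> g)" by (intro comp)
  next
    show "P (\<lambda>x. \<chi> i. c i * x $ i)" for c by (rule stretch)
  next
    show "P (\<lambda>x. \<chi> i. if i = m then x $ m + x $ n else x $ i)" if "m \<noteq> n" for m n
      by (rule shear[OF that])
  qed
  have "det (matrix ((*v) A)) \<noteq> 0" using A by (simp add: invertible_det_nz)
  from PA[unfolded P_def, rule_format, OF this F] show ?thesis
    by (simp only: matrix_of_matrix_vector_mul)
qed

lemma nn_integral_lborel_scaleR:
  fixes f :: "real ^ 'n \<Rightarrow> ennreal"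
  assumes t: "t > 0" and f [measurable]: "f \<in> borel_measurable borel"
  shows "(\<integral>\<^sup>+x. f x \<partial>lborel) = ennreal (t ^ CARD('n)) * (\<integral>\<^sup>+x. f (t *\<^sub>R x) \<partial>lborel)"
  by (subst lborel_affine[of t 0])
    (use t in \<open>simp_all add: nn_integral_density nn_integral_distr nn_integral_cmult\<close>)

lemma nn_integral_power_interval:
  assumes b: "b > 0" and n: "n > 0"
  shows "(\<integral>\<^sup>+t. ennreal (n * t ^ (n - 1)) * indicator {0<..<b} t \<partial>lborel) = ennreal (b ^ n)"
proof -
  have "(\<integral>\<^sup>+t. ennreal (n * t ^ (n - 1)) * indicator {0<..<b} t \<partial>lborel) =
      (\<integral>\<^sup>+t. ennreal (n * t ^ (n - 1)) * indicator {0..b} t \<partial>lborel)"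
    by (rule nn_integral_cong_AE, use AE_lborel_singleton[of 0] AE_lborel_singleton[of b] in eventually_elim)
      (auto split: split_indicator)
  also have "\<dots> = ennreal (b ^ n - 0 ^ n)"
    by (rule nn_integral_FTC_Icc) (use b in \<open>auto intro!: derivative_eq_intros\<close>)
  finally show ?thesis using n by (simp add: zero_power)
qed

lemma nn_integral_power_ray:
  assumes a: "a > 0" and n: "n > 0"
  shows "(\<integral>\<^sup>+t. ennreal (n / t ^ (n + 1)) * indicator {a<..} t \<partial>lborel) = ennreal (1 / a ^ n)"
proof -
  have "(\<integral>\<^sup>+t. ennreal (n / t ^ (n + 1)) * indicator {a<..} t \<partial>lborel) =
      (\<integral>\<^sup>+t. ennreal (n / t ^ (n + 1)) * indicator {a..} t \<partial>lborel)"
    by (rule nn_integral_cong_AE, use AE_lborel_singleton[of a] in eventually_elim)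
      (auto split: split_indicator)
  also have "\<dots> = ennreal (0 - (- (inverse a ^ n)))"
  proof (rule nn_integral_FTC_atLeast)
    fix t assume "a \<le> t"
    then have t: "t > 0" using a by simp
    show "((\<lambda>t. - (inverse t ^ n)) has_real_derivative n / t ^ (n + 1)) (at t)"
    proof -
      obtain k where k: "n = Suc k" using n by (cases n) auto
      have "((\<lambda>t. - (inverse t ^ n)) has_real_derivative
          - (real n * inverse t ^ (n - Suc 0) * - (inverse t ^ Suc (Suc 0)))) (at t)"
        using t by (auto intro!: derivative_eq_intros)
      then show ?thesis
        using t unfolding k by (simp add: field_simps)
    qed
    show "0 \<le> n / t ^ (n + 1)" using t by simp
  next
    have "((\<lambda>t. - (inverse t ^ n)) \<longlongrightarrow> - (0 ^ n)) (at_top :: real filter)"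
      by (intro tendsto_intros tendsto_inverse_0_at_top filterlim_ident)
    then show "((\<lambda>t. - (inverse t ^ n)) \<longlongrightarrow> 0) (at_top :: real filter)" using n by (simp add: zero_power)
  qed measurable
  finally show ?thesis by (simp add: power_inverse divide_inverse)
qed

section \<open>Changes of variables on the sphere\<close>

text \<open>Both sides are values of the double integral over \<open>x\<close> and \<open>t > 0\<close> of
  \<open>g x [N\<^sub>2 x < 1] n t ^ (n - 1) (N\<^sub>1 x) ^ n [t N\<^sub>1 x < 1]\<close>: integrating over \<open>t\<close> gives the left one,
  and substituting \<open>x / t\<close> for \<open>x\<close> before integrating over \<open>t\<close> gives the right one. This takes the place of
  polar coordinates.\<close>

lemma nn_integral_change_gauge:
  fixes g :: "real ^ 'n \<Rightarrow> ennreal" and N1 N2 :: "real ^ 'n \<Rightarrow> real"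
  assumes [measurable]: "g \<in> borel_measurable borel" "N1 \<in> borel_measurable borel" "N2 \<in> borel_measurable borel"
    and g: "\<And>t x. t > 0 \<Longrightarrow> g (t *\<^sub>R x) = g x"
    and N1: "\<And>t x. t > 0 \<Longrightarrow> N1 (t *\<^sub>R x) = t * N1 x" "\<And>x. x \<noteq> 0 \<Longrightarrow> N1 x > 0"
    and N2: "\<And>t x. t > 0 \<Longrightarrow> N2 (t *\<^sub>R x) = t * N2 x" "\<And>x. x \<noteq> 0 \<Longrightarrow> N2 x > 0"
  shows "(\<integral>\<^sup>+x. g x * indicator {x. N2 x < 1} x \<partial>lborel) =
    (\<integral>\<^sup>+x. g x * ennreal ((N1 x / N2 x) ^ CARD('n)) * indicator {x. N1 x < 1} x \<partial>lborel)"
proof -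
  let ?n = "CARD('n)"
  have n: "?n > 0" by simp
  let ?F = "\<lambda>x (t :: real). g x * indicator {x. N2 x < 1} x * (ennreal (real ?n * t ^ (?n - 1)) * ennreal (N1 x ^ ?n)) *
    (indicator {0<..} t * indicator {..<1} (t * N1 x)) :: ennreal"
  have AE0: "AE x :: real ^ 'n in lborel. x \<noteq> 0" by (rule AE_lborel_singleton)
  have "(\<integral>\<^sup>+x. g x * indicator {x. N2 x < 1} x \<partial>lborel) = (\<integral>\<^sup>+x. (\<integral>\<^sup>+t. ?F x t \<partial>lborel) \<partial>lborel)"
  proof (rule nn_integral_cong_AE, use AE0 in eventually_elim)
    fix x :: "real ^ 'n" assume "x \<noteq> 0"
    then have p: "N1 x > 0" by (rule N1)
    have "(\<integral>\<^sup>+t. ?F x t \<partial>lborel) = (\<integral>\<^sup>+t. g x * indicator {x. N2 x < 1} x * ennreal (N1 x ^ ?n) *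
        (ennreal (real ?n * t ^ (?n - 1)) * indicator {0<..<inverse (N1 x)} t) \<partial>lborel)"
      using p by (intro nn_integral_cong) (auto split: split_indicator simp: field_simps)
    also have "\<dots> = g x * indicator {x. N2 x < 1} x * ennreal (N1 x ^ ?n) * ennreal (inverse (N1 x) ^ ?n)"
      using p by (subst nn_integral_cmult, measurable) (simp only: nn_integral_power_interval[OF _ n]
          positive_imp_inverse_positive)
    also have "\<dots> = g x * indicator {x. N2 x < 1} x"
      using p by (simp add: mult.assoc ennreal_mult[symmetric] power_mult_distrib[symmetric])
    finally show "g x * indicator {x. N2 x < 1} x = (\<integral>\<^sup>+t. ?F x t \<partial>lborel)" by simp
  qed
  also have "\<dots> = (\<integral>\<^sup>+t. (\<integral>\<^sup>+x. ?F x t \<partial>lborel) \<partial>lborel)"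
    by (rule lborel_pair.Fubini'[symmetric]) measurable
  also have "\<dots> = (\<integral>\<^sup>+t. (\<integral>\<^sup>+x. g x * ennreal (N1 x ^ ?n) * indicator {x. N1 x < 1} x *
      (ennreal (real ?n / t ^ (?n + 1)) * indicator {0<..} (t - N2 x) * indicator {0<..} t) \<partial>lborel) \<partial>lborel)"
  proof (rule nn_integral_cong)
    fix t :: real
    show "(\<integral>\<^sup>+x. ?F x t \<partial>lborel) = (\<integral>\<^sup>+x. g x * ennreal (N1 x ^ ?n) * indicator {x. N1 x < 1} x *
      (ennreal (real ?n / t ^ (?n + 1)) * indicator {0<..} (t - N2 x) * indicator {0<..} t) \<partial>lborel)"
    proof (cases "t > 0")
      case t: True
      have "(\<integral>\<^sup>+x. ?F x t \<partial>lborel) = ennreal (inverse t ^ ?n) * (\<integral>\<^sup>+x. ?F (inverse t *\<^sub>R x) t \<partial>lborel)"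
        by (rule nn_integral_lborel_scaleR) (use t in simp_all)
      also have "\<dots> = (\<integral>\<^sup>+x. ennreal (inverse t ^ ?n) * ?F (inverse t *\<^sub>R x) t \<partial>lborel)"
        by (rule nn_integral_cmult[symmetric]) measurable
      also have "\<dots> = (\<integral>\<^sup>+x. g x * ennreal (N1 x ^ ?n) * indicator {x. N1 x < 1} x *
        (ennreal (real ?n / t ^ (?n + 1)) * indicator {0<..} (t - N2 x) * indicator {0<..} t) \<partial>lborel)"
      proof (rule nn_integral_cong)
        fix x :: "real ^ 'n"
        have it: "inverse t > 0" using t by simp
        have N: "0 \<le> N1 x" using N1(1)[of 2 0] N1(2)[of x] by (cases "x = 0") auto
        have e1: "ennreal (N1 (inverse t *\<^sub>R x) ^ ?n) = ennreal (inverse t ^ ?n) * ennreal (N1 x ^ ?n)"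
          using t N by (simp add: N1(1)[OF it] power_mult_distrib ennreal_mult')
        have e2: "ennreal (inverse t ^ ?n) * (ennreal (inverse t ^ ?n) * ennreal (real ?n * t ^ (?n - 1))) = ennreal (real ?n / t ^ (?n + 1))"
        proof -
          have "t ^ ?n = t * t ^ (?n - 1)" using n by (metis power_eq_if not_gr_zero)
          then show ?thesis using t by (simp add: ennreal_mult[symmetric] field_simps)
        qed
        have e3: "indicator {x. N2 x < 1} (inverse t *\<^sub>R x) = (indicator {0<..} (t - N2 x) :: ennreal)"
          unfolding indicator_def mem_Collect_eq N2(1)[OF it] using t by (simp add: field_simps)
        have e4: "indicator {..<1} (t * N1 (inverse t *\<^sub>R x)) = (indicator {x. N1 x < 1} x :: ennreal)"
          unfolding indicator_def mem_Collect_eq N1(1)[OF it] using t by (simp add: field_simps)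
        show "ennreal (inverse t ^ ?n) * ?F (inverse t *\<^sub>R x) t = g x * ennreal (N1 x ^ ?n) * indicator {x. N1 x < 1} x *
          (ennreal (real ?n / t ^ (?n + 1)) * indicator {0<..} (t - N2 x) * indicator {0<..} t)"
          unfolding e1 e3 e4 e2[symmetric] g[OF it] by (simp only: mult_ac)
      qed
      finally show ?thesis .
    qed simp
  qed
  also have "\<dots> = (\<integral>\<^sup>+x. (\<integral>\<^sup>+t. g x * ennreal (N1 x ^ ?n) * indicator {x. N1 x < 1} x *
      (ennreal (real ?n / t ^ (?n + 1)) * indicator {0<..} (t - N2 x) * indicator {0<..} t) \<partial>lborel) \<partial>lborel)"
    by (rule lborel_pair.Fubini') measurable
  also have "\<dots> = (\<integral>\<^sup>+x. g x * ennreal ((N1 x / N2 x) ^ ?n) * indicator {x. N1 x < 1} x \<partial>lborel)"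
  proof (rule nn_integral_cong_AE, use AE0 in eventually_elim)
    fix x :: "real ^ 'n" assume "x \<noteq> 0"
    then have p: "N1 x > 0" "N2 x > 0" by (auto intro: N1 N2)
    have "(\<integral>\<^sup>+t. g x * ennreal (N1 x ^ ?n) * indicator {x. N1 x < 1} x *
        (ennreal (real ?n / t ^ (?n + 1)) * indicator {0<..} (t - N2 x) * indicator {0<..} t) \<partial>lborel) =
      (\<integral>\<^sup>+t. g x * ennreal (N1 x ^ ?n) * indicator {x. N1 x < 1} x *
        (ennreal (real ?n / t ^ (?n + 1)) * indicator {N2 x<..} t) \<partial>lborel)"
      using p by (intro nn_integral_cong) (auto split: split_indicator)
    also have "\<dots> = g x * ennreal (N1 x ^ ?n) * indicator {x. N1 x < 1} x * ennreal (1 / N2 x ^ ?n)"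
      using p by (subst nn_integral_cmult, measurable) (simp only: nn_integral_power_ray[OF _ n])
    also have "\<dots> = g x * ennreal ((N1 x / N2 x) ^ ?n) * indicator {x. N1 x < 1} x"
    proof -
      have "ennreal ((N1 x / N2 x) ^ ?n) = ennreal (N1 x ^ ?n) * ennreal (1 / N2 x ^ ?n)"
        using p by (simp add: ennreal_mult[symmetric] power_divide)
      then show ?thesis by (simp only: mult_ac)
    qed
    finally show "(\<integral>\<^sup>+t. g x * ennreal (N1 x ^ ?n) * indicator {x. N1 x < 1} x *
        (ennreal (real ?n / t ^ (?n + 1)) * indicator {0<..} (t - N2 x) * indicator {0<..} t) \<partial>lborel) =
        g x * ennreal ((N1 x / N2 x) ^ ?n) * indicator {x. N1 x < 1} x" .
  qed
  finally show ?thesis .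
qed

lemma space_sphere_measure: "space sphere_measure = sphere (0 :: real ^ 'n) 1"
  by (simp add: sphere_measure_def space_scale_measure space_restrict_space)

lemma sets_sphere_measure [measurable_cong]:
  "sets sphere_measure = sets (restrict_space borel (sphere (0 :: real ^ 'n) 1))"
  by (simp add: sphere_measure_def)

lemma borel_measurable_sphere_measureI:
  "f \<in> borel_measurable borel \<Longrightarrow> f \<in> borel_measurable sphere_measure"
  using measurable_restrict_space1[of f borel borel "sphere 0 1"]
    measurable_cong_sets[OF sets_sphere_measure refl, of borel] by blast

lemma measurable_radial_projection:
  "(\<lambda>x :: real ^ 'n. x /\<^sub>R norm x) \<in> restrict_space borel (- {0}) \<rightarrow>\<^sub>M restrict_space borel (sphere 0 1)"
  by (rule measurable_restrict_space2)
    (auto simp: space_restrict_space intro!: borel_measurable_continuous_on_restrict continuous_intros)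

lemma measurable_radial_extension:
  fixes f :: "real ^ 'n \<Rightarrow> ennreal"
  assumes "f \<in> borel_measurable sphere_measure"
  shows "(\<lambda>x. f (x /\<^sub>R norm x) * indicator (- {0}) x) \<in> borel_measurable borel"
proof -
  have "f \<in> borel_measurable (restrict_space borel (sphere 0 1))"
    using assms measurable_cong_sets[OF sets_sphere_measure refl, of borel] by blast
  from measurable_compose[OF measurable_radial_projection this]
  show ?thesis
    by (subst (asm) borel_measurable_restrict_space_iff_ennreal) auto
qed

lemma nn_integral_sphere_measure:
  fixes f :: "real ^ 'n \<Rightarrow> ennreal"
  assumes f: "f \<in> borel_measurable sphere_measure"
  shows "(\<integral>\<^sup>+\<theta>. f \<theta> \<partial>sphere_measure) = of_nat CARD('n) *
    (\<integral>\<^sup>+x. f (x /\<^sub>R norm x) * indicator (- {0}) x * indicator {x. norm x < 1} x \<partial>lborel)"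
proof -
  let ?B = "ball 0 1 - {0 :: real ^ 'n}" and ?S = "restrict_space borel (sphere (0 :: real ^ 'n) 1)"
  have f': "f \<in> borel_measurable ?S"
    using f measurable_cong_sets[OF sets_sphere_measure refl, of borel] by blast
  have "(\<lambda>x. x /\<^sub>R norm x) \<in> restrict_space borel ?B \<rightarrow>\<^sub>M ?S"
    by (rule measurable_restrict_space2)
      (auto simp: space_restrict_space intro!: borel_measurable_continuous_on_restrict continuous_intros)
  then have p: "(\<lambda>x. x /\<^sub>R norm x) \<in> restrict_space lborel ?B \<rightarrow>\<^sub>M ?S"
    using measurable_cong_sets[OF sets_restrict_space_cong[OF sets_lborel] refl] by blast
  have "(\<integral>\<^sup>+\<theta>. f \<theta> \<partial>sphere_measure) = of_nat CARD('n) *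
      (\<integral>\<^sup>+x. f (x /\<^sub>R norm x) \<partial>restrict_space lborel ?B)"
    unfolding sphere_measure_def
    by (simp add: nn_integral_scale_measure nn_integral_distr[OF p] f')
  also have "(\<integral>\<^sup>+x. f (x /\<^sub>R norm x) \<partial>restrict_space lborel ?B) =
      (\<integral>\<^sup>+x. f (x /\<^sub>R norm x) * indicator ?B x \<partial>lborel)"
    by (rule nn_integral_restrict_space) auto
  also have "\<dots> = (\<integral>\<^sup>+x. f (x /\<^sub>R norm x) * indicator (- {0}) x * indicator {x. norm x < 1} x \<partial>lborel)"
    by (intro nn_integral_cong) (auto split: split_indicator)
  finally show ?thesis .
qed

definition sphere_map :: "real ^ 'n ^ 'n \<Rightarrow> real ^ 'n \<Rightarrow> real ^ 'n" where
  "sphere_map A \<theta> = (A *v \<theta>) /\<^sub>R norm (A *v \<theta>)"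

lemma norm_sphere_map: "A *v \<theta> \<noteq> 0 \<Longrightarrow> norm (sphere_map A \<theta>) = 1"
  by (simp add: sphere_map_def)

lemma measurable_sphere_map:
  fixes A :: "real ^ 'n ^ 'n"
  assumes A: "invertible A"
  shows "sphere_map A \<in> sphere_measure \<rightarrow>\<^sub>M sphere_measure"
proof -
  have nz: "A *v x \<noteq> 0" if "norm x = 1" for x using invertible_mult_eq_0[OF A, of x] that by auto
  have "sphere_map A \<in> restrict_space borel (sphere 0 1) \<rightarrow>\<^sub>M restrict_space borel (sphere 0 1)"
    unfolding sphere_map_def[abs_def]
    by (rule measurable_restrict_space2)
      (auto simp: space_restrict_space nz intro!: borel_measurable_continuous_on_restrict continuous_intros
         matrix_vector_mult_linear_continuous_on)
  then show ?thesis
    using measurable_cong_sets[OF sets_sphere_measure sets_sphere_measure] by blast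
qed

text \<open>Since the spherical measure is a volume of cones in the unit ball, the Jacobian of
  \<open>\<theta> \<mapsto> A \<theta> / |A \<theta>|\<close> can be found in Euclidean space: a linear change of variables leads from the unit
  ball to the ball of the gauge \<open>|A x|\<close>, and a change of gauge leads back to the unit ball.\<close>

lemma nn_integral_sphere_map:
  fixes A :: "real ^ 'n ^ 'n" and f :: "real ^ 'n \<Rightarrow> ennreal"
  assumes A: "invertible A" and f: "f \<in> borel_measurable sphere_measure"
  shows "(\<integral>\<^sup>+\<theta>. f (sphere_map A \<theta>) * ennreal (\<bar>det A\<bar> / norm (A *v \<theta>) ^ CARD('n)) \<partial>sphere_measure) =
    (\<integral>\<^sup>+\<theta>. f \<theta> \<partial>sphere_measure)"
proof -
  let ?n = "CARD('n)"
  define G where "G x = f (x /\<^sub>R norm x) * indicator (- {0}) x" for x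
  have Gm [measurable]: "G \<in> borel_measurable borel"
    unfolding G_def[abs_def] by (rule measurable_radial_extension[OF f])
  have Am': "(\<lambda>\<theta>. norm (A *v \<theta>)) \<in> borel_measurable sphere_measure"
    by (rule borel_measurable_sphere_measureI) measurable
  have Gs: "G (t *\<^sub>R x) = G x" if "t > 0" for t x
  proof -
    have "(t *\<^sub>R x) /\<^sub>R norm (t *\<^sub>R x) = x /\<^sub>R norm x" using that by simp
    then show ?thesis unfolding G_def using that by (simp only:) (simp split: split_indicator)
  qed
  have "(\<integral>\<^sup>+\<theta>. f (sphere_map A \<theta>) * ennreal (\<bar>det A\<bar> / norm (A *v \<theta>) ^ ?n) \<partial>sphere_measure) = of_nat ?n *
      (\<integral>\<^sup>+x. f (sphere_map A (x /\<^sub>R norm x)) * ennreal (\<bar>det A\<bar> / norm (A *v (x /\<^sub>R norm x)) ^ ?n) *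
        indicator (- {0}) x * indicator {x. norm x < 1} x \<partial>lborel)"
    by (rule nn_integral_sphere_measure)
      (intro borel_measurable_times_ennreal measurable_compose[OF measurable_sphere_map[OF A] f]
        measurable_compose[OF _ measurable_ennreal] borel_measurable_divide borel_measurable_const
        borel_measurable_power Am')
  also have "(\<integral>\<^sup>+x. f (sphere_map A (x /\<^sub>R norm x)) * ennreal (\<bar>det A\<bar> / norm (A *v (x /\<^sub>R norm x)) ^ ?n) *
        indicator (- {0}) x * indicator {x. norm x < 1} x \<partial>lborel) =
      (\<integral>\<^sup>+x. ennreal \<bar>det A\<bar> * (G (A *v x) * ennreal ((norm x / norm (A *v x)) ^ ?n) * indicator {x. norm x < 1} x) \<partial>lborel)"
  proof (rule nn_integral_cong)
    fix x :: "real ^ 'n"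
    show "f (sphere_map A (x /\<^sub>R norm x)) * ennreal (\<bar>det A\<bar> / norm (A *v (x /\<^sub>R norm x)) ^ ?n) *
        indicator (- {0}) x * indicator {x. norm x < 1} x =
      ennreal \<bar>det A\<bar> * (G (A *v x) * ennreal ((norm x / norm (A *v x)) ^ ?n) * indicator {x. norm x < 1} x)"
    proof (cases "x = 0")
      case False
      then have r: "A *v x \<noteq> 0" using invertible_mult_eq_0[OF A] by simp
      have s: "A *v (x /\<^sub>R norm x) = (A *v x) /\<^sub>R norm x" by (simp add: matrix_vector_mult_scaleR)
      have "sphere_map A (x /\<^sub>R norm x) = (A *v x) /\<^sub>R norm (A *v x)"
        unfolding sphere_map_def s using False by simp
      moreover have "ennreal (\<bar>det A\<bar> / norm (A *v (x /\<^sub>R norm x)) ^ ?n) =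
          ennreal \<bar>det A\<bar> * ennreal ((norm x / norm (A *v x)) ^ ?n)"
        unfolding s using False r by (simp add: ennreal_mult[symmetric] field_simps power_mult_distrib power_divide)
      ultimately show ?thesis using r False by (simp add: G_def mult_ac)
    qed (simp add: G_def)
  qed
  also have "\<dots> = ennreal \<bar>det A\<bar> * (\<integral>\<^sup>+x. G (A *v x) * indicator {x. norm (A *v x) < 1} x \<partial>lborel)"
  proof (subst nn_integral_cmult, measurable, rule arg_cong[where f="(*) _"], rule nn_integral_change_gauge[symmetric])
    show "x \<noteq> 0 \<Longrightarrow> 0 < norm (A *v x)" for x using invertible_mult_eq_0[OF A] by simp
    show "t > 0 \<Longrightarrow> G (A *v (t *\<^sub>R x)) = G (A *v x)" for t x by (simp add: matrix_vector_mult_scaleR Gs)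
    show "t > 0 \<Longrightarrow> norm (A *v (t *\<^sub>R x)) = t * norm (A *v x)" for t x by (simp add: matrix_vector_mult_scaleR)
  qed auto
  also have "\<dots> = (\<integral>\<^sup>+x. G x * indicator {x. norm x < 1} x \<partial>lborel)"
    by (subst nn_integral_lborel_linear[OF A, of "\<lambda>x. G x * indicator {x. norm x < 1} x"]) (auto simp: indicator_def)
  also have "of_nat ?n * \<dots> = (\<integral>\<^sup>+\<theta>. f \<theta> \<partial>sphere_measure)"
    unfolding nn_integral_sphere_measure[OF f] G_def ..
  finally show ?thesis .
qed

lemma sphere_map_inverse:
  fixes A B :: "real ^ 'n ^ 'n"
  assumes "A ** B = mat 1" and "norm \<theta> = 1"
  shows "sphere_map A (sphere_map B \<theta>) = \<theta>"
proof -
  have AB: "A *v (B *v \<theta>) = \<theta>" by (simp add: matrix_vector_mul_assoc assms(1))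
  then have "B *v \<theta> \<noteq> 0" using assms(2) by auto
  then show ?thesis
    using assms(2) by (simp add: sphere_map_def matrix_vector_mult_scaleR AB)
qed

lemma emeasure_sphere_measure_finite: "emeasure sphere_measure (space (sphere_measure :: (real ^ 'n) measure)) < \<infinity>"
proof -
  have "emeasure sphere_measure (space (sphere_measure :: (real ^ 'n) measure)) =
      (\<integral>\<^sup>+\<theta>. 1 \<partial>(sphere_measure :: (real ^ 'n) measure))" by simp
  also have "\<dots> = of_nat CARD('n) * (\<integral>\<^sup>+x. 1 * indicator (- {0 :: real ^ 'n}) x * indicator {x. norm x < 1} x \<partial>lborel)"
    by (rule nn_integral_sphere_measure) simp
  also have "\<dots> \<le> of_nat CARD('n) * (\<integral>\<^sup>+x. indicator (ball (0 :: real ^ 'n) 1) x \<partial>lborel)"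
    by (intro mult_left_mono nn_integral_mono) (auto split: split_indicator)
  also have "\<dots> < \<infinity>"
    using emeasure_lborel_ball_finite[of "0 :: real ^ 'n" 1]
    by (simp add: ennreal_mult_less_top ennreal_of_nat_eq_real_of_nat)
  finally show ?thesis .
qed

text \<open>The Jacobian is bounded below on the sphere, because \<open>|A \<theta>|\<close> is bounded above.\<close>

lemma nn_integral_sphere_map_le:
  fixes A :: "real ^ 'n ^ 'n"
  assumes A: "invertible A"
  obtains C where "C > 0" "\<And>f :: real ^ 'n \<Rightarrow> ennreal. f \<in> borel_measurable sphere_measure \<Longrightarrow>
    (\<integral>\<^sup>+\<theta>. f (sphere_map A \<theta>) \<partial>sphere_measure) \<le> ennreal C * (\<integral>\<^sup>+\<theta>. f \<theta> \<partial>sphere_measure)"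
proof -
  obtain B where B: "B > 0" "\<And>x. norm (A *v x) \<le> B * norm x"
    using linear_bounded_pos[of "(*v) A"] by auto
  have d: "\<bar>det A\<bar> > 0" using A by (simp add: invertible_det_nz)
  let ?C = "B ^ CARD('n) / \<bar>det A\<bar>"
  have "(\<integral>\<^sup>+\<theta>. f (sphere_map A \<theta>) \<partial>sphere_measure) \<le> ennreal ?C * (\<integral>\<^sup>+\<theta>. f \<theta> \<partial>sphere_measure)"
    if f: "f \<in> borel_measurable sphere_measure" for f :: "real ^ 'n \<Rightarrow> ennreal"
  proof -
    have "(\<integral>\<^sup>+\<theta>. f (sphere_map A \<theta>) \<partial>sphere_measure) \<le>
        (\<integral>\<^sup>+\<theta>. ennreal ?C * f (sphere_map A \<theta>) * ennreal (\<bar>det A\<bar> / norm (A *v \<theta>) ^ CARD('n)) \<partial>sphere_measure)"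
    proof (rule nn_integral_mono)
      fix \<theta> :: "real ^ 'n" assume "\<theta> \<in> space sphere_measure"
      then have \<theta>: "norm \<theta> = 1" by (simp add: space_sphere_measure)
      then have p: "norm (A *v \<theta>) > 0" using invertible_mult_eq_0[OF A, of \<theta>] by auto
      have "norm (A *v \<theta>) ^ CARD('n) \<le> B ^ CARD('n)"
        using B(2)[of \<theta>] \<theta> by (intro power_mono) auto
      then have "1 \<le> ?C * (\<bar>det A\<bar> / norm (A *v \<theta>) ^ CARD('n))"
        using p d by (simp add: field_simps)
      then have "1 \<le> ennreal ?C * ennreal (\<bar>det A\<bar> / norm (A *v \<theta>) ^ CARD('n))"
        using B(1) by (simp add: ennreal_mult[symmetric] one_ennreal_def[symmetric] del: ennreal_1)
      from mult_left_mono[OF this, of "f (sphere_map A \<theta>)"]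
      show "f (sphere_map A \<theta>) \<le> ennreal ?C * f (sphere_map A \<theta>) * ennreal (\<bar>det A\<bar> / norm (A *v \<theta>) ^ CARD('n))"
        by (simp add: mult_ac)
    qed
    also have "\<dots> = (\<integral>\<^sup>+\<theta>. ennreal ?C * f \<theta> \<partial>sphere_measure)"
      by (rule nn_integral_sphere_map[OF A, of "\<lambda>\<theta>. ennreal ?C * f \<theta>"]) (use f in measurable)
    finally show ?thesis by (simp only: nn_integral_cmult[OF f])
  qed
  moreover have "?C > 0" using B(1) d by simp
  ultimately show thesis by (rule that[rotated])
qed

lemma distr_density_sphere_map:
  fixes A :: "real ^ 'n ^ 'n" and w w' :: "real ^ 'n \<Rightarrow> real"
  assumes A: "invertible A" and w: "w \<in> borel_measurable sphere_measure" and c: "c \<ge> 0"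
    and w': "\<And>\<theta>. norm \<theta> = 1 \<Longrightarrow> w' \<theta> = c * (\<bar>det A\<bar> / norm (A *v \<theta>) ^ CARD('n)) * w (sphere_map A \<theta>)"
  shows "distr (density sphere_measure (\<lambda>\<theta>. ennreal (w' \<theta>))) (density sphere_measure (\<lambda>\<theta>. ennreal (w \<theta>))) (sphere_map A) =
    scale_measure (ennreal c) (density sphere_measure (\<lambda>\<theta>. ennreal (w \<theta>)))" (is "distr ?N ?M _ = _")
proof (rule measure_eqI)
  show "sets (distr ?N ?M (sphere_map A)) = sets (scale_measure (ennreal c) ?M)" by simp
  fix X assume "X \<in> sets (distr ?N ?M (sphere_map A))"
  then have X: "X \<in> sets sphere_measure" by simp
  note \<phi> = measurable_sphere_map[OF A]
  have Am: "(\<lambda>\<theta>. norm (A *v \<theta>)) \<in> borel_measurable sphere_measure"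
    by (rule borel_measurable_sphere_measureI) measurable
  have "(\<lambda>\<theta>. c * (\<bar>det A\<bar> / norm (A *v \<theta>) ^ CARD('n)) * w (sphere_map A \<theta>)) \<in> borel_measurable sphere_measure"
    by (intro borel_measurable_times borel_measurable_divide borel_measurable_const borel_measurable_power Am
        measurable_compose[OF \<phi> w])
  then have w'm: "w' \<in> borel_measurable sphere_measure"
    by (subst measurable_cong[OF w']) (simp_all add: space_sphere_measure)
  have "emeasure (distr ?N ?M (sphere_map A)) X = emeasure ?N (sphere_map A -` X \<inter> space sphere_measure)"
    using X \<phi> by (subst emeasure_distr) auto
  also have "\<dots> = (\<integral>\<^sup>+\<theta>. ennreal (w' \<theta>) * indicator (sphere_map A -` X \<inter> space sphere_measure) \<theta> \<partial>sphere_measure)"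
    using w'm measurable_sets[OF \<phi> X] by (subst emeasure_density) auto
  also have "\<dots> = (\<integral>\<^sup>+\<theta>. (ennreal c * (ennreal (w (sphere_map A \<theta>)) * indicator X (sphere_map A \<theta>))) *
      ennreal (\<bar>det A\<bar> / norm (A *v \<theta>) ^ CARD('n)) \<partial>sphere_measure)"
  proof (rule nn_integral_cong)
    fix \<theta> :: "real ^ 'n" assume sp: "\<theta> \<in> space sphere_measure"
    then have "norm \<theta> = 1" by (simp add: space_sphere_measure)
    have J: "0 \<le> \<bar>det A\<bar> / norm (A *v \<theta>) ^ CARD('n)" by simp
    from w'[OF \<open>norm \<theta> = 1\<close>] have "ennreal (w' \<theta>) = ennreal c * ennreal (\<bar>det A\<bar> / norm (A *v \<theta>) ^ CARD('n)) * ennreal (w (sphere_map A \<theta>))"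
      by (simp only: ennreal_mult'[OF mult_nonneg_nonneg[OF c J]] ennreal_mult'[OF c])
    then show "ennreal (w' \<theta>) * indicator (sphere_map A -` X \<inter> space sphere_measure) \<theta> =
      (ennreal c * (ennreal (w (sphere_map A \<theta>)) * indicator X (sphere_map A \<theta>))) *
      ennreal (\<bar>det A\<bar> / norm (A *v \<theta>) ^ CARD('n))"
      using sp by (simp add: indicator_def mult_ac)
  qed
  also have "\<dots> = (\<integral>\<^sup>+\<theta>. ennreal c * (ennreal (w \<theta>) * indicator X \<theta>) \<partial>sphere_measure)"
    by (rule nn_integral_sphere_map[OF A, of "\<lambda>\<theta>. ennreal c * (ennreal (w \<theta>) * indicator X \<theta>)"])
      (use w X in measurable)
  also have "\<dots> = ennreal c * (\<integral>\<^sup>+\<theta>. ennreal (w \<theta>) * indicator X \<theta> \<partial>sphere_measure)"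
    by (rule nn_integral_cmult) (use w X in measurable)
  also have "\<dots> = emeasure (scale_measure (ennreal c) ?M) X"
    using w X by (simp add: emeasure_density)
  finally show "emeasure (distr ?N ?M (sphere_map A)) X = emeasure (scale_measure (ennreal c) ?M) X" .
qed

section \<open>Transport of operators along isomorphisms of measure spaces\<close>

lemma scale_measure_eq_density: "scale_measure r M = density M (\<lambda>_. r)"
  by (rule measure_eqI) (simp_all add: emeasure_density_const)

text \<open>If \<open>\<psi>\<close> is inverse to \<open>\<phi>\<close> and \<open>U f = f \<circ> \<phi>\<close>, this is the graph of \<open>U A U\<^sup>-\<^sup>1\<close>, where \<open>G\<close> is the graph of \<open>A\<close>.\<close>

definition pull_graph :: "('a \<Rightarrow> 'a) \<Rightarrow> 'a graph \<Rightarrow> 'a graph" where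
  "pull_graph \<psi> G = {(u, v). (\<lambda>x. u (\<psi> x), \<lambda>x. v (\<psi> x)) \<in> G}"

text \<open>Values outside of \<open>space M\<close> carry no information. On the sphere this matters because \<open>\<psi>\<close> and \<open>\<phi>\<close> are
  inverse to each other there, and only there.\<close>

definition respects_space :: "'a measure \<Rightarrow> 'a graph \<Rightarrow> bool" where
  "respects_space M G \<longleftrightarrow> (\<forall>u v u' v'. (u, v) \<in> G \<longrightarrow>
     (\<forall>x\<in>space M. u' x = u x) \<longrightarrow> (\<forall>x\<in>space M. v' x = v x) \<longrightarrow> (u', v') \<in> G)"

lemma respects_spaceD:
  assumes "respects_space M G" "(u, v) \<in> G"
    "\<And>x. x \<in> space M \<Longrightarrow> u' x = u x" "\<And>x. x \<in> space M \<Longrightarrow> v' x = v x"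
  shows "(u', v') \<in> G"
  using assms unfolding respects_space_def by blast

lemma L2_cong: "(\<And>x. x \<in> space M \<Longrightarrow> f x = g x) \<Longrightarrow> f \<in> L2 M \<longleftrightarrow> g \<in> L2 M"
  unfolding L2_def by (auto cong: measurable_cong Bochner_Integration.integrable_cong)

lemma L2_inner_cong:
  "(\<And>x. x \<in> space M \<Longrightarrow> f x = f' x) \<Longrightarrow> (\<And>x. x \<in> space M \<Longrightarrow> g x = g' x) \<Longrightarrow>
    L2_inner M f g = L2_inner M f' g'"
  unfolding L2_inner_def by (auto intro: Bochner_Integration.integral_cong)

lemma L2_norm_cong: "(\<And>x. x \<in> space M \<Longrightarrow> f x = g x) \<Longrightarrow> L2_norm M f = L2_norm M g"
  unfolding L2_norm_def by (simp cong: L2_inner_cong)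

lemma L2_borel_measurable: "f \<in> L2 M \<Longrightarrow> f \<in> borel_measurable M"
  by (simp add: L2_def)

lemma L2_mult_integrable:
  assumes "f \<in> L2 M" "g \<in> L2 M"
  shows "integrable M (\<lambda>x. f x * g x)"
proof (rule Bochner_Integration.integrable_bound)
  show "integrable M (\<lambda>x. (f x)\<^sup>2 + (g x)\<^sup>2)" using assms by (simp add: L2_def)
  show "(\<lambda>x. f x * g x) \<in> borel_measurable M"
    by (intro borel_measurable_times L2_borel_measurable assms)
  have "\<bar>a * b\<bar> \<le> a\<^sup>2 + b\<^sup>2" for a b :: real
  proof -
    have "0 \<le> (\<bar>a\<bar> - \<bar>b\<bar>)\<^sup>2" by simp
    then have "2 * (\<bar>a\<bar> * \<bar>b\<bar>) \<le> a\<^sup>2 + b\<^sup>2" by (simp add: power2_diff)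
    moreover have "0 \<le> \<bar>a\<bar> * \<bar>b\<bar>" by simp
    ultimately show ?thesis unfolding abs_mult by linarith
  qed
  then show "AE x in M. norm (f x * g x) \<le> norm ((f x)\<^sup>2 + (g x)\<^sup>2)" by simp
qed

lemma L2_diff: "f \<in> L2 M \<Longrightarrow> g \<in> L2 M \<Longrightarrow> (\<lambda>x. f x - g x) \<in> L2 M"
  using L2_mult_integrable[of f M g] by (auto simp: L2_def power2_diff mult.assoc intro!: borel_measurable_diff)

lemma adjoint_graphD:
  "(u, v) \<in> adjoint_graph M G \<Longrightarrow> (z, w) \<in> G \<Longrightarrow> L2_inner M w u = L2_inner M z v"
  unfolding adjoint_graph_def by auto

lemma adjoint_graph_respects_space: "respects_space M (adjoint_graph M G)"
  unfolding respects_space_def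
proof (intro allI impI)
  fix u v u' v' assume uv: "(u, v) \<in> adjoint_graph M G"
    and u: "\<forall>x\<in>space M. u' x = u x" and v: "\<forall>x\<in>space M. v' x = v x"
  have "L2_inner M w u' = L2_inner M w u" "L2_inner M w v' = L2_inner M w v" for w
    using u v by (auto intro: L2_inner_cong)
  moreover have "u' \<in> L2 M \<longleftrightarrow> u \<in> L2 M" "v' \<in> L2 M \<longleftrightarrow> v \<in> L2 M"
    using u v by (auto intro!: L2_cong)
  ultimately show "(u', v') \<in> adjoint_graph M G"
    using uv unfolding adjoint_graph_def by auto
qed

lemma self_adjoint_respects_space: "self_adjoint M G \<Longrightarrow> respects_space M G"
  using adjoint_graph_respects_space[of M G] by (simp add: self_adjoint_def)

lemma self_adjoint_subset_L2: "self_adjoint M G \<Longrightarrow> G \<subseteq> L2 M \<times> L2 M"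
proof -
  assume "self_adjoint M G"
  then have "G = adjoint_graph M G" by (simp add: self_adjoint_def)
  also have "\<dots> \<subseteq> L2 M \<times> L2 M" by (auto simp: adjoint_graph_def)
  finally show ?thesis .
qed

text \<open>If \<open>f \<bottom> z\<close> then \<open>|f - z|\<^sup>2 = |f|\<^sup>2 + |z|\<^sup>2 \<ge> |f|\<^sup>2\<close>, so a function orthogonal to a dense domain
  vanishes; in particular the value of a self-adjoint operator is determined almost everywhere.\<close>

lemma self_adjoint_single_valued:
  assumes G: "self_adjoint M G" and 1: "(z, w1) \<in> G" and 2: "(z, w2) \<in> G"
  shows "AE x in M. w1 x = w2 x"
proof -
  have L: "w1 \<in> L2 M" "w2 \<in> L2 M" using self_adjoint_subset_L2[OF G] 1 2 by auto
  let ?f = "\<lambda>x. w1 x - w2 x"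
  have f: "?f \<in> L2 M" by (rule L2_diff[OF L])
  have orth: "L2_inner M ?f y = 0" if y: "y \<in> Domain G" "y \<in> L2 M" for y
  proof -
    from y obtain w where w: "(y, w) \<in> G" by auto
    have "adjoint_graph M G = G" using G by (simp only: self_adjoint_def)
    then have "(z, w1) \<in> adjoint_graph M G" "(z, w2) \<in> adjoint_graph M G"
      using 1 2 by simp_all
    then have "L2_inner M y w1 = L2_inner M y w2"
      using adjoint_graphD[OF _ w] by metis
    moreover have "L2_inner M ?f y = L2_inner M y w1 - L2_inner M y w2"
      using L2_mult_integrable[OF y(2) L(1)] L2_mult_integrable[OF y(2) L(2)]
      by (simp add: L2_inner_def mult.commute[of _ "y _"] right_diff_distrib)
    ultimately show ?thesis by simp
  qed
  let ?I = "L2_inner M ?f ?f"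
  have I: "?I \<le> \<epsilon>\<^sup>2" if \<epsilon>: "\<epsilon> > 0" for \<epsilon>
  proof -
    obtain y where y: "y \<in> Domain G" "y \<in> L2 M" "L2_norm M (\<lambda>x. ?f x - y x) < \<epsilon>"
    proof -
      have "densely_defined M G" using G unfolding self_adjoint_def by simp
      from this[unfolded densely_defined_def, rule_format, OF f \<epsilon>] show thesis
        using that by blast
    qed
    have "L2_inner M (\<lambda>x. ?f x - y x) (\<lambda>x. ?f x - y x) = ?I - 2 * L2_inner M ?f y + L2_inner M y y"
    proof -
      have "(\<lambda>x. (?f x - y x) * (?f x - y x)) = (\<lambda>x. ?f x * ?f x - 2 * (?f x * y x) + y x * y x)"
        by (simp add: fun_eq_iff algebra_simps)
      then show ?thesis
        unfolding L2_inner_def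
        using L2_mult_integrable[OF f f] L2_mult_integrable[OF f y(2)] L2_mult_integrable[OF y(2) y(2)]
        by simp
    qed
    moreover have "0 \<le> L2_inner M y y" by (simp add: L2_inner_def)
    moreover have "L2_inner M (\<lambda>x. ?f x - y x) (\<lambda>x. ?f x - y x) \<le> \<epsilon>\<^sup>2"
      using y(3) by (intro sqrt_le_D) (simp add: L2_norm_def)
    ultimately show ?thesis using orth[OF y(1,2)] by simp
  qed
  have "?I \<le> 0"
  proof (rule ccontr)
    assume "\<not> ?I \<le> 0"
    then show False using I[of "sqrt (?I / 2)"] by simp
  qed
  moreover have "?I = (\<integral>x. (?f x)\<^sup>2 \<partial>M)" by (simp add: L2_inner_def power2_eq_square)
  ultimately have "(\<integral>x. (?f x)\<^sup>2 \<partial>M) = 0" by (intro antisym) auto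
  then have "AE x in M. (?f x)\<^sup>2 = 0"
    using f by (subst (asm) integral_nonneg_eq_0_iff_AE) (auto simp: L2_def)
  then show ?thesis by simp
qed

lemma resolvent_set_iff:
  "\<mu> \<in> resolvent_set M G \<longleftrightarrow>
     (\<forall>v\<in>L2 M. \<exists>z w. (z, w) \<in> G \<and> (AE x in M. w x - \<mu> * z x = v x)) \<and>
     (\<exists>C. \<forall>z w. (z, w) \<in> G \<longrightarrow> L2_norm M z \<le> C * L2_norm M (\<lambda>x. w x - \<mu> * z x))"
  unfolding resolvent_set_def by (simp add: Bex_def Ball_def)

text \<open>An isomorphism of measurable spaces which multiplies the measure by a constant. Composition with it
  multiplies all inner products by this constant, and so transports adjoints, self-adjointness and
  resolvents.\<close>

locale scaled_measure_iso =
  fixes M N :: "'a measure" and \<phi> \<psi> :: "'a \<Rightarrow> 'a" and r :: real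
  assumes \<phi>: "\<phi> \<in> N \<rightarrow>\<^sub>M M" and \<psi>: "\<psi> \<in> M \<rightarrow>\<^sub>M N"
    and \<psi>\<phi>: "\<And>y. y \<in> space N \<Longrightarrow> \<psi> (\<phi> y) = y" and \<phi>\<psi>: "\<And>x. x \<in> space M \<Longrightarrow> \<phi> (\<psi> x) = x"
    and distr: "distr N M \<phi> = scale_measure (ennreal r) M" and r: "r > 0"
begin

lemma converse: "scaled_measure_iso N M \<psi> \<phi> (1 / r)"
proof
  show "distr M N \<psi> = scale_measure (ennreal (1 / r)) N"
  proof (rule measure_eqI)
    fix X assume "X \<in> sets (distr M N \<psi>)"
    then have X: "X \<in> sets N" by simp
    let ?Y = "\<psi> -` X \<inter> space M"
    have Y: "?Y \<in> sets M" by (rule measurable_sets[OF \<psi> X])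
    have eq: "\<phi> -` ?Y \<inter> space N = X"
      using \<psi>\<phi> measurable_space[OF \<phi>] sets.sets_into_space[OF X] by auto
    have "ennreal r * emeasure M ?Y = emeasure (distr N M \<phi>) ?Y" by (simp add: distr)
    also have "\<dots> = emeasure N X" by (simp only: emeasure_distr[OF \<phi> Y] eq)
    finally have "ennreal (1 / r) * (ennreal r * emeasure M ?Y) = ennreal (1 / r) * emeasure N X" by simp
    then have "emeasure M ?Y = ennreal (1 / r) * emeasure N X"
      using r by (simp add: mult.assoc[symmetric] ennreal_mult[symmetric])
    then show "emeasure (distr M N \<psi>) X = emeasure (scale_measure (ennreal (1 / r)) N) X"
      by (simp add: emeasure_distr[OF \<psi> X])
  qed simp
qed (use \<phi> \<psi> \<phi>\<psi> \<psi>\<phi> r in auto)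

lemma measurable_comp: "f \<in> borel_measurable M \<Longrightarrow> (\<lambda>y. f (\<phi> y)) \<in> borel_measurable N" for f :: "'a \<Rightarrow> real"
  by (rule measurable_compose[OF \<phi>])

lemma integral_comp:
  fixes f :: "'a \<Rightarrow> real"
  assumes f: "f \<in> borel_measurable M"
  shows "(\<integral>y. f (\<phi> y) \<partial>N) = r * (\<integral>x. f x \<partial>M)"
    and integrable_comp: "integrable N (\<lambda>y. f (\<phi> y)) \<longleftrightarrow> integrable M f"
proof -
  have "(\<integral>y. f (\<phi> y) \<partial>N) = (\<integral>x. f x \<partial>density M (\<lambda>_. ennreal r))"
    using integral_distr[OF \<phi> f] by (simp add: distr scale_measure_eq_density)
  also have "\<dots> = r * (\<integral>x. f x \<partial>M)"
    using f r by (subst integral_density) auto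
  finally show "(\<integral>y. f (\<phi> y) \<partial>N) = r * (\<integral>x. f x \<partial>M)" .
  have "integrable N (\<lambda>y. f (\<phi> y)) \<longleftrightarrow> integrable (density M (\<lambda>_. ennreal r)) f"
    using integrable_distr_eq[OF \<phi> f] by (simp add: distr scale_measure_eq_density)
  also have "\<dots> \<longleftrightarrow> integrable M f"
    using f r by (subst integrable_density) auto
  finally show "integrable N (\<lambda>y. f (\<phi> y)) \<longleftrightarrow> integrable M f" .
qed

lemma L2_comp: "f \<in> L2 M \<Longrightarrow> (\<lambda>y. f (\<phi> y)) \<in> L2 N"
  using integrable_comp[of "\<lambda>x. (f x)\<^sup>2"] measurable_comp[of f] by (auto simp: L2_def)

lemma L2_inner_comp:
  "f \<in> borel_measurable M \<Longrightarrow> g \<in> borel_measurable M \<Longrightarrow>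
    L2_inner N (\<lambda>y. f (\<phi> y)) (\<lambda>y. g (\<phi> y)) = r * L2_inner M f g"
  unfolding L2_inner_def by (rule integral_comp) simp

lemma L2_norm_comp:
  "f \<in> borel_measurable M \<Longrightarrow> L2_norm N (\<lambda>y. f (\<phi> y)) = sqrt r * L2_norm M f"
  by (simp add: L2_norm_def L2_inner_comp real_sqrt_mult)

lemma AE_comp:
  assumes "AE x in M. P x"
  shows "AE y in N. P (\<phi> y)"
proof -
  from assms have "AE x in density M (\<lambda>_. ennreal r). P x" by (subst AE_density) auto
  then have "AE x in distr N M \<phi>. P x" unfolding distr scale_measure_eq_density .
  then show ?thesis by (rule AE_distrD[OF \<phi>])
qed

lemma \<psi>_measurable: "f \<in> borel_measurable N \<Longrightarrow> (\<lambda>x. f (\<psi> x)) \<in> borel_measurable M" for f :: "'a \<Rightarrow> real"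
  by (rule measurable_compose[OF \<psi>])

lemma L2_\<psi>: "f \<in> L2 N \<Longrightarrow> (\<lambda>x. f (\<psi> x)) \<in> L2 M"
  by (rule scaled_measure_iso.L2_comp[OF converse])

lemma L2_\<psi>_iff: "(\<lambda>x. f (\<psi> x)) \<in> L2 M \<longleftrightarrow> f \<in> L2 N"
proof
  assume "(\<lambda>x. f (\<psi> x)) \<in> L2 M"
  from L2_comp[OF this] show "f \<in> L2 N"
    by (subst L2_cong[of N f "\<lambda>y. f (\<psi> (\<phi> y))"]) (simp_all add: \<psi>\<phi>)
qed (rule L2_\<psi>)

lemma L2_inner_\<psi>:
  assumes "f \<in> borel_measurable N" "g \<in> borel_measurable N"
  shows "L2_inner N f g = r * L2_inner M (\<lambda>x. f (\<psi> x)) (\<lambda>x. g (\<psi> x))"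
  using scaled_measure_iso.L2_inner_comp[OF converse assms] r by simp

lemma L2_norm_\<psi>:
  assumes "f \<in> borel_measurable N"
  shows "L2_norm N f = sqrt r * L2_norm M (\<lambda>x. f (\<psi> x))"
  using L2_inner_\<psi>[OF assms assms] by (simp add: L2_norm_def real_sqrt_mult)

lemma hilbert_isometry_comp:
  assumes "r = 1"
  shows "hilbert_isometry M N (\<lambda>f y. f (\<phi> y))"
  unfolding hilbert_isometry_def
proof (intro conjI ballI)
  fix g assume g: "g \<in> L2 N"
  show "\<exists>f\<in>L2 M. AE x in N. f (\<phi> x) = g x"
    by (rule bexI[OF _ L2_\<psi>[OF g]]) (simp add: \<psi>\<phi>)
next
  fix f g assume "f \<in> L2 M" "g \<in> L2 M"
  then show "L2_inner N (\<lambda>y. f (\<phi> y)) (\<lambda>y. g (\<phi> y)) = L2_inner M f g"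
    using L2_inner_comp[of f g] by (simp add: L2_borel_measurable assms)
qed (auto intro: L2_comp)

text \<open>The conjugacy relation; the values of \<open>u \<circ> \<phi> \<circ> \<psi>\<close> and \<open>u\<close> may differ outside of \<open>space M\<close>.\<close>

lemma pull_graph_comp_iff:
  assumes G: "respects_space M G"
  shows "((\<lambda>y. u (\<phi> y)), (\<lambda>y. v (\<phi> y))) \<in> pull_graph \<psi> G \<longleftrightarrow> (u, v) \<in> G"
proof -
  have "((\<lambda>x. u (\<phi> (\<psi> x))), (\<lambda>x. v (\<phi> (\<psi> x)))) \<in> G \<longleftrightarrow> (u, v) \<in> G"
    by (rule iffI; erule respects_spaceD[OF G]; simp add: \<phi>\<psi>)
  then show ?thesis by (simp add: pull_graph_def)
qed

lemma pull_graph_pull_graph: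
  assumes G: "respects_space M G"
  shows "pull_graph \<phi> (pull_graph \<psi> G) = G"
proof (rule set_eqI, clarify)
  fix u v
  have "(u, v) \<in> pull_graph \<phi> (pull_graph \<psi> G) \<longleftrightarrow> ((\<lambda>y. u (\<phi> y)), (\<lambda>y. v (\<phi> y))) \<in> pull_graph \<psi> G"
    unfolding pull_graph_def[of \<phi>] by simp
  then show "(u, v) \<in> pull_graph \<phi> (pull_graph \<psi> G) \<longleftrightarrow> (u, v) \<in> G"
    by (simp only: pull_graph_comp_iff[OF G])
qed

lemma pull_graph_respects_space:
  assumes G: "respects_space M G"
  shows "respects_space N (pull_graph \<psi> G)"
  unfolding respects_space_def
proof (intro allI impI)
  fix u v u' v' assume uv: "(u, v) \<in> pull_graph \<psi> G"
    and eq: "\<forall>x\<in>space N. u' x = u x" "\<forall>x\<in>space N. v' x = v x"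
  from uv have "((\<lambda>x. u (\<psi> x)), (\<lambda>x. v (\<psi> x))) \<in> G" by (simp add: pull_graph_def)
  then have "((\<lambda>x. u' (\<psi> x)), (\<lambda>x. v' (\<psi> x))) \<in> G"
    by (rule respects_spaceD[OF G]) (use eq measurable_space[OF \<psi>] in auto)
  then show "(u', v') \<in> pull_graph \<psi> G" by (simp add: pull_graph_def)
qed

lemma densely_defined_pull_graph:
  assumes G: "respects_space M G" and d: "densely_defined M G"
  shows "densely_defined N (pull_graph \<psi> G)"
  unfolding densely_defined_def
proof (intro ballI allI impI)
  fix f :: "'a \<Rightarrow> real" and \<epsilon> :: real assume f: "f \<in> L2 N" and \<epsilon>: "\<epsilon> > 0"
  have "\<epsilon> / sqrt r > 0" using \<epsilon> r by simp
  then obtain z where z: "z \<in> Domain G" "z \<in> L2 M" "L2_norm M (\<lambda>x. f (\<psi> x) - z x) < \<epsilon> / sqrt r"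
    using d[unfolded densely_defined_def, rule_format, OF L2_\<psi>[OF f]] by blast
  show "\<exists>z\<in>Domain (pull_graph \<psi> G). z \<in> L2 N \<and> L2_norm N (\<lambda>x. f x - z x) < \<epsilon>"
  proof (intro bexI conjI)
    from z(1) obtain w where "(z, w) \<in> G" by auto
    then have "((\<lambda>y. z (\<phi> y)), (\<lambda>y. w (\<phi> y))) \<in> pull_graph \<psi> G"
      by (simp add: pull_graph_comp_iff[OF G])
    then show "(\<lambda>y. z (\<phi> y)) \<in> Domain (pull_graph \<psi> G)" by (rule DomainI)
    show "(\<lambda>y. z (\<phi> y)) \<in> L2 N" by (rule L2_comp[OF z(2)])
    have "L2_norm N (\<lambda>y. f y - z (\<phi> y)) = L2_norm N (\<lambda>y. f (\<psi> (\<phi> y)) - z (\<phi> y))"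
      by (rule L2_norm_cong) (simp add: \<psi>\<phi>)
    also have "\<dots> = sqrt r * L2_norm M (\<lambda>x. f (\<psi> x) - z x)"
      by (intro L2_norm_comp borel_measurable_diff L2_borel_measurable L2_\<psi> f z(2))
    also have "\<dots> < \<epsilon>" using z(3) r by (simp add: field_simps)
    finally show "L2_norm N (\<lambda>y. f y - z (\<phi> y)) < \<epsilon>" .
  qed
qed

text \<open>Both inner products in the definition of the adjoint are multiplied by the same constant \<open>r\<close>.\<close>

lemma adjoint_graph_pull_graph:
  assumes G: "respects_space M G" "G \<subseteq> L2 M \<times> L2 M"
  shows "adjoint_graph N (pull_graph \<psi> G) = pull_graph \<psi> (adjoint_graph M G)"
proof (rule set_eqI, clarify)
  fix u v
  note m = L2_borel_measurable
  have "(\<forall>(z, w)\<in>pull_graph \<psi> G. L2_inner N w u = L2_inner N z v) \<longleftrightarrow>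
      (\<forall>(z, w)\<in>G. L2_inner M w (\<lambda>x. u (\<psi> x)) = L2_inner M z (\<lambda>x. v (\<psi> x)))"
    (is "?L \<longleftrightarrow> ?R") if uv: "u \<in> L2 N" "v \<in> L2 N"
  proof
    assume L: ?L
    show ?R
    proof clarify
      fix z w assume zw: "(z, w) \<in> G"
      then have zw': "((\<lambda>y. z (\<phi> y)), (\<lambda>y. w (\<phi> y))) \<in> pull_graph \<psi> G"
        by (simp add: pull_graph_comp_iff[OF G(1)])
      from subsetD[OF G(2) zw] have zwm: "z \<in> borel_measurable M" "w \<in> borel_measurable M"
        by (simp_all add: m)
      have *: "L2_inner N (\<lambda>y. f (\<phi> y)) g = r * L2_inner M f (\<lambda>x. g (\<psi> x))"
        if "f \<in> borel_measurable M" "g \<in> borel_measurable N" for f g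
      proof -
        have "L2_inner M (\<lambda>x. f (\<phi> (\<psi> x))) (\<lambda>x. g (\<psi> x)) = L2_inner M f (\<lambda>x. g (\<psi> x))"
          by (rule L2_inner_cong) (simp_all add: \<phi>\<psi>)
        then show ?thesis using L2_inner_\<psi>[OF measurable_comp[OF that(1)] that(2)] by simp
      qed
      show "L2_inner M w (\<lambda>x. u (\<psi> x)) = L2_inner M z (\<lambda>x. v (\<psi> x))"
      proof -
        have "L2_inner N (\<lambda>y. w (\<phi> y)) u = L2_inner N (\<lambda>y. z (\<phi> y)) v" using L zw' by auto
        then show ?thesis using r by (simp add: *[OF zwm(2) m[OF uv(1)]] *[OF zwm(1) m[OF uv(2)]])
      qed
    qed
  next
    assume R: ?R
    show ?L
    proof clarify
      fix z w assume zw: "(z, w) \<in> pull_graph \<psi> G"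
      then have zw': "((\<lambda>x. z (\<psi> x)), (\<lambda>x. w (\<psi> x))) \<in> G" by (simp add: pull_graph_def)
      from subsetD[OF G(2) this] have "z \<in> L2 N" "w \<in> L2 N" by (simp_all add: L2_\<psi>_iff)
      then have zwm: "z \<in> borel_measurable N" "w \<in> borel_measurable N" by (simp_all add: m)
      have "L2_inner M (\<lambda>x. w (\<psi> x)) (\<lambda>x. u (\<psi> x)) = L2_inner M (\<lambda>x. z (\<psi> x)) (\<lambda>x. v (\<psi> x))"
        using R zw' by auto
      then show "L2_inner N w u = L2_inner N z v"
        by (simp only: L2_inner_\<psi>[OF zwm(2) m[OF uv(1)]] L2_inner_\<psi>[OF zwm(1) m[OF uv(2)]])
    qed
  qed
  moreover have "(u, v) \<in> adjoint_graph N (pull_graph \<psi> G) \<longleftrightarrow> u \<in> L2 N \<and> v \<in> L2 N \<and>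
      (\<forall>(z, w)\<in>pull_graph \<psi> G. L2_inner N w u = L2_inner N z v)"
    by (simp add: adjoint_graph_def)
  moreover have "(u, v) \<in> pull_graph \<psi> (adjoint_graph M G) \<longleftrightarrow> u \<in> L2 N \<and> v \<in> L2 N \<and>
      (\<forall>(z, w)\<in>G. L2_inner M w (\<lambda>x. u (\<psi> x)) = L2_inner M z (\<lambda>x. v (\<psi> x)))"
    by (simp add: adjoint_graph_def pull_graph_def L2_\<psi>_iff)
  ultimately show "(u, v) \<in> adjoint_graph N (pull_graph \<psi> G) \<longleftrightarrow> (u, v) \<in> pull_graph \<psi> (adjoint_graph M G)"
    by blast
qed

lemma self_adjoint_pull_graph:
  assumes G: "self_adjoint M G"
  shows "self_adjoint N (pull_graph \<psi> G)"
proof -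
  note resp = self_adjoint_respects_space[OF G]
  have d: "densely_defined M G" and a: "adjoint_graph M G = G"
    using G[unfolded self_adjoint_def] by simp_all
  have "adjoint_graph N (pull_graph \<psi> G) = pull_graph \<psi> G"
    unfolding adjoint_graph_pull_graph[OF resp self_adjoint_subset_L2[OF G]] a ..
  with densely_defined_pull_graph[OF resp d] show ?thesis
    unfolding self_adjoint_def by (rule conjI)
qed

text \<open>Solvability is transported by composition, and the lower bound holds with the same constant, since
  both norms are multiplied by \<open>sqrt r\<close>.\<close>

lemma resolvent_set_pull_graph_subset:
  assumes G: "respects_space M G" "G \<subseteq> L2 M \<times> L2 M"
  shows "resolvent_set M (neg_graph G) \<subseteq> resolvent_set N (neg_graph (pull_graph \<psi> G))"
proof
  fix \<mu> assume \<mu>: "\<mu> \<in> resolvent_set M (neg_graph G)"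
  from conjunct2[OF \<mu>[unfolded resolvent_set_iff]]
  obtain C where C: "\<And>z w. (z, w) \<in> neg_graph G \<Longrightarrow> L2_norm M z \<le> C * L2_norm M (\<lambda>x. w x - \<mu> * z x)"
    by blast
  show "\<mu> \<in> resolvent_set N (neg_graph (pull_graph \<psi> G))"
    unfolding resolvent_set_iff
  proof (intro conjI ballI exI[of _ C] allI impI)
    fix v assume v: "v \<in> L2 N"
    from bspec[OF conjunct1[OF \<mu>[unfolded resolvent_set_iff]] L2_\<psi>[OF v]]
    obtain z w where zw: "(z, w) \<in> neg_graph G" and AE: "AE x in M. w x - \<mu> * z x = v (\<psi> x)"
      by (elim exE conjE)
    from zw obtain w' where w': "w = (\<lambda>x. - w' x)" "(z, w') \<in> G" by (auto simp: neg_graph_def)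
    have "((\<lambda>y. z (\<phi> y)), (\<lambda>y. w (\<phi> y))) \<in> neg_graph (pull_graph \<psi> G)"
      using w' pull_graph_comp_iff[OF G(1), of z w'] by (auto simp: neg_graph_def)
    moreover have "AE y in N. w (\<phi> y) - \<mu> * z (\<phi> y) = v y"
      using AE_comp[OF AE] AE_space by eventually_elim (simp add: \<psi>\<phi>)
    ultimately show "\<exists>z w. (z, w) \<in> neg_graph (pull_graph \<psi> G) \<and> (AE x in N. w x - \<mu> * z x = v x)"
      by blast
  next
    fix z w assume "(z, w) \<in> neg_graph (pull_graph \<psi> G)"
    then obtain w' where w': "w = (\<lambda>x. - w' x)" and "(z, w') \<in> pull_graph \<psi> G" by (auto simp: neg_graph_def)
    then have *: "((\<lambda>x. z (\<psi> x)), (\<lambda>x. w' (\<psi> x))) \<in> G" by (simp add: pull_graph_def)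
    from subsetD[OF G(2) *] have "z \<in> L2 N" "w' \<in> L2 N" by (simp_all add: L2_\<psi>_iff)
    then have m: "z \<in> borel_measurable N" "w \<in> borel_measurable N"
      using L2_borel_measurable by (auto simp: w')
    have "((\<lambda>x. z (\<psi> x)), (\<lambda>x. w (\<psi> x))) \<in> neg_graph G"
      using * by (auto simp: neg_graph_def w')
    from C[OF this] have "sqrt r * L2_norm M (\<lambda>x. z (\<psi> x)) \<le>
        sqrt r * (C * L2_norm M (\<lambda>x. w (\<psi> x) - \<mu> * z (\<psi> x)))"
      using r by (intro mult_left_mono) auto
    moreover have "L2_norm N (\<lambda>x. w x - \<mu> * z x) = sqrt r * L2_norm M (\<lambda>x. w (\<psi> x) - \<mu> * z (\<psi> x))"
      by (intro L2_norm_\<psi> borel_measurable_diff borel_measurable_times borel_measurable_const m)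
    ultimately show "L2_norm N z \<le> C * L2_norm N (\<lambda>x. w x - \<mu> * z x)"
      by (simp add: L2_norm_\<psi>[OF m(1)] mult.left_commute)
  qed
qed

lemma pull_graph_subset_L2: "G \<subseteq> L2 M \<times> L2 M \<Longrightarrow> pull_graph \<psi> G \<subseteq> L2 N \<times> L2 N"
  using L2_\<psi>_iff by (auto simp: pull_graph_def)

lemma spectrum_pull_graph:
  assumes G: "respects_space M G" "G \<subseteq> L2 M \<times> L2 M"
  shows "spectrum M (neg_graph G) = spectrum N (neg_graph (pull_graph \<psi> G))"
proof -
  have "resolvent_set N (neg_graph (pull_graph \<psi> G)) \<subseteq>
      resolvent_set M (neg_graph (pull_graph \<phi> (pull_graph \<psi> G)))"
    by (rule scaled_measure_iso.resolvent_set_pull_graph_subset[OF converse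
          pull_graph_respects_space[OF G(1)] pull_graph_subset_L2[OF G(2)]])
  then show ?thesis
    using resolvent_set_pull_graph_subset[OF G] by (auto simp: spectrum_def pull_graph_pull_graph[OF G(1)])
qed

text \<open>Normalizing both measures turns the scaled isomorphism into a measure preserving one.\<close>

lemma scale:
  assumes cd: "d * ennreal r = c"
  shows "scaled_measure_iso (scale_measure c M) (scale_measure d N) \<phi> \<psi> 1"
proof
  show "distr (scale_measure d N) (scale_measure c M) \<phi> = scale_measure (ennreal 1) (scale_measure c M)"
  proof (rule measure_eqI)
    fix X assume "X \<in> sets (distr (scale_measure d N) (scale_measure c M) \<phi>)"
    then have X: "X \<in> sets M" by simp
    have "emeasure (distr (scale_measure d N) (scale_measure c M) \<phi>) X = d * emeasure N (\<phi> -` X \<inter> space N)"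
      using \<phi> X by (subst emeasure_distr) (auto simp: space_scale_measure)
    also have "emeasure N (\<phi> -` X \<inter> space N) = emeasure (distr N M \<phi>) X"
      by (simp add: emeasure_distr[OF \<phi> X])
    finally show "emeasure (distr (scale_measure d N) (scale_measure c M) \<phi>) X =
        emeasure (scale_measure (ennreal 1) (scale_measure c M)) X"
      by (simp add: distr mult.assoc[symmetric] cd)
  qed simp
qed (use \<phi> \<psi> \<psi>\<phi> \<phi>\<psi> in \<open>simp_all add: space_scale_measure\<close>)

end

section \<open>Smoothness of the support function\<close>

text \<open>Since the solution \<open>g\<close> is given and continuous, no inverse function has to be constructed. The
  injective derivative of \<open>\<Psi>\<close> is bounded below near \<open>g u0\<close>, and this bound turns the linearization of
  \<open>\<Psi> (g y) - \<Psi> (g u) = J (y - u)\<close> into an estimate for the error of \<open>(\<Psi>' (g u))\<^sup>-\<^sup>1 (J (y - u))\<close> as an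
  approximation of \<open>g y - g u\<close>.\<close>

lemma C1_solution:
  fixes \<Psi> :: "'a :: euclidean_space \<Rightarrow> 'a" and g :: "'b :: euclidean_space \<Rightarrow> 'a"
  assumes \<Psi>: "\<And>e. e \<in> V \<Longrightarrow> (\<Psi> has_derivative \<Psi>' e) (at e)" "\<And>w. continuous_on V (\<lambda>e. \<Psi>' e w)"
    and W: "open W" "u0 \<in> W" and g: "continuous_on W g" "\<And>u. u \<in> W \<Longrightarrow> g u \<in> V"
    and eq: "\<And>u. u \<in> W \<Longrightarrow> \<Psi> (g u) = J u" and J: "linear J" and inj: "inj (\<Psi>' (g u0))"
  obtains W' L where "open W'" "u0 \<in> W'" "W' \<subseteq> W"
    "\<And>u. u \<in> W' \<Longrightarrow> (g has_derivative L u) (at u)" "\<And>v. continuous_on W' (\<lambda>u. L u v)"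
proof -
  have lin: "linear (\<Psi>' (g u))" if "u \<in> W" for u
    using \<Psi>(1)[OF g(2)[OF that]] by (rule has_derivative_linear)
  obtain c where c: "c > 0" "\<And>w. c * norm w \<le> norm (\<Psi>' (g u0) w)"
    using linear_inj_bounded_below_pos[OF lin[OF W(2)] inj] by blast
  have contP: "continuous_on W (\<lambda>u. \<Psi>' (g u) w)" for w
    by (rule continuous_on_compose2[OF \<Psi>(2) g(1)]) (use g(2) in auto)
  define s where "s u = (\<Sum>b\<in>Basis. norm (\<Psi>' (g u) b - \<Psi>' (g u0) b))" for u
  have s: "continuous_on W s"
    unfolding s_def by (intro continuous_intros contP)
  \<comment> \<open>On \<open>W'\<close> the operator \<open>\<Psi>' (g u)\<close> is closer than \<open>c / 2\<close> to \<open>\<Psi>' (g u0)\<close>, hence bounded below by \<open>c / 2\<close>.\<close>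
  define W' where "W' = W \<inter> s -` {..<c / 2}"
  have W'_open: "open W'"
    unfolding W'_def by (rule continuous_open_preimage[OF s W(1)]) simp
  have u0: "u0 \<in> W'" using W c(1) by (simp add: W'_def s_def)
  define \<kappa> where "\<kappa> = c / 2"
  have \<kappa>: "\<kappa> > 0" using c(1) by (simp add: \<kappa>_def)
  have low: "\<kappa> * norm w \<le> norm (\<Psi>' (g u) w)" if u: "u \<in> W'" for u w
  proof -
    have uW: "u \<in> W" and su: "s u < c / 2" using u by (auto simp: W'_def)
    have "\<Psi>' (g u) w - \<Psi>' (g u0) w = (\<Sum>b\<in>Basis. (w \<bullet> b) *\<^sub>R (\<Psi>' (g u) b - \<Psi>' (g u0) b))"
    proof -
      have "\<Psi>' (g x) w = (\<Sum>b\<in>Basis. (w \<bullet> b) *\<^sub>R \<Psi>' (g x) b)" if "x \<in> W" for x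
        using linear_sum[OF lin[OF that], of "\<lambda>b. (w \<bullet> b) *\<^sub>R b" Basis]
        by (simp add: euclidean_representation linear_scale[OF lin[OF that]])
      then show ?thesis using uW W(2) by (simp add: sum_subtractf scaleR_diff_right)
    qed
    also have "norm \<dots> \<le> (\<Sum>b\<in>Basis. norm w * norm (\<Psi>' (g u) b - \<Psi>' (g u0) b))"
      by (rule sum_norm_le) (simp add: mult_right_mono Basis_le_norm)
    also have "\<dots> = norm w * s u" by (simp add: s_def sum_distrib_left)
    also have "\<dots> \<le> norm w * (c / 2)" using su by (intro mult_left_mono) auto
    finally have "norm (\<Psi>' (g u) w - \<Psi>' (g u0) w) \<le> norm w * (c / 2)" .
    then show ?thesis
      using c(2)[of w] norm_triangle_ineq2[of "\<Psi>' (g u0) w" "\<Psi>' (g u) w"]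
      by (simp add: \<kappa>_def norm_minus_commute algebra_simps)
  qed
  define L where "L u v = inv (\<Psi>' (g u)) (J v)" for u v
  have injW: "inj (\<Psi>' (g u))" if "u \<in> W'" for u
  proof (rule injI)
    have l: "linear (\<Psi>' (g u))" using lin that by (auto simp: W'_def)
    fix x y assume "\<Psi>' (g u) x = \<Psi>' (g u) y"
    then have "\<Psi>' (g u) (x - y) = 0" by (simp add: linear_diff[OF l])
    then show "x = y" using low[OF that, of "x - y"] \<kappa> by (simp add: mult_le_0_iff)
  qed
  have PL: "\<Psi>' (g u) (L u v) = J v" if "u \<in> W'" for u v
  proof -
    have "surj (\<Psi>' (g u))"
      using linear_injective_imp_surjective[OF lin injW[OF that]] that by (auto simp: W'_def)
    then show ?thesis by (simp add: L_def surj_f_inv_f)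
  qed
  have Llin: "linear (L u)" if u: "u \<in> W'" for u
  proof -
    have l: "linear (\<Psi>' (g u))" using lin u by (auto simp: W'_def)
    show ?thesis
      by (rule linearI; rule injD[OF injW[OF u]])
        (simp_all add: PL[OF u] linear_add[OF l] linear_scale[OF l] linear_add[OF J] linear_scale[OF J])
  qed
  have deriv: "(g has_derivative L u) (at u)" if u: "u \<in> W'" for u
    unfolding has_derivative_at_alt
  proof (intro conjI allI impI)
    have uW: "u \<in> W" using u by (simp add: W'_def)
    show "bounded_linear (L u)" using Llin[OF u] by (simp add: linear_linear)
    obtain B where B: "B > 0" "\<And>v. norm (L u v) \<le> B * norm v"
      using linear_bounded_pos[OF Llin[OF u]] by blast
    fix e :: real assume e: "e > 0"
    define \<epsilon> where "\<epsilon> = min (\<kappa> / 2) (e * \<kappa> / (2 * B))"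
    have \<epsilon>: "\<epsilon> > 0" "\<epsilon> \<le> \<kappa> / 2" "2 * \<epsilon> * B \<le> e * \<kappa>"
      using e \<kappa> B(1) by (auto simp: \<epsilon>_def min_def field_simps)
    obtain d1 where d1: "d1 > 0" "\<And>y. norm (y - g u) < d1 \<Longrightarrow>
        norm (\<Psi> y - \<Psi> (g u) - \<Psi>' (g u) (y - g u)) \<le> \<epsilon> * norm (y - g u)"
      using \<Psi>(1)[OF g(2)[OF uW]] \<epsilon>(1) unfolding has_derivative_at_alt by blast
    obtain d2 where d2: "d2 > 0" "\<And>y. y \<in> W \<Longrightarrow> dist y u < d2 \<Longrightarrow> dist (g y) (g u) < d1"
      using g(1) uW d1(1) unfolding continuous_on_iff by blast
    obtain d3 where d3: "d3 > 0" "ball u d3 \<subseteq> W"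
      using W(1) uW open_contains_ball by blast
    show "\<exists>d>0. \<forall>y. norm (y - u) < d \<longrightarrow> norm (g y - g u - L u (y - u)) \<le> e * norm (y - u)"
    proof (intro exI[of _ "min d2 d3"] conjI allI impI)
      show "min d2 d3 > 0" using d2(1) d3(1) by simp
      fix y assume "norm (y - u) < min d2 d3"
      then have y: "dist y u < d2" "y \<in> ball u d3" by (auto simp: dist_norm norm_minus_commute)
      then have yW: "y \<in> W" using d3(2) by blast
      have gy: "norm (g y - g u) < d1" using d2(2)[OF yW y(1)] by (simp add: dist_norm)
      let ?r = "g y - g u - L u (y - u)"
      have l: "linear (\<Psi>' (g u))" by (rule lin[OF uW])
      have "\<Psi> (g y) - \<Psi> (g u) - \<Psi>' (g u) (g y - g u) = - \<Psi>' (g u) ?r"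
        by (simp add: eq[OF yW] eq[OF uW] linear_diff[OF l] PL[OF u] linear_diff[OF J])
      then have "norm (\<Psi>' (g u) ?r) \<le> \<epsilon> * norm (g y - g u)"
        using d1(2)[OF gy] by (simp only: norm_minus_cancel)
      then have "\<kappa> * norm ?r \<le> \<epsilon> * norm (g y - g u)" using low[OF u, of ?r] by simp
      also have "norm (g y - g u) \<le> norm ?r + norm (L u (y - u))"
        using norm_triangle_ineq[of ?r "L u (y - u)"] by simp
      also have "\<dots> \<le> norm ?r + B * norm (y - u)" using B(2)[of "y - u"] by simp
      finally have "\<kappa> * norm ?r \<le> \<epsilon> * (norm ?r + B * norm (y - u))" using \<epsilon>(1) by simp
      moreover have "\<epsilon> * norm ?r \<le> \<kappa> / 2 * norm ?r" using \<epsilon>(2) by (intro mult_right_mono) auto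
      moreover have "2 * \<epsilon> * B * norm (y - u) \<le> e * \<kappa> * norm (y - u)"
        using \<epsilon>(3) by (intro mult_right_mono) auto
      ultimately have "\<kappa> * norm ?r \<le> \<kappa> * (e * norm (y - u))" by (simp add: algebra_simps)
      then show "norm ?r \<le> e * norm (y - u)" using \<kappa> by simp
    qed
  qed
  have contL: "continuous_on W' (\<lambda>u. L u v)" for v
    unfolding continuous_on_def
  proof
    fix u1 assume u1: "u1 \<in> W'"
    let ?w = "L u1 v"
    have "((\<lambda>u. \<Psi>' (g u) ?w) \<longlongrightarrow> \<Psi>' (g u1) ?w) (at u1 within W')"
      using continuous_on_subset[OF contP, of W'] u1 by (auto simp: W'_def continuous_on_def)
    then have "((\<lambda>u. norm (\<Psi>' (g u) ?w - \<Psi>' (g u1) ?w) / \<kappa>) \<longlongrightarrow> norm (\<Psi>' (g u1) ?w - \<Psi>' (g u1) ?w) / \<kappa>) (at u1 within W')"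
      by (intro tendsto_intros) (use \<kappa> in auto)
    then have lim: "((\<lambda>u. norm (\<Psi>' (g u) ?w - \<Psi>' (g u1) ?w) / \<kappa>) \<longlongrightarrow> 0) (at u1 within W')" by simp
    have "\<forall>\<^sub>F u in at u1 within W'. norm (L u v - ?w) \<le> norm (\<Psi>' (g u) ?w - \<Psi>' (g u1) ?w) / \<kappa>"
      unfolding eventually_at_filter
    proof (rule always_eventually, intro allI impI)
      fix u assume u: "u \<in> W'"
      then have l: "linear (\<Psi>' (g u))" using lin by (auto simp: W'_def)
      have e: "\<Psi>' (g u) (L u v - ?w) = - (\<Psi>' (g u) ?w - \<Psi>' (g u1) ?w)"
        by (simp add: linear_diff[OF l] PL[OF u] PL[OF u1])
      have "norm (L u v - ?w) * \<kappa> \<le> norm (\<Psi>' (g u) ?w - \<Psi>' (g u1) ?w)"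
        using low[OF u, of "L u v - ?w"] unfolding e norm_minus_cancel by (simp only: mult.commute)
      then show "norm (L u v - ?w) \<le> norm (\<Psi>' (g u) ?w - \<Psi>' (g u1) ?w) / \<kappa>"
        using \<kappa> by (simp add: pos_le_divide_eq)
    qed
    then have "((\<lambda>u. L u v - ?w) \<longlongrightarrow> 0) (at u1 within W')" using lim by (rule Lim_null_comparison)
    then show "((\<lambda>u. L u v) \<longlongrightarrow> ?w) (at u1 within W')" by (simp add: LIM_zero_iff)
  qed
  show thesis by (rule that[OF W'_open u0 _ deriv contL]) (auto simp: W'_def)
qed

definition support_point :: "(real ^ 'n) set \<Rightarrow> real ^ 'n \<Rightarrow> real ^ 'n" where
  "support_point K u = (SOME x. x \<in> K \<and> (\<forall>y\<in>K. y \<bullet> u \<le> x \<bullet> u))"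

lemma support_point:
  fixes K :: "(real ^ 'n) set"
  assumes "compact K" "K \<noteq> {}"
  shows support_point_in: "support_point K u \<in> K"
    and support_point_max: "y \<in> K \<Longrightarrow> y \<bullet> u \<le> support_point K u \<bullet> u"
    and support_fun_eq: "support_fun K u = support_point K u \<bullet> u"
proof -
  have "\<exists>x\<in>K. \<forall>y\<in>K. y \<bullet> u \<le> x \<bullet> u"
    by (rule continuous_attains_sup[OF assms]) (intro continuous_intros)
  then have "\<exists>x. x \<in> K \<and> (\<forall>y\<in>K. y \<bullet> u \<le> x \<bullet> u)" by blast
  from someI_ex[OF this] have *: "support_point K u \<in> K" "\<And>y. y \<in> K \<Longrightarrow> y \<bullet> u \<le> support_point K u \<bullet> u"
    unfolding support_point_def by auto
  then show "support_point K u \<in> K" "y \<in> K \<Longrightarrow> y \<bullet> u \<le> support_point K u \<bullet> u" by auto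
  show "support_fun K u = support_point K u \<bullet> u"
    unfolding support_fun_def by (rule cSup_eq_maximum) (use * in auto)
qed

lemma maximizer_in_frontier:
  fixes K :: "(real ^ 'n) set"
  assumes x: "x \<in> K" "\<And>y. y \<in> K \<Longrightarrow> y \<bullet> u \<le> x \<bullet> u" and u: "u \<noteq> 0"
  shows "x \<in> frontier K"
proof -
  have "x \<notin> interior K"
  proof
    assume "x \<in> interior K"
    then obtain e where e: "e > 0" "ball x e \<subseteq> K" by (auto simp: mem_interior)
    let ?t = "e / (2 * norm u)"
    have "x + ?t *\<^sub>R u \<in> ball x e" using e(1) u by (simp add: dist_norm)
    then have "(x + ?t *\<^sub>R u) \<bullet> u \<le> x \<bullet> u" using e(2) x(2) by blast
    then have "?t * (u \<bullet> u) \<le> 0" by (simp add: inner_add_left)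
    moreover have "?t > 0" "u \<bullet> u > 0" using e(1) u by simp_all
    ultimately show False by (smt (verit) mult_pos_pos)
  qed
  then show ?thesis using x(1) closure_subset by (auto simp: frontier_def)
qed

lemma DERIV_line:
  assumes "(f has_derivative D) (at (x + t *\<^sub>R v))"
  shows "((\<lambda>s. f (x + s *\<^sub>R v)) has_real_derivative D v) (at t)"
proof -
  have "((\<lambda>s. f (x + s *\<^sub>R v)) has_derivative (\<lambda>s. D (s *\<^sub>R v))) (at t)"
    by (rule has_derivative_compose[where f="\<lambda>s. x + s *\<^sub>R v", OF _ assms]) (auto intro!: derivative_eq_intros)
  moreover have "(\<lambda>s. D (s *\<^sub>R v)) = (*) (D v)"
    by (simp add: fun_eq_iff linear_scale[OF has_derivative_linear[OF assms]] mult.commute)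
  ultimately show ?thesis by (simp only: has_field_derivative_def)
qed

lemma line_stays_in_open:
  fixes x v :: "'a :: real_normed_vector"
  assumes "open U" "x \<in> U"
  obtains d where "d > 0" "\<And>t. \<bar>t\<bar> < d \<Longrightarrow> x + t *\<^sub>R v \<in> U"
proof -
  obtain e where e: "e > 0" "ball x e \<subseteq> U" using assms open_contains_ball by blast
  show thesis
  proof (rule that[of "e / (norm v + 1)"])
    show "e / (norm v + 1) > 0" using e(1) by (simp add: add_nonneg_pos)
    fix t assume "\<bar>t\<bar> < e / (norm v + 1)"
    then have "\<bar>t\<bar> * (norm v + 1) < e" by (simp add: pos_less_divide_eq add_nonneg_pos)
    moreover have "\<bar>t\<bar> * norm v \<le> \<bar>t\<bar> * (norm v + 1)" by (intro mult_left_mono) auto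
    ultimately have "norm (t *\<^sub>R v) < e" by simp
    then show "x + t *\<^sub>R v \<in> U" using e(2) by (auto simp: dist_norm)
  qed
qed

text \<open>A direction in which \<open>f\<close> decreases leads into \<open>K\<close>, where the functional \<open>u\<close> cannot increase. A linear
  functional which is nonpositive on the half-space \<open>D v < 0\<close> is a nonnegative multiple of \<open>D\<close>.\<close>

lemma lagrange_multiplier:
  fixes f :: "real ^ 'n \<Rightarrow> real"
  assumes U: "open U" "x \<in> U" and KU: "K \<inter> U = {x \<in> U. f x \<le> 0}" and D: "(f has_derivative D) (at x)"
    and nz: "D w0 \<noteq> 0" and x: "x \<in> K" "\<And>y. y \<in> K \<Longrightarrow> y \<bullet> u \<le> x \<bullet> u"
  obtains \<tau> where "\<tau> \<ge> 0" "\<And>v. v \<bullet> u = \<tau> * D v"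
proof -
  note lin = has_derivative_linear[OF D]
  have neg: "v \<bullet> u \<le> 0" if v: "D v < 0" for v
  proof -
    have "((\<lambda>s. f (x + s *\<^sub>R v)) has_real_derivative D v) (at 0)"
      by (rule DERIV_line) (simp add: D)
    from DERIV_neg_dec_right[OF this v]
    obtain d1 where d1: "d1 > 0" "\<And>h. 0 < h \<Longrightarrow> h < d1 \<Longrightarrow> f (x + h *\<^sub>R v) < f x" by auto
    obtain d2 where d2: "d2 > 0" "\<And>t. \<bar>t\<bar> < d2 \<Longrightarrow> x + t *\<^sub>R v \<in> U"
      by (rule line_stays_in_open[OF U, of v]) (assumption | (rule that, assumption+))+
    define t where "t = min d1 d2 / 2"
    have t: "0 < t" "t < d1" "\<bar>t\<bar> < d2" using d1(1) d2(1) by (auto simp: t_def)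
    have "f x \<le> 0" using KU U(2) x(1) by blast
    then have "x + t *\<^sub>R v \<in> K" using d1(2)[OF t(1,2)] d2(2)[OF t(3)] KU by force
    from x(2)[OF this] show ?thesis using t(1) by (simp add: inner_add_left mult_le_0_iff)
  qed
  define w where "w = (- 1 / D w0) *\<^sub>R w0"
  have w: "D w = - 1" using nz unfolding w_def linear_scale[OF lin] by simp
  \<comment> \<open>The closed half-space follows by a small perturbation in the direction \<open>w\<close>; \<open>\<epsilon>\<close> is such that the
    perturbation changes \<open>v \<bullet> u\<close> by at most one half.\<close>
  have le: "v \<bullet> u \<le> 0" if v: "D v \<le> 0" for v
  proof (rule ccontr)
    assume "\<not> v \<bullet> u \<le> 0"
    then have pos: "v \<bullet> u > 0" by simp
    define \<epsilon> where "\<epsilon> = (v \<bullet> u) / (2 * (\<bar>w \<bullet> u\<bar> + 1))"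
    have \<epsilon>: "\<epsilon> > 0" using pos by (simp add: \<epsilon>_def add_nonneg_pos)
    have "D (v + \<epsilon> *\<^sub>R w) < 0" using v \<epsilon> by (simp add: linear_add[OF lin] linear_scale[OF lin] w)
    from neg[OF this] have "v \<bullet> u \<le> - (\<epsilon> * (w \<bullet> u))" by (simp add: inner_add_left)
    also have "\<dots> \<le> \<epsilon> * (\<bar>w \<bullet> u\<bar> + 1)"
    proof -
      have "- (w \<bullet> u) \<le> \<bar>w \<bullet> u\<bar> + 1" by linarith
      from mult_left_mono[OF this, of \<epsilon>] \<epsilon> show ?thesis by simp
    qed
    also have "\<dots> = (v \<bullet> u) / 2"
    proof -
      have half: "a / (2 * q) * q = a / 2" if "q > 0" for a q :: real using that by simp
      have "\<bar>w \<bullet> u\<bar> + 1 > 0" by linarith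
      then show ?thesis unfolding \<epsilon>_def by (rule half)
    qed
    finally show False using pos by simp
  qed
  show thesis
  proof (rule that[of "- (w \<bullet> u)"])
    show "- (w \<bullet> u) \<ge> 0" using neg[of w] w by simp
    fix v
    have z: "D (v + D v *\<^sub>R w) = 0"
      by (simp add: linear_add[OF lin] linear_scale[OF lin] w)
    then have "D (- (v + D v *\<^sub>R w)) = 0" by (simp only: linear_neg[OF lin])
    from le[OF eq_refl[OF z]] le[OF eq_refl[OF this]]
    have "(v + D v *\<^sub>R w) \<bullet> u = 0" unfolding inner_minus_left by linarith
    then show "v \<bullet> u = - (w \<bullet> u) * D v" by (simp add: inner_add_left mult.commute)
  qed
qed

lemma frontier_defining_function_zero:
  fixes f :: "real ^ 'n \<Rightarrow> real"
  assumes U: "open U" "x \<in> U" and KU: "K \<inter> U = {x \<in> U. f x \<le> 0}" and f: "continuous_on U f"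
    and x: "x \<in> frontier K" "x \<in> K"
  shows "f x = 0"
proof (rule ccontr)
  assume "f x \<noteq> 0"
  then have "x \<in> U \<inter> f -` {..<0}" using KU U(2) x(2) by force
  moreover have "open (U \<inter> f -` {..<0})" by (rule continuous_open_preimage[OF f U(1)]) simp
  moreover have "U \<inter> f -` {..<0} \<subseteq> K"
  proof
    fix y assume "y \<in> U \<inter> f -` {..<0}"
    then have "y \<in> K \<inter> U" unfolding KU by auto
    then show "y \<in> K" by simp
  qed
  ultimately have "x \<in> interior K" by (meson interiorI)
  then show False using x(1) by (simp add: frontier_def)
qed

lemma C2_positively_curved_boundaryE:
  assumes "C2_positively_curved_boundary K" "p \<in> frontier K"
  obtains U f w where "open U" "p \<in> U" "C2_on U f" "K \<inter> U = {x \<in> U. f x \<le> 0}"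
    "frechet_derivative f (at p) w \<noteq> 0"
    "\<And>v. v \<noteq> 0 \<Longrightarrow> frechet_derivative f (at p) v = 0 \<Longrightarrow> hess f p v v > 0"
  using bspec[OF assms(1)[unfolded C2_positively_curved_boundary_def] assms(2)]
  by (elim exE conjE) (rule that, assumption+, blast)

text \<open>Two maximizers would be joined by a segment of maximizers, along which the defining function
  vanishes; this contradicts the positive curvature in the direction of the segment.\<close>

lemma maximizer_unique:
  fixes K :: "(real ^ 'n) set"
  assumes K: "convex K" "C2_positively_curved_boundary K" and u: "u \<noteq> 0"
    and x: "x \<in> K" "\<And>z. z \<in> K \<Longrightarrow> z \<bullet> u \<le> x \<bullet> u" and y: "y \<in> K" "\<And>z. z \<in> K \<Longrightarrow> z \<bullet> u \<le> y \<bullet> u"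
  shows "x = y"
proof (rule ccontr)
  assume "x \<noteq> y"
  define v where "v = y - x"
  have v: "v \<noteq> 0" "v \<bullet> u = 0" using \<open>x \<noteq> y\<close> x(2)[OF y(1)] y(2)[OF x(1)] by (auto simp: v_def inner_diff_left)
  have xf: "x \<in> frontier K" by (rule maximizer_in_frontier[OF x u])
  obtain U f w0 where U: "open U" "x \<in> U" and f: "C2_on U f" and KU: "K \<inter> U = {x \<in> U. f x \<le> 0}"
    and w0: "frechet_derivative f (at x) w0 \<noteq> 0"
    and curv: "\<And>v. v \<noteq> 0 \<Longrightarrow> frechet_derivative f (at x) v = 0 \<Longrightarrow> hess f x v v > 0"
    by (rule C2_positively_curved_boundaryE[OF K(2) xf]) (assumption | (rule that, assumption+))+
  let ?D = "\<lambda>x. frechet_derivative f (at x)"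
  obtain \<tau> where \<tau>: "\<tau> \<ge> 0" "\<And>v. v \<bullet> u = \<tau> * ?D x v"
    by (rule lagrange_multiplier[OF U KU C2_onD1[OF f U(2)] w0 x]) (assumption | (rule that, assumption+))+
  have "\<tau> \<noteq> 0" using \<tau>(2)[of u] u by auto
  then have Dv: "?D x v = 0" using \<tau>(2)[of v] v(2) by simp
  obtain d where d: "d > 0" "\<And>t. \<bar>t\<bar> < d \<Longrightarrow> x + t *\<^sub>R v \<in> U"
    by (rule line_stays_in_open[OF U, of v]) (assumption | (rule that, assumption+))+
  have f0: "f (x + t *\<^sub>R v) = 0" if t: "0 \<le> t" "t \<le> 1" "t < d" for t
  proof -
    have tU: "x + t *\<^sub>R v \<in> U" using d(2)[of t] t by simp
    have "x + t *\<^sub>R v = (1 - t) *\<^sub>R x + t *\<^sub>R y" by (simp add: v_def algebra_simps)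
    then have tK: "x + t *\<^sub>R v \<in> K" using convexD_alt[OF K(1) x(1) y(1)] t by simp
    have "x + t *\<^sub>R v \<in> frontier K"
      by (rule maximizer_in_frontier[OF tK _ u]) (use x(2) v(2) in \<open>simp add: inner_add_left\<close>)
    from frontier_defining_function_zero[OF U(1) tU KU C2_on_continuous[OF f] this tK] show ?thesis .
  qed
  have D0: "?D (x + t *\<^sub>R v) v = 0" if t: "0 < t" "t < min 1 d" for t
  proof -
    have tU: "x + t *\<^sub>R v \<in> U" using d(2)[of t] t by simp
    have "((\<lambda>s. f (x + s *\<^sub>R v)) has_real_derivative ?D (x + t *\<^sub>R v) v) (at t)"
      by (rule DERIV_line[OF C2_onD1[OF f tU]])
    moreover have "((\<lambda>s. f (x + s *\<^sub>R v)) has_real_derivative 0) (at t)"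
      by (rule has_field_derivative_transform_within_open[OF DERIV_const[of 0], of "{0<..<min 1 d}"])
        (use t f0 in auto)
    ultimately show ?thesis by (rule DERIV_unique)
  qed
  have "((\<lambda>s. ?D (x + s *\<^sub>R v) v) has_real_derivative hess f x v v) (at 0)"
    by (rule DERIV_line) (simp add: C2_onD2[OF f U(2)])
  from DERIV_pos_inc_right[OF this curv[OF v(1) Dv]]
  obtain d1 where d1: "d1 > 0" "\<And>h. 0 < h \<Longrightarrow> h < d1 \<Longrightarrow> ?D x v < ?D (x + h *\<^sub>R v) v" by auto
  define t where "t = min d1 (min 1 d) / 2"
  have "0 < t" "t < d1" "t < min 1 d" using d1(1) d(1) by (auto simp: t_def)
  then show False using d1(2)[of t] D0[of t] Dv by simp
qed

text \<open>By uniqueness the graph of the support point map is cut out by closed conditions, and its values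
  lie in a compact set.\<close>

lemma continuous_on_support_point:
  fixes K :: "(real ^ 'n) set"
  assumes K: "compact K" "K \<noteq> {}" "convex K" "C2_positively_curved_boundary K"
  shows "continuous_on (- {0}) (support_point K)"
proof -
  let ?C = "\<Inter>y\<in>K. {p :: (real ^ 'n) \<times> (real ^ 'n). y \<bullet> fst p \<le> snd p \<bullet> fst p}"
  have closed: "closed ?C"
    by (intro closed_INT ballI closed_Collect_le continuous_intros)
  have eq: "(\<lambda>u. (u, support_point K u)) ` (- {0}) = (- {0}) \<times> K \<inter> ?C"
  proof (intro set_eqI iffI)
    fix p assume "p \<in> (\<lambda>u. (u, support_point K u)) ` (- {0})"
    then show "p \<in> (- {0}) \<times> K \<inter> ?C"
      using support_point_in[OF K(1,2)] support_point_max[OF K(1,2)] by auto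
  next
    fix p assume p: "p \<in> (- {0}) \<times> K \<inter> ?C"
    obtain u x where ux: "p = (u, x)" by (cases p)
    have "x = support_point K u"
      by (rule maximizer_unique[OF K(3,4), of u])
        (use p ux support_point_in[OF K(1,2)] support_point_max[OF K(1,2)] in auto)
    then show "p \<in> (\<lambda>u. (u, support_point K u)) ` (- {0})" using p ux by auto
  qed
  have "support_point K \<in> - {0} \<rightarrow> K" using support_point_in[OF K(1,2)] by auto
  from continuous_closed_graph_eq[OF K(1) this] show ?thesis
    unfolding eq using closedin_closed_Int[OF closed] by simp
qed

text \<open>The support point \<open>x\<close> and the multiplier \<open>\<tau>\<close> solve the Lagrange system \<open>\<tau> \<nabla>f x = u\<close>, \<open>f x = 0\<close>.
  Its derivative in \<open>(x, \<tau>)\<close> is injective: if \<open>\<mu> \<nabla>f + \<tau> D\<^sup>2f w = 0\<close> and \<open>w \<bottom> \<nabla>f\<close> then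
  \<open>D\<^sup>2f (w, w) = 0\<close>, so that \<open>w = 0\<close> by positive curvature.\<close>

lemma support_point_locally_C1:
  fixes K :: "(real ^ 'n) set"
  assumes K: "compact K" "K \<noteq> {}" "convex K" "C2_positively_curved_boundary K" and u0: "u0 \<noteq> 0"
  obtains W L where "open W" "u0 \<in> W" "\<And>u. u \<in> W \<Longrightarrow> (support_point K has_derivative L u) (at u)"
    "\<And>v. continuous_on W (\<lambda>u. L u v)"
proof -
  let ?G = "support_point K"
  note Gin = support_point_in[OF K(1,2)] and Gmax = support_point_max[OF K(1,2)]
  note Gcont = continuous_on_support_point[OF K]
  have Gfr: "?G u \<in> frontier K" if "u \<noteq> 0" for u
    by (rule maximizer_in_frontier[OF Gin Gmax that])
  obtain U f w0 where U: "open U" "?G u0 \<in> U" and f: "C2_on U f" and KU: "K \<inter> U = {x \<in> U. f x \<le> 0}"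
    and w0: "frechet_derivative f (at (?G u0)) w0 \<noteq> 0"
    and curv: "\<And>v. v \<noteq> 0 \<Longrightarrow> frechet_derivative f (at (?G u0)) v = 0 \<Longrightarrow> hess f (?G u0) v v > 0"
    by (rule C2_positively_curved_boundaryE[OF K(4) Gfr[OF u0]]) (assumption | (rule that, assumption+))+
  let ?D = "\<lambda>x. frechet_derivative f (at x)"
  note Dlin = C2_on_linear_frechet[OF f]
  define N where "N x = (\<Sum>b\<in>Basis. ?D x b *\<^sub>R b)" for x
  define HN where "HN x w = (\<Sum>b\<in>Basis. hess f x b w *\<^sub>R b)" for x w
  have repr: "(\<Sum>b\<in>Basis. l b *\<^sub>R b) \<bullet> v = l v" if "linear l" for l and v :: "real ^ 'n"
  proof -
    have "l v = l (\<Sum>b\<in>Basis. (v \<bullet> b) *\<^sub>R b)" by (simp add: euclidean_representation)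
    also have "\<dots> = (\<Sum>b\<in>Basis. (v \<bullet> b) * l b)" by (simp add: linear_sum[OF that] linear_scale[OF that])
    also have "\<dots> = (\<Sum>b\<in>Basis. l b *\<^sub>R b) \<bullet> v"
      unfolding inner_sum_left inner_scaleR_left by (intro sum.cong refl) (simp add: inner_commute)
    finally show ?thesis by (rule sym)
  qed
  have Nv: "N x \<bullet> v = ?D x v" if "x \<in> U" for x v
    unfolding N_def by (rule repr[OF Dlin[OF that]])
  have HNv: "HN x w \<bullet> v = hess f x v w" if "x \<in> U" for x v w
    unfolding HN_def by (rule repr[OF C2_on_linear_hess_left[OF U(1) f that]])
  have Nder: "(N has_derivative HN x) (at x)" if "x \<in> U" for x
    unfolding N_def[abs_def] HN_def[abs_def]
    by (intro has_derivative_sum has_derivative_scaleR_left C2_onD2[OF f that])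
  have Ncont: "continuous_on U N"
    unfolding N_def[abs_def] by (intro continuous_intros C2_on_frechet_continuous[OF f])
  have HNcont: "continuous_on U (\<lambda>x. HN x w)" for w
    unfolding HN_def by (intro continuous_intros C2_on_hess_continuous[OF f])
  define V where "V = U \<times> (UNIV :: real set)"
  define \<Psi> where "\<Psi> e = (snd e *\<^sub>R N (fst e), f (fst e))" for e
  define \<Psi>' where "\<Psi>' e w = (snd e *\<^sub>R HN (fst e) (fst w) + snd w *\<^sub>R N (fst e), ?D (fst e) (fst w))" for e w
  define W where "W = {u \<in> - {0}. ?G u \<in> U \<and> N (?G u) \<noteq> 0}"
  define g where "g u = (?G u, norm u / norm (N (?G u)))" for u
  have N0: "N (?G u0) \<noteq> 0"
    using w0 Nv[OF U(2)] by (metis inner_zero_left)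
  have W_eq: "W = (- {0}) \<inter> ?G -` (U \<inter> N -` (- {0}))" by (auto simp: W_def)
  have oUN: "open (U \<inter> N -` (- {0}))" by (rule continuous_open_preimage[OF Ncont U(1)]) auto
  have W: "open W" unfolding W_eq by (rule continuous_open_preimage[OF Gcont open_minus_zero oUN])
  have u0W: "u0 \<in> W" using u0 U(2) N0 by (simp add: W_def)
  have gcont: "continuous_on W g"
  proof -
    have "continuous_on W ?G" by (rule continuous_on_subset[OF Gcont]) (auto simp: W_def)
    moreover have "continuous_on W (\<lambda>u. N (?G u))"
      by (rule continuous_on_compose2[OF Ncont calculation]) (auto simp: W_def)
    ultimately show ?thesis unfolding g_def by (intro continuous_intros) (auto simp: W_def)
  qed
  have eq: "\<Psi> (g u) = (u, 0)" if u: "u \<in> W" for u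
  proof -
    have u': "u \<noteq> 0" "?G u \<in> U" "N (?G u) \<noteq> 0" using u by (auto simp: W_def)
    have "?D (?G u) (N (?G u)) \<noteq> 0" using Nv[OF u'(2), of "N (?G u)"] u'(3) by (metis inner_eq_zero_iff)
    then obtain \<tau> where \<tau>: "\<tau> \<ge> 0" "\<And>v. v \<bullet> u = \<tau> * ?D (?G u) v"
      by (rule lagrange_multiplier[OF U(1) u'(2) KU C2_onD1[OF f u'(2)] _ Gin Gmax]) (assumption | (rule that, assumption+))+
    have "v \<bullet> u = v \<bullet> (\<tau> *\<^sub>R N (?G u))" for v
      using \<tau>(2)[of v] Nv[OF u'(2), of v] by (simp add: inner_commute)
    then have uN: "u = \<tau> *\<^sub>R N (?G u)" by (metis vector_eq_ldot)
    then have "norm u = \<tau> * norm (N (?G u))" using \<tau>(1) by (metis abs_of_nonneg norm_scaleR)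
    then have "norm u / norm (N (?G u)) = \<tau>" using u'(3) by simp
    moreover have "f (?G u) = 0"
      by (rule frontier_defining_function_zero[OF U(1) u'(2) KU C2_on_continuous[OF f] Gfr[OF u'(1)] Gin])
    ultimately show ?thesis unfolding \<Psi>_def g_def fst_conv snd_conv using uN by metis
  qed
  have der: "(\<Psi> has_derivative \<Psi>' e) (at e)" if e: "e \<in> V" for e
  proof -
    have eU: "fst e \<in> U" using e by (auto simp: V_def)
    have fs: "(fst has_derivative fst) (at e)" "(snd has_derivative snd) (at e)"
      by (auto intro!: derivative_eq_intros)
    have 1: "((\<lambda>e. N (fst e)) has_derivative (\<lambda>w. HN (fst e) (fst w))) (at e)"
      by (rule has_derivative_compose[OF fs(1) Nder[OF eU]])
    have 2: "((\<lambda>e. f (fst e)) has_derivative (\<lambda>w. ?D (fst e) (fst w))) (at e)"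
      by (rule has_derivative_compose[OF fs(1) C2_onD1[OF f eU]])
    show ?thesis
      unfolding \<Psi>_def[abs_def] \<Psi>'_def[abs_def]
      by (rule has_derivative_Pair[OF has_derivative_scaleR[OF fs(2) 1] 2])
  qed
  have cont': "continuous_on V (\<lambda>e. \<Psi>' e w)" for w
  proof -
    have F: "continuous_on V fst" "fst ` V \<subseteq> U" by (auto simp: V_def intro!: continuous_intros)
    show ?thesis
      unfolding \<Psi>'_def
      by (intro continuous_intros continuous_on_compose2[OF Ncont F] continuous_on_compose2[OF HNcont F]
          continuous_on_compose2[OF C2_on_frechet_continuous[OF f] F])
  qed
  have inj: "inj (\<Psi>' (g u0))"
  proof -
    have lin: "linear (\<Psi>' (g u0))"
      by (rule has_derivative_linear[OF der]) (use U(2) in \<open>simp add: V_def g_def\<close>)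
    show ?thesis
      unfolding linear_injective_0[OF lin]
    proof (intro allI impI)
      fix e assume e: "\<Psi>' (g u0) e = 0"
      obtain w \<mu> where [simp]: "e = (w, \<mu>)" by (cases e)
      let ?x = "?G u0" and ?l = "norm u0 / norm (N (?G u0))"
      have Dw: "?D ?x w = 0" and s: "?l *\<^sub>R HN ?x w + \<mu> *\<^sub>R N ?x = 0"
        using e by (simp_all add: \<Psi>'_def g_def zero_prod_def)
      from s have "(?l *\<^sub>R HN ?x w + \<mu> *\<^sub>R N ?x) \<bullet> w = 0" by simp
      then have "?l * hess f ?x w w = 0"
        by (simp only: inner_add_left inner_scaleR_left HNv[OF U(2)] Nv[OF U(2)] Dw mult_zero_right add_0_right)
      moreover have "?l \<noteq> 0" using u0 N0 by simp
      ultimately have "w = 0" using curv[of w] Dw by fastforce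
      moreover have "HN ?x 0 = 0"
        using has_derivative_linear[OF Nder[OF U(2)]] by (rule linear_0)
      ultimately have "\<mu> = 0" using s N0 by simp
      with \<open>w = 0\<close> show "e = 0" by (simp add: zero_prod_def)
    qed
  qed
  have gV: "g u \<in> V" if "u \<in> W" for u using that by (simp add: g_def V_def W_def)
  have J: "linear (\<lambda>u :: real ^ 'n. (u, 0 :: real))" by (auto simp: linear_iff)
  obtain W' L where W': "open W'" "u0 \<in> W'" "W' \<subseteq> W" "\<And>u. u \<in> W' \<Longrightarrow> (g has_derivative L u) (at u)"
    "\<And>v. continuous_on W' (\<lambda>u. L u v)"
    by (rule C1_solution[OF der cont' W u0W gcont gV eq J inj]) (assumption | (rule that, assumption+))+
  have d: "(support_point K has_derivative (\<lambda>v. fst (L u v))) (at u)" if "u \<in> W'" for u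
    using has_derivative_fst[OF W'(4)[OF that]] by (simp add: g_def)
  have "continuous_on W' (\<lambda>u. fst (L u v))" for v
    by (intro continuous_on_fst W'(5))
  from that[OF W'(1,2) d this] show thesis .
qed

text \<open>The support points \<open>G u\<close> and \<open>G y\<close> are competitors for the maximum of the other, so that
  \<open>G u \<bullet> (y - u) \<le> h y - h u \<le> G y \<bullet> (y - u)\<close>; the gap is \<open>o(|y - u|)\<close> by continuity of \<open>G\<close>.\<close>

lemma has_derivative_support_fun:
  fixes K :: "(real ^ 'n) set"
  assumes K: "compact K" "K \<noteq> {}" "convex K" "C2_positively_curved_boundary K" and u: "u \<noteq> 0"
  shows "(support_fun K has_derivative (\<lambda>v. support_point K u \<bullet> v)) (at u)"
  unfolding has_derivative_at_alt
proof (intro conjI allI impI)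
  let ?G = "support_point K"
  show "bounded_linear (\<lambda>v. ?G u \<bullet> v)" by (rule bounded_linear_inner_right)
  fix e :: real assume e: "e > 0"
  have "isCont ?G u"
    using continuous_on_support_point[OF K] u by (simp add: continuous_on_eq_continuous_at[OF open_minus_zero])
  then obtain d where d: "d > 0" "\<And>y. dist y u < d \<Longrightarrow> dist (?G y) (?G u) < e"
    using e unfolding continuous_at_eps_delta by (auto simp: dist_norm)
  show "\<exists>d>0. \<forall>y. norm (y - u) < d \<longrightarrow>
      norm (support_fun K y - support_fun K u - ?G u \<bullet> (y - u)) \<le> e * norm (y - u)"
  proof (intro exI[of _ d] conjI allI impI)
    fix y assume y: "norm (y - u) < d"
    have 1: "?G u \<bullet> y \<le> ?G y \<bullet> y" "?G y \<bullet> u \<le> ?G u \<bullet> u"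
      by (intro support_point_max[OF K(1,2)] support_point_in[OF K(1,2)])+
    have "(?G y - ?G u) \<bullet> (y - u) \<le> norm (?G y - ?G u) * norm (y - u)" by (rule norm_cauchy_schwarz)
    also have "\<dots> \<le> e * norm (y - u)"
      using d(2)[of y] y by (intro mult_right_mono) (auto simp: dist_norm)
    finally have "(?G y - ?G u) \<bullet> (y - u) \<le> e * norm (y - u)" .
    then show "norm (support_fun K y - support_fun K u - ?G u \<bullet> (y - u)) \<le> e * norm (y - u)"
      using 1 unfolding support_fun_eq[OF K(1,2)]
      by (simp add: inner_diff_left inner_diff_right abs_le_iff)
  qed (rule d)
qed

text \<open>The gradient of the support function is the support point, which is a \<open>C\<^sup>1\<close> function of the
  direction.\<close>

theorem C2_sphere_support_fun:
  fixes K :: "(real ^ 'n) set"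
  assumes "K \<in> K2_plus"
  shows "C2_sphere (support_fun K)"
proof -
  have K: "compact K" "K \<noteq> {}" "convex K" "C2_positively_curved_boundary K"
    using assms interior_subset by (auto simp: K2_plus_def)
  let ?G = "support_point K"
  define L where "L u = frechet_derivative ?G (at u)" for u
  have loc: "\<exists>W. open W \<and> u \<in> W \<and> (\<forall>v. continuous_on W (\<lambda>u. L u v)) \<and> (?G has_derivative L u) (at u)"
    if u: "u \<noteq> 0" for u
  proof -
    obtain W M where W: "open W" "u \<in> W" "\<And>u. u \<in> W \<Longrightarrow> (?G has_derivative M u) (at u)"
      "\<And>v. continuous_on W (\<lambda>u. M u v)"
      by (rule support_point_locally_C1[OF K u]) (assumption | (rule that, assumption+))+
    have LM: "L u = M u" if "u \<in> W" for u
      unfolding L_def by (rule frechet_derivative_eqI[OF W(3)[OF that]])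
    have "continuous_on W (\<lambda>u. L u v)" for v
      using W(4)[of v] by (rule continuous_on_eq) (simp add: LM)
    then show ?thesis using W(1,2) W(3)[OF W(2)] LM[OF W(2)] by auto
  qed
  have GL: "(?G has_derivative L u) (at u)" if "u \<in> - {0}" for u using loc[of u] that by auto
  have "C2_on (- {0}) (support_fun K)"
  proof (rule C2_onI_C2[OF open_minus_zero])
    show "(support_fun K has_derivative (\<lambda>v. ?G u \<bullet> v)) (at u)" if "u \<in> - {0}" for u
      by (rule has_derivative_support_fun[OF K]) (use that in simp)
    show "((\<lambda>y. ?G y \<bullet> w) has_derivative (\<lambda>v. L u v \<bullet> w)) (at u)" if "u \<in> - {0}" for u w
      by (rule has_derivative_inner_left[OF GL[OF that]])
    show "continuous_on (- {0}) (\<lambda>u. L u v \<bullet> w)" for w v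
    proof (rule continuous_at_imp_continuous_on, rule ballI)
      fix u :: "real ^ 'n" assume "u \<in> - {0}"
      then obtain W where W: "open W" "u \<in> W" "continuous_on W (\<lambda>u. L u v)" using loc[of u] by auto
      then have "isCont (\<lambda>u. L u v) u" by (simp add: continuous_on_eq_continuous_at)
      then show "isCont (\<lambda>u. L u v \<bullet> w) u" by (intro continuous_intros)
    qed
  qed
  then show ?thesis
    unfolding C2_sphere_def
    by (rule C2_on_cong_C2[OF open_minus_zero])
      (use hom_ext_eq_self[OF pos_homogeneous_support_fun[OF compact_imp_bounded[OF K(1)] K(2)]] in auto)
qed

section \<open>Boundedness on the Sobolev space\<close>

lemma continuous_on_sphere_borel_measurable:
  fixes g :: "real ^ 'n \<Rightarrow> real"
  assumes "continuous_on (sphere 0 1) g"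
  shows "g \<in> borel_measurable sphere_measure"
  using borel_measurable_continuous_on_restrict[OF assms]
    measurable_cong_sets[OF sets_sphere_measure refl, of borel] by blast

lemma continuous_on_sphere_integrable:
  fixes g :: "real ^ 'n \<Rightarrow> real"
  assumes g: "continuous_on (sphere 0 1) g"
  shows "integrable sphere_measure g"
proof -
  interpret finite_measure "sphere_measure :: (real ^ 'n) measure"
    by (rule finite_measureI) (use emeasure_sphere_measure_finite in \<open>simp add: less_top\<close>)
  have "compact (g ` sphere 0 1)" by (rule compact_continuous_image[OF g]) simp
  then obtain B where B: "\<And>x. x \<in> sphere 0 1 \<Longrightarrow> norm (g x) \<le> B"
    using compact_imp_bounded[of "g ` sphere 0 1"] unfolding bounded_iff by blast
  show ?thesis
    by (rule integrable_const_bound[of _ B])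
      (use B continuous_on_sphere_borel_measurable[OF g] in \<open>auto simp: space_sphere_measure\<close>)
qed

lemma linear_functional_bound:
  fixes \<phi> :: "'a :: euclidean_space \<Rightarrow> real"
  assumes "linear \<phi>"
  shows "\<bar>\<phi> w\<bar> \<le> norm w * sqrt (\<Sum>b\<in>Basis. (\<phi> b)\<^sup>2)"
proof -
  define a where "a = adjoint \<phi> 1"
  have a: "\<phi> x = a \<bullet> x" for x
    using adjoint_works[OF assms, of x 1] by (simp add: a_def inner_commute)
  have "(\<Sum>b\<in>Basis. (\<phi> b)\<^sup>2) = a \<bullet> a"
    by (subst euclidean_inner) (simp add: a power2_eq_square)
  then have "sqrt (\<Sum>b\<in>Basis. (\<phi> b)\<^sup>2) = norm a" by (simp add: norm_eq_sqrt_inner)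
  then show ?thesis using Cauchy_Schwarz_ineq2[of a w] by (simp add: a mult.commute)
qed

lemma bilinear_form_bound:
  fixes H :: "'a :: euclidean_space \<Rightarrow> 'a \<Rightarrow> real"
  assumes "bilinear H"
  shows "\<bar>H u w\<bar> \<le> norm u * norm w * sqrt (\<Sum>b\<in>Basis. \<Sum>c\<in>Basis. (H b c)\<^sup>2)"
proof -
  have l1: "linear (H u)" and l2: "linear (\<lambda>u. H u v)" for u v
    using assms by (auto simp: bilinear_def)
  have "(H u c)\<^sup>2 \<le> (norm u)\<^sup>2 * (\<Sum>b\<in>Basis. (H b c)\<^sup>2)" for c
  proof -
    have "\<bar>H u c\<bar>\<^sup>2 \<le> (norm u * sqrt (\<Sum>b\<in>Basis. (H b c)\<^sup>2))\<^sup>2"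
      by (rule power_mono[OF linear_functional_bound[OF l2]]) simp
    then show ?thesis by (simp add: power_mult_distrib sum_nonneg)
  qed
  then have "(\<Sum>c\<in>Basis. (H u c)\<^sup>2) \<le> (\<Sum>c\<in>Basis. (norm u)\<^sup>2 * (\<Sum>b\<in>Basis. (H b c)\<^sup>2))"
    by (intro sum_mono)
  also have "\<dots> = (norm u)\<^sup>2 * (\<Sum>b\<in>Basis. \<Sum>c\<in>Basis. (H b c)\<^sup>2)"
    by (subst sum.swap) (simp add: sum_distrib_left)
  finally have "sqrt (\<Sum>c\<in>Basis. (H u c)\<^sup>2) \<le> norm u * sqrt (\<Sum>b\<in>Basis. \<Sum>c\<in>Basis. (H b c)\<^sup>2)"
    by (metis real_sqrt_le_mono real_sqrt_mult real_sqrt_abs abs_norm_cancel)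
  then have "norm w * sqrt (\<Sum>c\<in>Basis. (H u c)\<^sup>2) \<le> norm w * (norm u * sqrt (\<Sum>b\<in>Basis. \<Sum>c\<in>Basis. (H b c)\<^sup>2))"
    by (rule mult_left_mono) simp
  then show ?thesis using linear_functional_bound[OF l1, of u w] by (simp add: mult_ac)
qed

text \<open>The first is the integrand of the \<open>H\<^sup>2\<close> norm. The second, for \<open>f = hom_ext z\<close>, is comparable to it and
  involves no frame; it behaves well under composition with linear maps.\<close>

definition H2_density :: "(real ^ 'n \<Rightarrow> real) \<Rightarrow> real ^ 'n \<Rightarrow> real" where
  "H2_density z \<theta> = (z \<theta>)\<^sup>2 + (\<Sum>i<CARD('n) - 1. (sphere_grad z \<theta> i)\<^sup>2)
     + (\<Sum>i<CARD('n) - 1. \<Sum>j<CARD('n) - 1. (sphere_hess z \<theta> i j)\<^sup>2)"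

definition euclidean_jet :: "(real ^ 'n \<Rightarrow> real) \<Rightarrow> real ^ 'n \<Rightarrow> real" where
  "euclidean_jet f x = (\<Sum>b\<in>Basis. (frechet_derivative f (at x) b)\<^sup>2)
     + (\<Sum>b\<in>Basis. \<Sum>c\<in>Basis. (hess f x b c)\<^sup>2)"

lemma H2_norm_eq: "H2_norm z = sqrt (\<integral>\<theta>. H2_density z \<theta> \<partial>sphere_measure)"
  by (simp add: H2_norm_def H2_density_def)

lemma H2_density_nonneg: "H2_density z \<theta> \<ge> 0"
  unfolding H2_density_def by (intro add_nonneg_nonneg sum_nonneg) auto

lemma euclidean_jet_nonneg: "euclidean_jet f x \<ge> 0"
  unfolding euclidean_jet_def by (intro add_nonneg_nonneg sum_nonneg) auto

context
  fixes z :: "real ^ 'n \<Rightarrow> real" and \<theta> :: "real ^ 'n"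
  assumes z: "C2_sphere z" and \<theta>: "norm \<theta> = 1"
begin

lemma sum_frechet_hom_ext_squares:
  "(\<Sum>b\<in>Basis. (frechet_derivative (hom_ext z) (at \<theta>) b)\<^sup>2) =
     (z \<theta>)\<^sup>2 + (\<Sum>i<CARD('n) - 1. (sphere_grad z \<theta> i)\<^sup>2)"
proof -
  have nz: "\<theta> \<noteq> 0" using \<theta> by auto
  have "linear (frechet_derivative (hom_ext z) (at \<theta>))"
    by (rule C2_on_linear_frechet[OF z[unfolded C2_sphere_def]]) (use nz in simp)
  from tangent_frame_sum_squares[OF \<theta> this] show ?thesis
    using euler_identity[OF z[unfolded C2_sphere_def] pos_homogeneous_hom_ext nz]
    by (simp add: sphere_grad_def hom_ext_sphere[OF \<theta>])
qed

lemma sum_hess_hom_ext_squares: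
  "(\<Sum>b\<in>Basis. \<Sum>c\<in>Basis. (hess (hom_ext z) \<theta> b c)\<^sup>2) =
     (\<Sum>i<CARD('n) - 1. \<Sum>j<CARD('n) - 1. (D2 z \<theta> i j)\<^sup>2)"
proof -
  have nz: "\<theta> \<noteq> 0" using \<theta> by auto
  show ?thesis
    unfolding D2_def by (rule bilinear_frame_sum_squares[OF \<theta> hess_hom_ext[OF z nz]])
qed

lemma trace_hess_hom_ext:
  "(\<Sum>b\<in>Basis. hess (hom_ext z) \<theta> b b) = (\<Sum>i<CARD('n) - 1. D2 z \<theta> i i)"
proof -
  let ?H = "hess (hom_ext z) \<theta>" and ?e = "tangent_frame \<theta>"
  have nz: "\<theta> \<noteq> 0" using \<theta> by auto
  have l1: "linear (?H u)" and l2: "linear (\<lambda>u. ?H u v)" for u v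
    using bilinear_hess_hom_ext[OF z nz] by (auto simp: bilinear_def)
  have "(\<Sum>b\<in>Basis. ?H b b) = (\<Sum>b\<in>Basis. ?H b ((\<theta> \<bullet> b) *\<^sub>R \<theta> + (\<Sum>i<CARD('n) - 1. (?e i \<bullet> b) *\<^sub>R ?e i)))"
    by (intro sum.cong refl arg_cong[where f="?H _"] tangent_frame_expansion[OF \<theta>])
  also have "\<dots> = (\<Sum>b\<in>Basis. \<Sum>i<CARD('n) - 1. (?e i \<bullet> b) * ?H b (?e i))"
    by (simp add: linear_add[OF l1] linear_scale[OF l1] linear_sum[OF l1] hess_hom_ext_radial_right[OF z nz])
  also have "\<dots> = (\<Sum>i<CARD('n) - 1. \<Sum>b\<in>Basis. (?e i \<bullet> b) * ?H b (?e i))"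
    by (rule sum.swap)
  also have "\<dots> = (\<Sum>i<CARD('n) - 1. ?H (\<Sum>b\<in>Basis. (?e i \<bullet> b) *\<^sub>R b) (?e i))"
    by (simp add: linear_sum[OF l2] linear_scale[OF l2])
  also have "\<dots> = (\<Sum>i<CARD('n) - 1. D2 z \<theta> i i)"
    by (simp add: euclidean_representation D2_def)
  finally show ?thesis .
qed

text \<open>All terms are expressed without frames, whence the integrand of the \<open>H\<^sup>2\<close> norm is continuous. In
  particular it is integrable, and the \<open>H\<^sup>2\<close> norm of a \<open>C\<^sup>2\<close> function is a genuine integral rather than the
  default value 0.\<close>

lemma H2_density_eq:
  "H2_density z \<theta> = euclidean_jet (hom_ext z) \<theta>
     - 2 * hom_ext z \<theta> * (\<Sum>b\<in>Basis. hess (hom_ext z) \<theta> b b) + real (CARD('n) - 1) * (hom_ext z \<theta>)\<^sup>2"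
proof -
  have inner: "(\<Sum>j<CARD('n) - 1. (sphere_hess z \<theta> i j)\<^sup>2) =
      (\<Sum>j<CARD('n) - 1. (D2 z \<theta> i j)\<^sup>2) - 2 * z \<theta> * D2 z \<theta> i i + (z \<theta>)\<^sup>2" if i: "i < CARD('n) - 1" for i
  proof -
    have "(\<Sum>j<CARD('n) - 1. (sphere_hess z \<theta> i j)\<^sup>2) =
        (\<Sum>j<CARD('n) - 1. (D2 z \<theta> i j)\<^sup>2 + (if i = j then (z \<theta>)\<^sup>2 - 2 * z \<theta> * D2 z \<theta> i i else 0))"
      by (intro sum.cong refl) (auto simp: sphere_hess_def power2_diff)
    also have "\<dots> = (\<Sum>j<CARD('n) - 1. (D2 z \<theta> i j)\<^sup>2) + ((z \<theta>)\<^sup>2 - 2 * z \<theta> * D2 z \<theta> i i)"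
      using i by (simp only: sum.distrib) (simp add: sum.delta)
    finally show ?thesis by simp
  qed
  have "(\<Sum>i<CARD('n) - 1. \<Sum>j<CARD('n) - 1. (sphere_hess z \<theta> i j)\<^sup>2) =
      (\<Sum>i<CARD('n) - 1. (\<Sum>j<CARD('n) - 1. (D2 z \<theta> i j)\<^sup>2) - 2 * z \<theta> * D2 z \<theta> i i + (z \<theta>)\<^sup>2)"
    by (intro sum.cong refl) (simp only: inner lessThan_iff)
  also have "\<dots> = (\<Sum>i<CARD('n) - 1. \<Sum>j<CARD('n) - 1. (D2 z \<theta> i j)\<^sup>2)
      - 2 * z \<theta> * (\<Sum>i<CARD('n) - 1. D2 z \<theta> i i) + real (CARD('n) - 1) * (z \<theta>)\<^sup>2"
    by (simp only: sum.distrib sum_subtractf sum_distrib_left sum_constant card_lessThan)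
  finally show ?thesis
    unfolding H2_density_def euclidean_jet_def sum_frechet_hom_ext_squares sum_hess_hom_ext_squares
      trace_hess_hom_ext hom_ext_sphere[OF \<theta>] by simp
qed

text \<open>The two Hessians differ by \<open>z \<delta>\<close>, whose square sum is \<open>(n - 1) z\<^sup>2\<close>, and
  \<open>(a - b)\<^sup>2 \<le> 2 a\<^sup>2 + 2 b\<^sup>2\<close>.\<close>

lemma H2_density_le_euclidean_jet: "H2_density z \<theta> \<le> 2 * real CARD('n) * euclidean_jet (hom_ext z) \<theta>"
  and euclidean_jet_le_H2_density: "euclidean_jet (hom_ext z) \<theta> \<le> 2 * real CARD('n) * H2_density z \<theta>"
proof -
  let ?m = "CARD('n) - 1" and ?n = "real CARD('n)"
  let ?Z = "(z \<theta>)\<^sup>2" and ?G = "\<Sum>i<?m. (sphere_grad z \<theta> i)\<^sup>2"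
  let ?S = "\<Sum>i<?m. \<Sum>j<?m. (sphere_hess z \<theta> i j)\<^sup>2" and ?D = "\<Sum>i<?m. \<Sum>j<?m. (D2 z \<theta> i j)\<^sup>2"
  have n: "real ?m = ?n - 1" "?n \<ge> 1" by (simp_all add: of_nat_diff)
  have sq: "(a - b)\<^sup>2 \<le> 2 * a\<^sup>2 + 2 * b\<^sup>2" for a b :: real
    using zero_le_power2[of "a + b"] by (simp add: power2_sum power2_diff)
  have dd: "(\<Sum>i<?m. \<Sum>j<?m. (if i = j then z \<theta> else 0)\<^sup>2) = real ?m * ?Z"
    by (simp add: if_distrib[of "\<lambda>x. x\<^sup>2"] sum.delta cong: if_cong)
  have "?S \<le> (\<Sum>i<?m. \<Sum>j<?m. 2 * (D2 z \<theta> i j)\<^sup>2 + 2 * (if i = j then z \<theta> else 0)\<^sup>2)"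
    unfolding sphere_hess_def by (intro sum_mono sq)
  also have "\<dots> = 2 * ?D + 2 * (\<Sum>i<?m. \<Sum>j<?m. (if i = j then z \<theta> else 0)\<^sup>2)"
    by (simp only: sum.distrib sum_distrib_left)
  finally have S: "?S \<le> 2 * ?D + 2 * (real ?m * ?Z)" unfolding dd .
  have "?D = (\<Sum>i<?m. \<Sum>j<?m. (sphere_hess z \<theta> i j - - (if i = j then z \<theta> else 0))\<^sup>2)"
    by (simp add: sphere_hess_def)
  also have "\<dots> \<le> (\<Sum>i<?m. \<Sum>j<?m. 2 * (sphere_hess z \<theta> i j)\<^sup>2 + 2 * (- (if i = j then z \<theta> else 0))\<^sup>2)"
    by (intro sum_mono sq)
  also have "\<dots> = 2 * ?S + 2 * (\<Sum>i<?m. \<Sum>j<?m. (if i = j then z \<theta> else 0)\<^sup>2)"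
    by (simp only: sum.distrib sum_distrib_left power2_minus)
  finally have D: "?D \<le> 2 * ?S + 2 * (real ?m * ?Z)" unfolding dd .
  have nn: "?G \<ge> 0" "?S \<ge> 0" "?D \<ge> 0" "?Z \<ge> 0" by (auto intro!: sum_nonneg)
  have J: "euclidean_jet (hom_ext z) \<theta> = ?Z + ?G + ?D"
    unfolding euclidean_jet_def sum_frechet_hom_ext_squares sum_hess_hom_ext_squares ..
  have arith: "Z + G + S \<le> 2 * N * (Z + G + D)"
    if "S \<le> 2 * D + 2 * ((N - 1) * Z)" "N \<ge> 1" "G \<ge> 0" "D \<ge> 0" "Z \<ge> 0" for Z G S D N :: real
  proof -
    have "G \<le> N * G" "D \<le> N * D" "0 \<le> N * G" using that by (simp_all add: mult_le_cancel_right1)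
    with that show ?thesis by (simp add: algebra_simps)
  qed
  show "H2_density z \<theta> \<le> 2 * ?n * euclidean_jet (hom_ext z) \<theta>"
    unfolding J H2_density_def by (rule arith[OF S[unfolded n(1)] n(2) nn(1,3,4)])
  show "euclidean_jet (hom_ext z) \<theta> \<le> 2 * ?n * H2_density z \<theta>"
    unfolding J H2_density_def by (rule arith[OF D[unfolded n(1)] n(2) nn(1,2,4)])
qed

end

lemma continuous_on_H2_density:
  fixes z :: "real ^ 'n \<Rightarrow> real"
  assumes z: "C2_sphere z"
  shows "continuous_on (sphere 0 1) (H2_density z)"
proof -
  note z' = z[unfolded C2_sphere_def]
  have sub: "sphere 0 1 \<subseteq> - {0 :: real ^ 'n}" by auto
  note c = continuous_on_subset[OF C2_on_continuous[OF z'] sub]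
    continuous_on_subset[OF C2_on_frechet_continuous[OF z'] sub]
    continuous_on_subset[OF C2_on_hess_continuous[OF z'] sub]
  have "continuous_on (sphere 0 1) (\<lambda>\<theta>. euclidean_jet (hom_ext z) \<theta>
     - 2 * hom_ext z \<theta> * (\<Sum>b\<in>Basis. hess (hom_ext z) \<theta> b b) + real (CARD('n) - 1) * (hom_ext z \<theta>)\<^sup>2)"
    unfolding euclidean_jet_def by (intro continuous_intros c)
  then show ?thesis
    by (rule continuous_on_eq) (simp add: H2_density_eq[OF z])
qed

text \<open>By \<open>F = \<rho> (f \<circ> A)\<close> with the smooth function \<open>\<rho> x = |x| / |A x|\<close>, the first two derivatives of
  \<open>F\<close> at \<open>\<theta>\<close> are combinations of those of \<open>f\<close> at \<open>A \<theta> / |A \<theta>|\<close>, with bounded coefficients.\<close>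

lemma euclidean_jet_push0_le:
  fixes T :: "real ^ 'n ^ 'n"
  assumes T: "invertible T"
  obtains C where "C \<ge> 0" "\<And>z \<theta>. C2_sphere z \<Longrightarrow> norm \<theta> = 1 \<Longrightarrow>
    euclidean_jet (hom_ext (push0 T z)) \<theta> \<le> C * euclidean_jet (hom_ext z) (sphere_map (transpose T) \<theta>)"
proof -
  let ?A = "transpose T"
  note A = invertible_transpose[OF T]
  define \<rho> where "\<rho> x = norm x * inverse (norm (?A *v x))" for x
  have \<rho>: "C2_on (- {0}) \<rho>" unfolding \<rho>_def by (rule C2_on_norm_ratio[OF A])
  let ?k = "\<lambda>\<theta>. (\<Sum>b\<in>Basis. \<bar>frechet_derivative \<rho> (at \<theta>) b\<bar>) + (\<Sum>b\<in>Basis. \<Sum>c\<in>Basis. \<bar>hess \<rho> \<theta> b c\<bar>)"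
  have sub: "sphere 0 1 \<subseteq> - {0 :: real ^ 'n}" by auto
  have "continuous_on (sphere 0 1) ?k"
    by (intro continuous_intros continuous_on_subset[OF C2_on_frechet_continuous[OF \<rho>] sub]
        continuous_on_subset[OF C2_on_hess_continuous[OF \<rho>] sub])
  then have "compact (?k ` sphere 0 1)" by (rule compact_continuous_image) simp
  then obtain R where R: "\<And>\<theta>. \<theta> \<in> sphere 0 1 \<Longrightarrow> norm (?k \<theta>) \<le> R"
    using compact_imp_bounded[of "?k ` sphere 0 1"] unfolding bounded_iff by blast
  have R1: "\<bar>frechet_derivative \<rho> (at \<theta>) b\<bar> \<le> R" and R2: "\<bar>hess \<rho> \<theta> b c\<bar> \<le> R"
    if "norm \<theta> = 1" and b: "b \<in> Basis" and c: "c \<in> Basis" for \<theta> b c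
  proof -
    have k: "?k \<theta> \<le> R" using R[of \<theta>] that(1) by simp
    have 1: "\<bar>frechet_derivative \<rho> (at \<theta>) b\<bar> \<le> (\<Sum>b\<in>Basis. \<bar>frechet_derivative \<rho> (at \<theta>) b\<bar>)"
      by (rule member_le_sum[OF b]) auto
    have "\<bar>hess \<rho> \<theta> b c\<bar> \<le> (\<Sum>c\<in>Basis. \<bar>hess \<rho> \<theta> b c\<bar>)"
      by (rule member_le_sum[OF c]) auto
    also have "\<dots> \<le> (\<Sum>b\<in>Basis. \<Sum>c\<in>Basis. \<bar>hess \<rho> \<theta> b c\<bar>)"
      by (rule member_le_sum[OF b]) (auto intro: sum_nonneg)
    finally have 2: "\<bar>hess \<rho> \<theta> b c\<bar> \<le> (\<Sum>b\<in>Basis. \<Sum>c\<in>Basis. \<bar>hess \<rho> \<theta> b c\<bar>)" .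
    have "0 \<le> (\<Sum>b\<in>Basis. \<Sum>c\<in>Basis. \<bar>hess \<rho> \<theta> b c\<bar>)" "0 \<le> (\<Sum>b\<in>Basis. \<bar>frechet_derivative \<rho> (at \<theta>) b\<bar>)"
      by (auto intro!: sum_nonneg)
    then show "\<bar>frechet_derivative \<rho> (at \<theta>) b\<bar> \<le> R" "\<bar>hess \<rho> \<theta> b c\<bar> \<le> R"
      using 1 2 k by linarith+
  qed
  have R0: "R \<ge> 0"
  proof -
    obtain b :: "real ^ 'n" where "b \<in> Basis" using nonempty_Basis by blast
    then have "norm (?k b) \<le> R" by (intro R) simp
    then show ?thesis using norm_ge_zero order_trans by blast
  qed
  obtain B where B: "B > 0" "\<And>x. norm (?A *v x) \<le> B * norm x"
    using linear_bounded_pos[of "(*v) ?A"] by auto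
  have injA: "inj ((*v) ?A)"
    by (subst linear_injective_0) (simp_all add: invertible_mult_eq_0[OF A] del: transpose_matrix_vector)
  obtain \<beta> where \<beta>: "\<beta> > 0" "\<And>x. \<beta> * norm x \<le> norm (?A *v x)"
    using linear_inj_bounded_below_pos[OF matrix_vector_mul_linear injA] by blast
  \<comment> \<open>By the product rule each first and second derivative of \<open>F\<close> is bounded by \<open>M\<close> times the square root of
    the jet of \<open>f\<close>: the first two terms come from \<open>F'\<close>, the others from \<open>F''\<close>.\<close>
  define M where "M = B / \<beta> + R * B + (B\<^sup>2 / \<beta>\<^sup>2 + 3 * R * B)"
  let ?C = "(real CARD('n) + (real CARD('n))\<^sup>2) * M\<^sup>2"
  have "euclidean_jet (hom_ext (push0 T z)) \<theta> \<le> ?C * euclidean_jet (hom_ext z) (sphere_map ?A \<theta>)"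
    if z: "C2_sphere z" and \<theta>: "norm \<theta> = 1" for z \<theta>
  proof -
    let ?f = "hom_ext z" and ?y = "sphere_map ?A \<theta>" and ?r = "norm (?A *v \<theta>)"
    note f = z[unfolded C2_sphere_def]
    let ?s = "sqrt (euclidean_jet ?f ?y)"
    have \<theta>0: "\<theta> \<noteq> 0" and \<theta>0': "\<theta> \<in> - {0}" using \<theta> by auto
    have nz: "?A *v \<theta> \<noteq> 0" using \<theta>0 invertible_mult_eq_0[OF A] by simp
    have r: "?r > 0" "?r \<le> B" "\<beta> \<le> ?r" using nz B(2)[of \<theta>] \<beta>(2)[of \<theta>] \<theta> by auto
    have y: "norm ?y = 1" by (rule norm_sphere_map[OF nz])
    then have y0: "?y \<noteq> 0" by auto
    have Ay: "?A *v \<theta> = ?r *\<^sub>R ?y" using nz by (simp add: sphere_map_def del: transpose_matrix_vector)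
    have s0: "?s \<ge> 0" by (simp add: euclidean_jet_nonneg)
    have linf: "linear (frechet_derivative ?f (at ?y))"
      by (rule C2_on_linear_frechet[OF f]) (use y0 in simp)
    have s1: "\<bar>frechet_derivative ?f (at ?y) w\<bar> \<le> norm w * ?s" for w
      using linear_functional_bound[OF linf, of w]
      by (rule order_trans) (auto intro!: mult_left_mono sum_nonneg simp: euclidean_jet_def)
    have s2: "\<bar>hess ?f ?y u w\<bar> \<le> norm u * norm w * ?s" for u w
      using bilinear_form_bound[OF bilinear_hess_hom_ext[OF z y0], of u w]
      by (rule order_trans) (auto intro!: mult_left_mono sum_nonneg simp: euclidean_jet_def)
    have s3: "\<bar>?f ?y\<bar> \<le> ?s"
      using s1[of ?y] y euler_identity[OF f pos_homogeneous_hom_ext y0] by simp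
    have fA: "?f (?A *v \<theta>) = ?r * ?f ?y"
      by (subst Ay) (use r(1) pos_homogeneous_hom_ext[of z] in \<open>simp add: pos_homogeneous_def del: transpose_matrix_vector\<close>)
    have fA': "frechet_derivative ?f (at (?A *v \<theta>)) w = frechet_derivative ?f (at ?y) w" for w
      by (subst Ay) (rule frechet_pos_homogeneous_scale[OF f pos_homogeneous_hom_ext r(1) y0])
    have fA'': "hess ?f (?A *v \<theta>) u w = hess ?f ?y u w / ?r" for u w
      by (subst Ay) (rule hess_pos_homogeneous_scale[OF f pos_homogeneous_hom_ext r(1) y0])
    let ?g = "\<lambda>x. ?f (?A *v x)"
    have g: "C2_on (- {0}) ?g" by (rule C2_on_comp_matrix[OF A f])
    have AU: "?A *v x \<in> - {0}" if "x \<in> - {0}" for x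
      using that invertible_mult_eq_0[OF A, of x] by simp
    have g': "frechet_derivative ?g (at \<theta>) u = frechet_derivative ?f (at ?y) (?A *v u)" for u
      using C2_on_linear_comp_frechet[OF open_minus_zero matrix_vector_mul_linear f AU \<theta>0'] by (simp only: fA')
    have g'': "hess ?g \<theta> u v = hess ?f ?y (?A *v u) (?A *v v) / ?r" for u v
      using C2_on_linear_comp_hess[OF open_minus_zero matrix_vector_mul_linear f AU \<theta>0', of u v] by (simp only: fA'')
    have F: "hom_ext (push0 T z) x = \<rho> x * ?g x" if "x \<in> - {0}" for x
      using hom_ext_push0[OF T, of x z] that by (simp add: \<rho>_def)
    note FC = C2_on_cong[OF open_minus_zero C2_on_mult_C2[OF open_minus_zero \<rho> g] F]
    have \<rho>\<theta>: "\<rho> \<theta> = inverse ?r" using \<theta> by (simp add: \<rho>_def)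
    have F': "frechet_derivative (hom_ext (push0 T z)) (at \<theta>) b =
        inverse ?r * frechet_derivative ?f (at ?y) (?A *v b) + frechet_derivative \<rho> (at \<theta>) b * (?r * ?f ?y)" for b
      using FC(2)[OF _ \<theta>0'] C2_on_mult_frechet[OF open_minus_zero \<rho> g \<theta>0'] by (simp only: g' \<rho>\<theta> fA)
    have F'': "hess (hom_ext (push0 T z)) \<theta> b c =
        inverse ?r * (hess ?f ?y (?A *v b) (?A *v c) / ?r)
        + frechet_derivative \<rho> (at \<theta>) c * frechet_derivative ?f (at ?y) (?A *v b)
        + (frechet_derivative \<rho> (at \<theta>) b * frechet_derivative ?f (at ?y) (?A *v c) + hess \<rho> \<theta> b c * (?r * ?f ?y))" for b c
      using FC(3)[OF _ \<theta>0', of b c] C2_on_mult_hess[OF open_minus_zero \<rho> g \<theta>0', of b c] by (simp only: g' g'' \<rho>\<theta> fA)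
    have ir: "inverse ?r \<le> inverse \<beta>" "0 \<le> inverse ?r" "0 \<le> \<beta>" using r \<beta>(1) by (auto intro: le_imp_inverse_le)
    have b1: "\<bar>frechet_derivative ?f (at ?y) (?A *v b)\<bar> \<le> B * ?s" if "b \<in> Basis" for b
    proof -
      have "norm (?A *v b) \<le> B" using B(2)[of b] norm_Basis[OF that] by (simp only: mult_1_right)
      from mult_right_mono[OF this s0] s1[of "?A *v b"] show ?thesis by (rule order_trans[rotated])
    qed
    have b2: "\<bar>hess ?f ?y (?A *v b) (?A *v c)\<bar> \<le> B * B * ?s" if "b \<in> Basis" "c \<in> Basis" for b c
    proof -
      have "norm (?A *v b) * norm (?A *v c) \<le> B * B"
        using B(2)[of b] B(2)[of c] B(1) that by (intro mult_mono) auto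
      from mult_right_mono[OF this s0] s2[of "?A *v b" "?A *v c"] show ?thesis by linarith
    qed
    have b3: "\<bar>?r * ?f ?y\<bar> \<le> B * ?s"
      unfolding abs_mult using r s3 B(1) by (intro mult_mono) auto
    have F1: "\<bar>frechet_derivative (hom_ext (push0 T z)) (at \<theta>) b\<bar> \<le> M * ?s" if b: "b \<in> Basis" for b
    proof -
      have "\<bar>inverse ?r * frechet_derivative ?f (at ?y) (?A *v b)\<bar> \<le> inverse \<beta> * (B * ?s)"
        unfolding abs_mult using ir b1[OF b] by (intro mult_mono) auto
      moreover have "\<bar>frechet_derivative \<rho> (at \<theta>) b * (?r * ?f ?y)\<bar> \<le> R * (B * ?s)"
        unfolding abs_mult[of "frechet_derivative \<rho> (at \<theta>) b"] using R1[OF \<theta> b b] b3 R0 by (intro mult_mono) auto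
      ultimately have "\<bar>frechet_derivative (hom_ext (push0 T z)) (at \<theta>) b\<bar> \<le> inverse \<beta> * (B * ?s) + R * (B * ?s)"
        unfolding F' by linarith
      also have "\<dots> = (B / \<beta> + R * B) * ?s" by (simp add: divide_inverse algebra_simps)
      also have "\<dots> \<le> M * ?s"
        using B(1) \<beta>(1) R0 by (intro mult_right_mono s0) (simp add: M_def)
      finally show ?thesis .
    qed
    have F2: "\<bar>hess (hom_ext (push0 T z)) \<theta> b c\<bar> \<le> M * ?s" if b: "b \<in> Basis" and c: "c \<in> Basis" for b c
    proof -
      have "\<bar>inverse ?r * (hess ?f ?y (?A *v b) (?A *v c) / ?r)\<bar> = inverse ?r * (inverse ?r * \<bar>hess ?f ?y (?A *v b) (?A *v c)\<bar>)"
        using r(1) by (simp add: abs_mult divide_inverse)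
      also have "\<dots> \<le> inverse \<beta> * (inverse \<beta> * (B * B * ?s))"
        using ir b2[OF b c] by (intro mult_mono mult_nonneg_nonneg) auto
      finally have 1: "\<bar>inverse ?r * (hess ?f ?y (?A *v b) (?A *v c) / ?r)\<bar> \<le> inverse \<beta> * (inverse \<beta> * (B * B * ?s))" .
      have 2: "\<bar>frechet_derivative \<rho> (at \<theta>) c * frechet_derivative ?f (at ?y) (?A *v b)\<bar> \<le> R * (B * ?s)"
        unfolding abs_mult using R1[OF \<theta> c c] b1[OF b] R0 by (intro mult_mono) auto
      have 3: "\<bar>frechet_derivative \<rho> (at \<theta>) b * frechet_derivative ?f (at ?y) (?A *v c)\<bar> \<le> R * (B * ?s)"
        unfolding abs_mult using R1[OF \<theta> b b] b1[OF c] R0 by (intro mult_mono) auto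
      have 4: "\<bar>hess \<rho> \<theta> b c * (?r * ?f ?y)\<bar> \<le> R * (B * ?s)"
        unfolding abs_mult[of "hess \<rho> \<theta> b c"] using R2[OF \<theta> b c] b3 R0 by (intro mult_mono) auto
      have "\<bar>hess (hom_ext (push0 T z)) \<theta> b c\<bar> \<le> inverse \<beta> * (inverse \<beta> * (B * B * ?s)) + R * (B * ?s) + (R * (B * ?s) + R * (B * ?s))"
        unfolding F'' using 1 2 3 4 by linarith
      also have "\<dots> = (B\<^sup>2 / \<beta>\<^sup>2 + 3 * R * B) * ?s" by (simp add: divide_inverse algebra_simps power2_eq_square)
      also have "\<dots> \<le> M * ?s"
        using B(1) \<beta>(1) R0 by (intro mult_right_mono s0) (simp add: M_def)
      finally show ?thesis .
    qed
    have sq: "a\<^sup>2 \<le> M\<^sup>2 * euclidean_jet ?f ?y" if "\<bar>a\<bar> \<le> M * ?s" for a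
    proof -
      have "\<bar>a\<bar>\<^sup>2 \<le> (M * ?s)\<^sup>2" by (rule power_mono[OF that]) simp
      then show ?thesis by (simp add: power_mult_distrib euclidean_jet_nonneg)
    qed
    have "euclidean_jet (hom_ext (push0 T z)) \<theta> \<le>
        (\<Sum>b\<in>(Basis :: (real ^ 'n) set). M\<^sup>2 * euclidean_jet ?f ?y) +
        (\<Sum>b\<in>(Basis :: (real ^ 'n) set). \<Sum>c\<in>(Basis :: (real ^ 'n) set). M\<^sup>2 * euclidean_jet ?f ?y)"
      unfolding euclidean_jet_def[of "hom_ext (push0 T z)"] by (intro add_mono sum_mono sq F1 F2)
    also have "\<dots> = ?C * euclidean_jet ?f ?y"
      by (simp add: algebra_simps power2_eq_square)
    finally show ?thesis .
  qed
  moreover have "?C \<ge> 0" by simp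
  ultimately show thesis using that by blast
qed

lemma push0_eq_sphere_map: "push0 T z = (\<lambda>\<theta>. z (sphere_map (transpose T) \<theta>))"
  by (simp add: push0_def sphere_map_def fun_eq_iff)

lemma sphere_map_space:
  fixes A :: "real ^ 'n ^ 'n"
  assumes "invertible A" "norm \<theta> = 1"
  shows "norm (sphere_map A \<theta>) = 1"
  by (rule norm_sphere_map) (use assms invertible_mult_eq_0[OF assms(1), of \<theta>] in auto)

lemma sphere_map_integral_le:
  fixes A :: "real ^ 'n ^ 'n"
  assumes A: "invertible A"
  obtains C where "C > 0" "\<And>g :: real ^ 'n \<Rightarrow> real. integrable sphere_measure g \<Longrightarrow> (\<forall>\<theta>. 0 \<le> g \<theta>) \<Longrightarrow>
    integrable sphere_measure (\<lambda>\<theta>. g (sphere_map A \<theta>)) \<and>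
    (\<integral>\<theta>. g (sphere_map A \<theta>) \<partial>sphere_measure) \<le> C * (\<integral>\<theta>. g \<theta> \<partial>sphere_measure)"
proof -
  obtain C where C: "C > 0" "\<And>f :: real ^ 'n \<Rightarrow> ennreal. f \<in> borel_measurable sphere_measure \<Longrightarrow>
    (\<integral>\<^sup>+\<theta>. f (sphere_map A \<theta>) \<partial>sphere_measure) \<le> ennreal C * (\<integral>\<^sup>+\<theta>. f \<theta> \<partial>sphere_measure)"
    by (rule nn_integral_sphere_map_le[OF A]) (rule that, assumption+)
  have "integrable sphere_measure (\<lambda>\<theta>. g (sphere_map A \<theta>)) \<and>
    (\<integral>\<theta>. g (sphere_map A \<theta>) \<partial>sphere_measure) \<le> C * (\<integral>\<theta>. g \<theta> \<partial>sphere_measure)"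
    if g: "integrable sphere_measure g" and nn: "\<forall>\<theta>. 0 \<le> g \<theta>" for g :: "real ^ 'n \<Rightarrow> real"
  proof -
    have gm: "g \<in> borel_measurable sphere_measure" using g by (rule borel_measurable_integrable)
    have gm': "(\<lambda>\<theta>. g (sphere_map A \<theta>)) \<in> borel_measurable sphere_measure"
      by (rule measurable_compose[OF measurable_sphere_map[OF A] gm])
    have "(\<integral>\<^sup>+\<theta>. ennreal (g (sphere_map A \<theta>)) \<partial>sphere_measure) \<le> ennreal C * (\<integral>\<^sup>+\<theta>. ennreal (g \<theta>) \<partial>sphere_measure)"
      by (rule C(2)) (use gm in measurable)
    also have "(\<integral>\<^sup>+\<theta>. ennreal (g \<theta>) \<partial>sphere_measure) = ennreal (\<integral>\<theta>. g \<theta> \<partial>sphere_measure)"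
      by (rule nn_integral_eq_integral[OF g]) (simp add: nn)
    also have "ennreal C * \<dots> = ennreal (C * (\<integral>\<theta>. g \<theta> \<partial>sphere_measure))"
      using C(1) by (simp add: ennreal_mult')
    finally have le: "(\<integral>\<^sup>+\<theta>. ennreal (g (sphere_map A \<theta>)) \<partial>sphere_measure) \<le> ennreal (C * (\<integral>\<theta>. g \<theta> \<partial>sphere_measure))" .
    then have int: "integrable sphere_measure (\<lambda>\<theta>. g (sphere_map A \<theta>))"
      by (intro integrableI_nonneg gm') (auto simp: nn intro: le_less_trans)
    have "(\<integral>\<^sup>+\<theta>. ennreal (g (sphere_map A \<theta>)) \<partial>sphere_measure) = ennreal (\<integral>\<theta>. g (sphere_map A \<theta>) \<partial>sphere_measure)"
      by (rule nn_integral_eq_integral[OF int]) (simp add: nn)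
    then have "(\<integral>\<theta>. g (sphere_map A \<theta>) \<partial>sphere_measure) \<le> C * (\<integral>\<theta>. g \<theta> \<partial>sphere_measure)"
      using le C(1) by (subst (asm) ennreal_le_iff2 | simp add: integral_nonneg nn)+
    with int show ?thesis by simp
  qed
  then show thesis using that C(1) by blast
qed

lemma H2_norm_push0_le:
  fixes T :: "real ^ 'n ^ 'n"
  assumes T: "invertible T"
  obtains C where "C > 0" "\<And>z. C2_sphere z \<Longrightarrow> H2_norm (push0 T z) \<le> C * H2_norm z"
proof -
  let ?A = "transpose T" and ?n = "2 * real CARD('n)"
  obtain C1 where C1: "C1 \<ge> 0" "\<And>z \<theta>. C2_sphere z \<Longrightarrow> norm \<theta> = 1 \<Longrightarrow>
    euclidean_jet (hom_ext (push0 T z)) \<theta> \<le> C1 * euclidean_jet (hom_ext z) (sphere_map ?A \<theta>)"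
    by (rule euclidean_jet_push0_le[OF T]) (rule that, assumption+)
  obtain C2 where C2: "C2 > 0" "\<And>g :: real ^ 'n \<Rightarrow> real. integrable sphere_measure g \<Longrightarrow> (\<forall>\<theta>. 0 \<le> g \<theta>) \<Longrightarrow>
    integrable sphere_measure (\<lambda>\<theta>. g (sphere_map ?A \<theta>)) \<and>
    (\<integral>\<theta>. g (sphere_map ?A \<theta>) \<partial>sphere_measure) \<le> C2 * (\<integral>\<theta>. g \<theta> \<partial>sphere_measure)"
    by (rule sphere_map_integral_le[OF invertible_transpose[OF T]]) (rule that, assumption+)
  let ?c = "?n * (C1 * ?n)"
  have c: "?c \<ge> 0" using C1(1) by simp
  have bound: "H2_norm (push0 T z) \<le> sqrt (?c * C2) * H2_norm z" if z: "C2_sphere z" for z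
  proof -
    have pw: "H2_density (push0 T z) \<theta> \<le> ?c * H2_density z (sphere_map ?A \<theta>)" if \<theta>: "norm \<theta> = 1" for \<theta>
    proof -
      have y: "norm (sphere_map ?A \<theta>) = 1" by (rule sphere_map_space[OF invertible_transpose[OF T] \<theta>])
      have "H2_density (push0 T z) \<theta> \<le> ?n * euclidean_jet (hom_ext (push0 T z)) \<theta>"
        by (rule H2_density_le_euclidean_jet[OF C2_sphere_push0[OF T z] \<theta>])
      also have "\<dots> \<le> ?n * (C1 * euclidean_jet (hom_ext z) (sphere_map ?A \<theta>))"
        by (intro mult_left_mono C1(2)[OF z \<theta>]) simp
      also have "\<dots> \<le> ?n * (C1 * (?n * H2_density z (sphere_map ?A \<theta>)))"
        by (intro mult_left_mono euclidean_jet_le_H2_density[OF z y] C1(1)) simp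
      finally show ?thesis by (simp only: mult.assoc)
    qed
    have I: "integrable sphere_measure (H2_density z)" "integrable sphere_measure (H2_density (push0 T z))"
      by (intro continuous_on_sphere_integrable continuous_on_H2_density z C2_sphere_push0[OF T z])+
    have nn: "\<forall>\<theta>. 0 \<le> H2_density z \<theta>" by (simp add: H2_density_nonneg)
    note I' = C2(2)[OF I(1) nn]
    have "(\<integral>\<theta>. H2_density (push0 T z) \<theta> \<partial>sphere_measure) \<le> (\<integral>\<theta>. ?c * H2_density z (sphere_map ?A \<theta>) \<partial>sphere_measure)"
      by (rule integral_mono) (use I I' pw in \<open>auto simp: space_sphere_measure\<close>)
    also have "\<dots> = ?c * (\<integral>\<theta>. H2_density z (sphere_map ?A \<theta>) \<partial>sphere_measure)" by simp
    also have "\<dots> \<le> ?c * (C2 * (\<integral>\<theta>. H2_density z \<theta> \<partial>sphere_measure))"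
      using I' c by (intro mult_left_mono) auto
    finally have "sqrt (\<integral>\<theta>. H2_density (push0 T z) \<theta> \<partial>sphere_measure) \<le> sqrt (?c * C2 * (\<integral>\<theta>. H2_density z \<theta> \<partial>sphere_measure))"
      by (simp only: real_sqrt_le_iff mult.assoc)
    then show ?thesis unfolding H2_norm_eq by (simp only: real_sqrt_mult)
  qed
  show thesis
  proof (rule that[of "sqrt (?c * C2) + 1"])
    show "sqrt (?c * C2) + 1 > 0" using c C2(1) by (intro add_nonneg_pos) auto
    fix z :: "real ^ 'n \<Rightarrow> real" assume z: "C2_sphere z"
    have "0 \<le> H2_norm z" unfolding H2_norm_eq by (simp add: H2_density_nonneg)
    then show "H2_norm (push0 T z) \<le> (sqrt (?c * C2) + 1) * H2_norm z"
      using bound[OF z] by (simp add: distrib_right)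
  qed
qed

lemma C2_sphere_L2:
  fixes z :: "real ^ 'n \<Rightarrow> real"
  assumes "C2_sphere z"
  shows "z \<in> L2 sphere_measure"
proof -
  have "continuous_on (sphere 0 1) (hom_ext z)"
    by (rule continuous_on_subset[OF C2_on_continuous[OF assms[unfolded C2_sphere_def]]]) auto
  then have c: "continuous_on (sphere 0 1) z"
    by (rule continuous_on_eq) (simp add: hom_ext_sphere)
  then have "continuous_on (sphere 0 1) (\<lambda>\<theta>. (z \<theta>)\<^sup>2)" by (intro continuous_intros)
  with c show ?thesis
    by (simp add: L2_def continuous_on_sphere_borel_measurable continuous_on_sphere_integrable)
qed

lemma push0_L2_sphere:
  fixes T :: "real ^ 'n ^ 'n"
  assumes T: "invertible T"
  obtains C where "C > 0" "\<And>z. z \<in> L2 sphere_measure \<Longrightarrow> push0 T z \<in> L2 sphere_measure"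
    "\<And>z. z \<in> L2 sphere_measure \<Longrightarrow> L2_norm sphere_measure (push0 T z) \<le> C * L2_norm sphere_measure z"
proof -
  let ?A = "transpose T"
  note A = invertible_transpose[OF T]
  obtain C where C: "C > 0" "\<And>g :: real ^ 'n \<Rightarrow> real. integrable sphere_measure g \<Longrightarrow> (\<forall>\<theta>. 0 \<le> g \<theta>) \<Longrightarrow>
    integrable sphere_measure (\<lambda>\<theta>. g (sphere_map ?A \<theta>)) \<and>
    (\<integral>\<theta>. g (sphere_map ?A \<theta>) \<partial>sphere_measure) \<le> C * (\<integral>\<theta>. g \<theta> \<partial>sphere_measure)"
    by (rule sphere_map_integral_le[OF A]) (rule that, assumption+)
  show thesis
  proof (rule that[of "sqrt C"])
    show "sqrt C > 0" using C(1) by simp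
    fix z :: "real ^ 'n \<Rightarrow> real" assume z: "z \<in> L2 sphere_measure"
    then have zm: "z \<in> borel_measurable sphere_measure" and zi: "integrable sphere_measure (\<lambda>\<theta>. (z \<theta>)\<^sup>2)"
      by (auto simp: L2_def)
    have nn: "\<forall>\<theta>. 0 \<le> (z \<theta>)\<^sup>2" by simp
    note I = C(2)[OF zi nn]
    show "push0 T z \<in> L2 sphere_measure"
      unfolding L2_def push0_eq_sphere_map
      using I measurable_compose[OF measurable_sphere_map[OF A] zm] by simp
    have "L2_norm sphere_measure (push0 T z) \<le> sqrt (C * (\<integral>\<theta>. (z \<theta>)\<^sup>2 \<partial>sphere_measure))"
      unfolding L2_norm_def L2_inner_def push0_eq_sphere_map using I by (simp add: power2_eq_square)
    also have "\<dots> = sqrt C * L2_norm sphere_measure z"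
      by (simp add: L2_norm_def L2_inner_def power2_eq_square real_sqrt_mult)
    finally show "L2_norm sphere_measure (push0 T z) \<le> sqrt C * L2_norm sphere_measure z" .
  qed
qed

lemma push0_diff: "push0 T (\<lambda>\<theta>. f \<theta> - g \<theta>) = (\<lambda>\<theta>. push0 T f \<theta> - push0 T g \<theta>)"
  by (simp add: push0_def fun_eq_iff)

text \<open>A sequence of \<open>C\<^sup>2\<close> functions which is Cauchy in \<open>H\<^sup>2\<close> and converges to \<open>z\<close> in \<open>L\<^sup>2\<close> is mapped to such a sequence
  for \<open>push0 T z\<close>, because \<open>push0 T\<close> is bounded in both norms.\<close>

theorem push0_H2_sphere:
  fixes T :: "real ^ 'n ^ 'n"
  assumes T: "invertible T" and z: "z \<in> H2_sphere"
  shows "push0 T z \<in> H2_sphere"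
proof -
  obtain C where C: "C > 0" "\<And>z. C2_sphere z \<Longrightarrow> H2_norm (push0 T z) \<le> C * H2_norm z"
    by (rule H2_norm_push0_le[OF T]) (rule that, assumption+)
  obtain D where D: "D > 0" "\<And>z. z \<in> L2 sphere_measure \<Longrightarrow> push0 T z \<in> L2 sphere_measure"
    "\<And>z. z \<in> L2 sphere_measure \<Longrightarrow> L2_norm sphere_measure (push0 T z) \<le> D * L2_norm sphere_measure z"
    by (rule push0_L2_sphere[OF T]) (rule that, assumption+)
  obtain s where zL: "z \<in> L2 sphere_measure" and s: "\<And>k. C2_sphere (s k)"
    "\<And>\<epsilon>. \<epsilon> > 0 \<Longrightarrow> \<exists>N::nat. \<forall>k\<ge>N. \<forall>l\<ge>N. H2_norm (\<lambda>\<theta>. s k \<theta> - s l \<theta>) < \<epsilon>"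
    "(\<lambda>k. L2_norm sphere_measure (\<lambda>\<theta>. s k \<theta> - z \<theta>)) \<longlonglongrightarrow> 0"
    using z unfolding H2_sphere_def by blast
  show ?thesis
    unfolding H2_sphere_def
  proof (intro CollectI conjI exI[of _ "\<lambda>k. push0 T (s k)"] allI impI)
    show "push0 T z \<in> L2 sphere_measure" by (rule D(2)[OF zL])
    show "C2_sphere (push0 T (s k))" for k by (rule C2_sphere_push0[OF T s(1)])
  next
    fix \<epsilon> :: real assume "\<epsilon> > 0"
    then have "\<epsilon> / C > 0" using C(1) by simp
    from s(2)[OF this] obtain N where N: "\<And>k l. k \<ge> N \<Longrightarrow> l \<ge> N \<Longrightarrow> H2_norm (\<lambda>\<theta>. s k \<theta> - s l \<theta>) < \<epsilon> / C" by blast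
    have "H2_norm (\<lambda>\<theta>. push0 T (s k) \<theta> - push0 T (s l) \<theta>) < \<epsilon>" if "k \<ge> N" "l \<ge> N" for k l
    proof -
      have "H2_norm (\<lambda>\<theta>. push0 T (s k) \<theta> - push0 T (s l) \<theta>) \<le> C * H2_norm (\<lambda>\<theta>. s k \<theta> - s l \<theta>)"
        unfolding push0_diff[symmetric] by (rule C(2)[OF C2_sphere_diff[OF s(1) s(1)]])
      also have "\<dots> < \<epsilon>" using N[OF that] C(1) by (simp add: pos_less_divide_eq mult.commute)
      finally show ?thesis .
    qed
    then show "\<exists>N. \<forall>k\<ge>N. \<forall>l\<ge>N. H2_norm (\<lambda>\<theta>. push0 T (s k) \<theta> - push0 T (s l) \<theta>) < \<epsilon>" by blast
  next
    have lim: "(\<lambda>k. D * L2_norm sphere_measure (\<lambda>\<theta>. s k \<theta> - z \<theta>)) \<longlonglongrightarrow> 0"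
      using tendsto_mult_right_zero[OF s(3)] .
    have "L2_norm sphere_measure (\<lambda>\<theta>. push0 T (s k) \<theta> - push0 T z \<theta>) \<le> D * L2_norm sphere_measure (\<lambda>\<theta>. s k \<theta> - z \<theta>)" for k
      unfolding push0_diff[symmetric] by (rule D(3)[OF L2_diff[OF C2_sphere_L2[OF s(1)] zL]])
    moreover have "0 \<le> L2_norm sphere_measure (\<lambda>\<theta>. push0 T (s k) \<theta> - push0 T z \<theta>)" for k
      by (simp add: L2_norm_def L2_inner_def)
    ultimately show "(\<lambda>k. L2_norm sphere_measure (\<lambda>\<theta>. push0 T (s k) \<theta> - push0 T z \<theta>)) \<longlonglongrightarrow> 0"
      by (intro tendsto_sandwich[OF _ _ tendsto_const lim] always_eventually allI)
  qed
qed

lemma H2_sphere_cong: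
  fixes z z' :: "real ^ 'n \<Rightarrow> real"
  assumes z: "z \<in> H2_sphere" and eq: "\<And>\<theta>. norm \<theta> = 1 \<Longrightarrow> z' \<theta> = z \<theta>"
  shows "z' \<in> H2_sphere"
proof -
  have "z' \<in> L2 sphere_measure \<longleftrightarrow> z \<in> L2 sphere_measure"
    by (rule L2_cong) (simp add: space_sphere_measure eq)
  moreover have "L2_norm sphere_measure (\<lambda>\<theta>. s \<theta> - z' \<theta>) = L2_norm sphere_measure (\<lambda>\<theta>. s \<theta> - z \<theta>)" for s
    by (rule L2_norm_cong) (simp add: space_sphere_measure eq)
  ultimately show ?thesis using z by (simp add: H2_sphere_def)
qed

section \<open>Transport of the cone measure and of the self-adjoint extension\<close>

lemma space_cone_measure: "space (cone_measure K) = sphere (0 :: real ^ 'n) 1"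
  by (simp add: cone_measure_def space_sphere_measure)

text \<open>The density of the cone measure picks up a factor \<open>|A \<theta>|\<close> from \<open>h\<^bsub>T K\<^esub>\<close> and a factor
  \<open>(det T)\<^sup>2 / |A \<theta>| ^ (n + 1)\<close> from the determinant. The product is \<open>|det T|\<close> times the Jacobian of the map
  \<open>\<theta> \<mapsto> A \<theta> / |A \<theta>|\<close>.\<close>

lemma scaled_measure_iso_cone_measure:
  fixes T S :: "real ^ 'n ^ 'n"
  assumes T: "invertible T" and TS: "T ** S = mat 1" "S ** T = mat 1"
    and K: "bounded K" "K \<noteq> {}" and C: "C2_sphere (support_fun K)"
  shows "scaled_measure_iso (cone_measure K) (cone_measure ((\<lambda>x. T *v x) ` K))
    (sphere_map (transpose T)) (sphere_map (transpose S)) \<bar>det T\<bar>"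
proof
  let ?A = "transpose T" and ?TK = "(\<lambda>x. T *v x) ` K" and ?m = "CARD('n) - 1"
  have S: "invertible S" using TS by (auto simp: invertible_def)
  note A = invertible_transpose[OF T] and B = invertible_transpose[OF S]
  have AB: "transpose T ** transpose S = mat 1" "transpose S ** transpose T = mat 1"
    using TS by (simp_all add: matrix_transpose_mul[symmetric] transpose_mat)
  show "sphere_map ?A \<in> cone_measure ?TK \<rightarrow>\<^sub>M cone_measure K"
    using measurable_sphere_map[OF A] by (simp add: cone_measure_def)
  show "sphere_map (transpose S) \<in> cone_measure K \<rightarrow>\<^sub>M cone_measure ?TK"
    using measurable_sphere_map[OF B] by (simp add: cone_measure_def)
  show "sphere_map (transpose S) (sphere_map ?A y) = y" if "y \<in> space (cone_measure ?TK)" for y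
    using sphere_map_inverse[OF AB(2)] that by (simp add: space_cone_measure)
  show "sphere_map ?A (sphere_map (transpose S) x) = x" if "x \<in> space (cone_measure K)" for x
    using sphere_map_inverse[OF AB(1)] that by (simp add: space_cone_measure)
  show "\<bar>det T\<bar> > 0" using T by (simp add: invertible_det_nz)
  have "continuous_on (sphere 0 1) (hom_ext (support_fun K))"
    by (rule continuous_on_subset[OF C2_on_continuous[OF C[unfolded C2_sphere_def]]]) auto
  then have hc: "continuous_on (sphere 0 1) (support_fun K)"
    by (rule continuous_on_eq) (simp add: hom_ext_sphere)
  show "distr (cone_measure ?TK) (cone_measure K) (sphere_map ?A) = scale_measure (ennreal \<bar>det T\<bar>) (cone_measure K)"
    unfolding cone_measure_def
  proof (rule distr_density_sphere_map[OF A])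
    show "(\<lambda>\<theta>. support_fun K \<theta> * mat_det ?m (D2 (support_fun K) \<theta>) / real CARD('n)) \<in> borel_measurable sphere_measure"
      unfolding divide_inverse
      by (intro continuous_on_sphere_borel_measurable continuous_on_mult continuous_on_const hc
          continuous_on_mat_det_D2[OF C])
    fix \<theta> :: "real ^ 'n" assume \<theta>: "norm \<theta> = 1"
    let ?r = "norm (?A *v \<theta>)"
    have nz: "?A *v \<theta> \<noteq> 0" using \<theta> invertible_mult_eq_0[OF A, of \<theta>] by auto
    then have r: "?r > 0" by simp
    have Ay: "?A *v \<theta> = ?r *\<^sub>R sphere_map ?A \<theta>" using nz by (simp add: sphere_map_def del: transpose_matrix_vector)
    have 1: "support_fun ?TK \<theta> = ?r * support_fun K (sphere_map ?A \<theta>)"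
      unfolding support_fun_linear_image
      by (subst Ay) (use r pos_homogeneous_support_fun[OF K] in \<open>simp add: pos_homogeneous_def del: transpose_matrix_vector\<close>)
    have 2: "mat_det ?m (D2 (support_fun ?TK) \<theta>) =
        (det ?A)\<^sup>2 / ?r ^ (CARD('n) + 1) * mat_det ?m (D2 (support_fun K) (sphere_map ?A \<theta>))"
      by (rule mat_det_D2_linear[OF A \<theta> C hom_ext_support_fun_linear[OF T K]]) (assumption | simp only: sphere_map_def)+
    have "(det ?A)\<^sup>2 = \<bar>det T\<bar> * \<bar>det ?A\<bar>" by (simp add: power2_eq_square)
    then show "support_fun ?TK \<theta> * mat_det ?m (D2 (support_fun ?TK) \<theta>) / real CARD('n) =
      \<bar>det T\<bar> * (\<bar>det ?A\<bar> / ?r ^ CARD('n)) *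
        (support_fun K (sphere_map ?A \<theta>) * mat_det ?m (D2 (support_fun K) (sphere_map ?A \<theta>)) / real CARD('n))"
      unfolding 1 2 using r by (simp add: divide_simps del: transpose_matrix_vector)
  qed simp
qed

text \<open>The transported graph is self-adjoint, has the domain \<open>H\<^sup>2\<close> because \<open>push0 T\<close> and \<open>push0 S\<close> both preserve
  \<open>H\<^sup>2\<close>, and extends the operator on \<open>C\<^sup>2\<close> functions by \<open>hbm_C2_push0\<close>, applied to \<open>S = T\<^sup>-\<^sup>1\<close>.\<close>

lemma hbm_extension_pull_graph:
  fixes T S :: "real ^ 'n ^ 'n"
  assumes T: "invertible T" and TS: "T ** S = mat 1" "S ** T = mat 1"
    and K: "bounded K" "K \<noteq> {}" and C: "C2_sphere (support_fun K)" and G: "hbm_extension K G"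
  shows "hbm_extension ((\<lambda>x. T *v x) ` K) (pull_graph (sphere_map (transpose S)) G)"
proof -
  let ?A = "transpose T" and ?B = "transpose S" and ?TK = "(\<lambda>x. T *v x) ` K"
  interpret scaled_measure_iso "cone_measure K" "cone_measure ?TK" "sphere_map ?A" "sphere_map ?B" "\<bar>det T\<bar>"
    by (rule scaled_measure_iso_cone_measure[OF T TS K C])
  have S: "invertible S" using TS by (auto simp: invertible_def)
  have sa: "self_adjoint (cone_measure K) G" and dom: "Domain G = H2_sphere"
    and C2: "\<And>z. C2_sphere z \<Longrightarrow> (z, hbm_C2 K z) \<in> G"
    using G by (auto simp: hbm_extension_def)
  note resp = self_adjoint_respects_space[OF sa]
  show ?thesis
    unfolding hbm_extension_def
  proof (intro conjI allI impI)
    show "self_adjoint (cone_measure ?TK) (pull_graph (sphere_map ?B) G)"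
      by (rule self_adjoint_pull_graph[OF sa])
    show "Domain (pull_graph (sphere_map ?B) G) = H2_sphere"
    proof (intro set_eqI iffI)
      fix u assume "u \<in> Domain (pull_graph (sphere_map ?B) G)"
      then obtain v where "((\<lambda>x. u (sphere_map ?B x)), (\<lambda>x. v (sphere_map ?B x))) \<in> G"
        by (auto simp: pull_graph_def)
      then have "(\<lambda>x. u (sphere_map ?B x)) \<in> H2_sphere" unfolding dom[symmetric] by (rule DomainI)
      from push0_H2_sphere[OF T this] show "u \<in> H2_sphere"
        by (rule H2_sphere_cong) (simp add: push0_eq_sphere_map \<psi>\<phi> space_cone_measure)
    next
      fix u :: "real ^ 'n \<Rightarrow> real" assume "u \<in> H2_sphere"
      from push0_H2_sphere[OF S this] have "(\<lambda>x. u (sphere_map ?B x)) \<in> Domain G"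
        unfolding dom by (simp only: push0_eq_sphere_map)
      then obtain w where w: "((\<lambda>x. u (sphere_map ?B x)), w) \<in> G" by auto
      have "((\<lambda>x. u (sphere_map ?B x)), (\<lambda>x. w (sphere_map ?A (sphere_map ?B x)))) \<in> G"
        by (rule respects_spaceD[OF resp w]) (simp_all add: \<phi>\<psi>)
      then have "(u, \<lambda>y. w (sphere_map ?A y)) \<in> pull_graph (sphere_map ?B) G"
        by (simp add: pull_graph_def)
      then show "u \<in> Domain (pull_graph (sphere_map ?B) G)" by (rule DomainI)
    qed
    fix z :: "real ^ 'n \<Rightarrow> real" assume z: "C2_sphere z"
    have bTK: "bounded ?TK" "?TK \<noteq> {}"
      using bounded_linear_image[OF K(1) matrix_vector_mul_bounded_linear[of T]] K(2) by auto
    have STK: "(\<lambda>x. S *v x) ` ?TK = K"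
      by (simp add: image_comp comp_def matrix_vector_mul_assoc TS)
    have "(push0 S z, hbm_C2 K (push0 S z)) \<in> G" by (rule C2[OF C2_sphere_push0[OF S z]])
    then have "((\<lambda>x. z (sphere_map ?B x)), (\<lambda>x. hbm_C2 ?TK z (sphere_map ?B x))) \<in> G"
    proof (rule respects_spaceD[OF resp])
      fix \<theta> assume "\<theta> \<in> space (cone_measure K)"
      then have "norm \<theta> = 1" by (simp add: space_cone_measure)
      from hbm_C2_push0[OF S bTK C2_sphere_support_fun_linear_image[OF T K C] z this]
      show "hbm_C2 ?TK z (sphere_map ?B \<theta>) = hbm_C2 K (push0 S z) \<theta>"
        unfolding STK by (simp add: push0_eq_sphere_map)
    qed (simp add: push0_eq_sphere_map)
    then show "(z, hbm_C2 ?TK z) \<in> pull_graph (sphere_map ?B) G" by (simp add: pull_graph_def)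
  qed
qed

text \<open>Extensions for \<open>K\<close> and for \<open>T K\<close> correspond bijectively, so that one is unique if and only if the other
  is; the default graph \<open>{}\<close> corresponds to itself.\<close>

lemma hbm_graph_linear_image:
  fixes T S :: "real ^ 'n ^ 'n"
  assumes T: "invertible T" and TS: "T ** S = mat 1" "S ** T = mat 1"
    and K: "bounded K" "K \<noteq> {}" and C: "C2_sphere (support_fun K)"
  shows "hbm_graph ((\<lambda>x. T *v x) ` K) = pull_graph (sphere_map (transpose S)) (hbm_graph K)"
proof -
  let ?A = "transpose T" and ?B = "transpose S" and ?TK = "(\<lambda>x. T *v x) ` K"
  interpret scaled_measure_iso "cone_measure K" "cone_measure ?TK" "sphere_map ?A" "sphere_map ?B" "\<bar>det T\<bar>"
    by (rule scaled_measure_iso_cone_measure[OF T TS K C])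
  have S: "invertible S" using TS by (auto simp: invertible_def)
  have bTK: "bounded ?TK" "?TK \<noteq> {}"
    using bounded_linear_image[OF K(1) matrix_vector_mul_bounded_linear[of T]] K(2) by auto
  have STK: "(\<lambda>x. S *v x) ` ?TK = K"
    by (simp add: image_comp comp_def matrix_vector_mul_assoc TS)
  have to: "hbm_extension ?TK (pull_graph (sphere_map ?B) G)" if "hbm_extension K G" for G
    by (rule hbm_extension_pull_graph[OF T TS K C that])
  have from': "hbm_extension K (pull_graph (sphere_map ?A) H)" if "hbm_extension ?TK H" for H
    using hbm_extension_pull_graph[OF S TS(2,1) bTK C2_sphere_support_fun_linear_image[OF T K C] that]
    unfolding STK .
  have inv1: "pull_graph (sphere_map ?A) (pull_graph (sphere_map ?B) G) = G" if "hbm_extension K G" for G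
    by (rule pull_graph_pull_graph[OF self_adjoint_respects_space]) (use that in \<open>simp add: hbm_extension_def\<close>)
  have inv2: "pull_graph (sphere_map ?B) (pull_graph (sphere_map ?A) H) = H" if "hbm_extension ?TK H" for H
    by (rule scaled_measure_iso.pull_graph_pull_graph[OF converse self_adjoint_respects_space])
      (use that in \<open>simp add: hbm_extension_def\<close>)
  show ?thesis
  proof (cases "\<exists>!G. hbm_extension K G")
    case True
    then obtain G where G: "hbm_extension K G" and uniq: "\<And>G'. hbm_extension K G' \<Longrightarrow> G' = G" by blast
    have uniq': "H = pull_graph (sphere_map ?B) G" if "hbm_extension ?TK H" for H
      using uniq[OF from'[OF that]] inv2[OF that] by simp
    have "(THE G. hbm_extension K G) = G" by (rule the_equality) (rule G, erule uniq)
    moreover have "(THE H. hbm_extension ?TK H) = pull_graph (sphere_map ?B) G"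
      by (rule the_equality) (rule to[OF G], erule uniq')
    moreover have "\<exists>!H. hbm_extension ?TK H" by (rule ex1I) (rule to[OF G], erule uniq')
    ultimately show ?thesis using True by (simp add: hbm_graph_def)
  next
    case False
    have "\<not> (\<exists>!H. hbm_extension ?TK H)"
    proof
      assume "\<exists>!H. hbm_extension ?TK H"
      then obtain H where H: "hbm_extension ?TK H" and uniq: "\<And>H'. hbm_extension ?TK H' \<Longrightarrow> H' = H" by blast
      have "\<exists>!G. hbm_extension K G"
      proof (rule ex1I)
        show "hbm_extension K (pull_graph (sphere_map ?A) H)" by (rule from'[OF H])
        fix G assume G: "hbm_extension K G"
        show "G = pull_graph (sphere_map ?A) H"
          using uniq[OF to[OF G]] inv1[OF G] by simp
      qed
      with False show False by simp
    qed
    then show ?thesis using False by (simp add: hbm_graph_def pull_graph_def)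
  qed
qed

lemma hbm_graph_cases:
  obtains "hbm_graph K = {}" | "hbm_extension K (hbm_graph K)"
proof (cases "\<exists>!G. hbm_extension K G")
  case True
  from theI'[OF this] that(2) True show thesis by (simp add: hbm_graph_def)
next
  case False
  then show thesis using that(1) by (simp add: hbm_graph_def)
qed

lemma hbm_graph_respects_space: "respects_space (cone_measure K) (hbm_graph K)"
  and hbm_graph_subset_L2: "hbm_graph K \<subseteq> L2 (cone_measure K) \<times> L2 (cone_measure K)"
proof -
  have "respects_space (cone_measure K) (hbm_graph K) \<and> hbm_graph K \<subseteq> L2 (cone_measure K) \<times> L2 (cone_measure K)"
  proof (cases K rule: hbm_graph_cases)
    case 2
    then have "self_adjoint (cone_measure K) (hbm_graph K)" by (simp add: hbm_extension_def)
    from self_adjoint_respects_space[OF this] self_adjoint_subset_L2[OF this] show ?thesis by simp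
  qed (simp add: respects_space_def)
  then show "respects_space (cone_measure K) (hbm_graph K)"
    "hbm_graph K \<subseteq> L2 (cone_measure K) \<times> L2 (cone_measure K)" by simp_all
qed

lemma hbm_in_graph: "z \<in> Domain (hbm_graph K) \<Longrightarrow> (z, hbm K z) \<in> hbm_graph K"
proof -
  assume z: "z \<in> Domain (hbm_graph K)"
  then have "\<exists>w. (z, w) \<in> hbm_graph K" by auto
  from someI_ex[OF this] show ?thesis using z by (simp add: hbm_def)
qed

lemma measure_lebesgue_linear_image:
  fixes T :: "real ^ 'n ^ 'n"
  assumes T: "invertible T" and K: "compact K"
  shows "measure lebesgue ((\<lambda>x. T *v x) ` K) = \<bar>det T\<bar> * measure lebesgue K"
proof -
  let ?TK = "(\<lambda>x. T *v x) ` K"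
  have "compact ?TK"
    by (rule compact_continuous_image[OF matrix_vector_mult_linear_continuous_on K])
  then have b: "?TK \<in> sets borel" "K \<in> sets borel" using K by (simp_all add: borel_compact)
  have ind: "indicator ?TK (T *v x) = (indicator K x :: ennreal)" for x
  proof -
    have "x \<in> K" if "T *v x = T *v y" "y \<in> K" for y
      using that invertible_mult_eq_0[OF T, of "x - y"] by (simp add: matrix_vector_mult_diff_distrib)
    then show ?thesis by (auto simp: indicator_def)
  qed
  have "emeasure lborel ?TK = (\<integral>\<^sup>+x. indicator ?TK x \<partial>lborel)" using b by simp
  also have "\<dots> = ennreal \<bar>det T\<bar> * (\<integral>\<^sup>+x. indicator ?TK (T *v x) \<partial>lborel)"
    by (rule nn_integral_lborel_linear[OF T]) (use b in measurable)
  also have "\<dots> = ennreal \<bar>det T\<bar> * emeasure lborel K"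
    unfolding ind using b by simp
  finally have "emeasure lborel ?TK = ennreal \<bar>det T\<bar> * emeasure lborel K" .
  then have "measure lborel ?TK = \<bar>det T\<bar> * measure lborel K"
    by (simp add: measure_def enn2real_mult)
  then show ?thesis using b by (simp add: measure_completion)
qed

theorem theorem5p8:
  fixes K :: "(real ^ 'n) set" and T :: "real ^ 'n ^ 'n"
  assumes "CARD('n) \<ge> 2" and "K \<in> K2_plus" and "invertible T"
  shows "let TK = (\<lambda>x. T *v x) ` K in
      (\<forall>z\<in>H2_sphere. push0 T z \<in> H2_sphere) \<and>
      (\<forall>z\<in>L2 (cone_measure K). push0 T z \<in> L2 (cone_measure TK)) \<and>
      (\<forall>z. C2_sphere z \<longrightarrow> C2_sphere (push0 T z) \<and>
         (\<forall>\<theta>\<in>sphere 0 1. hbm_C2 TK (push0 T z) \<theta> = push0 T (hbm_C2 K z) \<theta>)) \<and>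
      (\<forall>z\<in>H2_sphere. AE \<theta> in cone_measure TK. hbm TK (push0 T z) \<theta> = push0 T (hbm K z) \<theta>) \<and>
      hilbert_isometry (normalized_cone_measure K) (normalized_cone_measure TK) (push0 T) \<and>
      conjugate_via (cone_measure K) (push0 T) (hbm_graph K) (hbm_graph TK) \<and>
      spectrum (cone_measure K) (neg_graph (hbm_graph K)) =
        spectrum (cone_measure TK) (neg_graph (hbm_graph TK))"
proof -
  let ?TK = "(\<lambda>x. T *v x) ` K" and ?A = "transpose T"
  note T = assms(3)
  have cK: "compact K" using assms(2) by (simp add: K2_plus_def)
  have K: "bounded K" "K \<noteq> {}"
    using compact_imp_bounded[OF cK] assms(2) interior_subset by (auto simp: K2_plus_def)
  note C = C2_sphere_support_fun[OF assms(2)]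
  obtain S where TS: "T ** S = mat 1" "S ** T = mat 1" using T by (auto simp: invertible_def)
  let ?B = "transpose S"
  interpret scaled_measure_iso "cone_measure K" "cone_measure ?TK" "sphere_map ?A" "sphere_map ?B" "\<bar>det T\<bar>"
    by (rule scaled_measure_iso_cone_measure[OF T TS K C])
  have push0: "push0 T = (\<lambda>f y. f (sphere_map ?A y))"
    by (simp add: fun_eq_iff push0_eq_sphere_map)
  note graph = hbm_graph_linear_image[OF T TS K C]
  have comp: "(push0 T z, push0 T w) \<in> hbm_graph ?TK \<longleftrightarrow> (z, w) \<in> hbm_graph K" for z w
    unfolding graph push0 by (rule pull_graph_comp_iff[OF hbm_graph_respects_space])
  have AE: "AE \<theta> in cone_measure ?TK. hbm ?TK (push0 T z) \<theta> = push0 T (hbm K z) \<theta>" if z: "z \<in> H2_sphere" for z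
  proof (cases K rule: hbm_graph_cases)
    case 1
    then have "hbm_graph ?TK = {}" unfolding graph by (simp add: pull_graph_def)
    with 1 show ?thesis by (simp add: hbm_def push0_def)
  next
    case 2
    have "hbm_extension ?TK (hbm_graph ?TK)"
      unfolding graph by (rule hbm_extension_pull_graph[OF T TS K C 2])
    then have sa: "self_adjoint (cone_measure ?TK) (hbm_graph ?TK)" by (simp add: hbm_extension_def)
    have "z \<in> Domain (hbm_graph K)" using 2 z by (simp add: hbm_extension_def)
    then have "(push0 T z, push0 T (hbm K z)) \<in> hbm_graph ?TK"
      unfolding comp by (rule hbm_in_graph)
    then have "(push0 T z, hbm ?TK (push0 T z)) \<in> hbm_graph ?TK" and
      *: "(push0 T z, push0 T (hbm K z)) \<in> hbm_graph ?TK"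
      by (auto intro: hbm_in_graph)
    then show ?thesis by (rule self_adjoint_single_valued[OF sa])
  qed
  have iso: "hilbert_isometry (normalized_cone_measure K) (normalized_cone_measure ?TK) (push0 T)"
  proof -
    have "ennreal (1 / measure lebesgue ?TK) * ennreal \<bar>det T\<bar> = ennreal (1 / measure lebesgue K)"
    proof -
      have "0 \<le> 1 / (\<bar>det T\<bar> * measure lebesgue K)" "0 \<le> \<bar>det T\<bar>" by simp_all
      from ennreal_mult[OF this] show ?thesis
        unfolding measure_lebesgue_linear_image[OF T cK] using r by simp
    qed
    from scaled_measure_iso.hilbert_isometry_comp[OF scale[OF this] refl]
    show ?thesis unfolding normalized_cone_measure_def push0 .
  qed
  have conj: "conjugate_via (cone_measure K) (push0 T) (hbm_graph K) (hbm_graph ?TK)"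
    unfolding conjugate_via_def comp by simp
  have spec: "spectrum (cone_measure K) (neg_graph (hbm_graph K)) =
      spectrum (cone_measure ?TK) (neg_graph (hbm_graph ?TK))"
    unfolding graph by (rule spectrum_pull_graph[OF hbm_graph_respects_space hbm_graph_subset_L2])
  have L2: "push0 T z \<in> L2 (cone_measure ?TK)" if "z \<in> L2 (cone_measure K)" for z
    unfolding push0 by (rule L2_comp[OF that])
  show ?thesis
    unfolding Let_def
    using push0_H2_sphere[OF T] L2 C2_sphere_push0[OF T] hbm_C2_push0[OF T K C] AE iso conj spec
    by (intro conjI ballI allI impI) simp_all
qed

end
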